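(* Let $(\mathcal{C}, \otimes, I)$ be a monoidal category, let $L(\mathcal{C})$ be the free autonomous category on $\mathcal{C}$, and let $F : \mathcal{C} \to L(\mathcal{C})$ be the canonical strong monoidal embedding functor. Then $F$ is full: for all objects $A, B$ of $\mathcal{C}$, every morphism $F(A) \to F(B)$ in $L(\mathcal{C})$ is of the form $F(g)$ for some morphism $g : A \to B$ in $\mathcal{C}$.
   Context: Monoidal categories are not assumed to be symmetric or braided. An autonomous (or rigid) category is a monoidal category $(\mathcal{D}, \otimes, I)$ in which every object $A$ has both a left adjoint (left dual) and a right adjoint (right dual): there are objects $A^l$, $A^r$ and morphisms $\epsilon_l : A^l \otimes A \to I$, $\eta_l : I \to A \otimes A^l$, $\epsilon_r : A \otimes A^r \to I$, $\eta_r : I \to A^r \otimes A$ satisfying the usual triangle (yanking, or snake) equations. A strong monoidal functor is a functor equipped with coherent natural isomorphisms $F(A) \otimes F(B) \cong F(A \otimes B)$ and an isomorphism $I \cong F(I)$. The free autonomous category on a monoidal category $\mathcal{C}$ is an autonomous category $L(\mathcal{C})$ with a strong monoidal functor $F : \mathcal{C} \to L(\mathcal{C})$ (the embedding functor) such that, for every autonomous category $\mathcal{D}$ and every strong monoidal functor $G : \mathcal{C} \to \mathcal{D}$: (1) there exist a strong monoidal functor $G' : L(\mathcal{C}) \to \mathcal{D}$ and a monoidal natural isomorphism $\varphi : G' \circ F \Rightarrow G$; (2) for any two such pairs $(G'_1, \varphi_1)$, $(G'_2, \varphi_2)$ there is a unique monoidal natural isomorphism $\theta : G'_1 \Rightarrow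 G'_2$ with $\varphi_2 \circ (\theta F) = \varphi_1$. Such a pair $(L(\mathcal{C}), F)$ exists for every monoidal category $\mathcal{C}$ and is unique up to monoidal equivalence compatible with $F$ up to monoidal natural isomorphism. Informally, the morphisms of $L(\mathcal{C})$ are planar string diagrams whose nodes are labelled by morphisms of $\mathcal{C}$ and whose wires, labelled by objects of $\mathcal{C}$, may bend (formal units and counits), modulo planar deformation and the equations of composition, tensor product and identities holding in $\mathcal{C}$. *)

theory Defs
  imports Main "HOL-Library.FuncSet"
begin

section \<open>Categories and monoidal categories\<close>

text \<open>
  Structures are records with explicit carriers; the values of the operations outside
  the carriers are irrelevant. Composition is written in applicative order.
\<close>

record ('o, 'a) cat =
  obj :: "'o set"
  arr :: "'a set"
  src :: "'a \<Rightarrow> 'o"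
  trg :: "'a \<Rightarrow> 'o"
  ident :: "'o \<Rightarrow> 'a"
  comp :: "'a \<Rightarrow> 'a \<Rightarrow> 'a"  (infixl "\<cdot>\<index>" 60)

record ('o, 'a) moncat = "('o, 'a) cat" +
  tensor_obj :: "'o \<Rightarrow> 'o \<Rightarrow> 'o"  (infixl "\<otimes>\<index>" 70)
  tensor_arr :: "'a \<Rightarrow> 'a \<Rightarrow> 'a"  (infixl "\<boxtimes>\<index>" 70)
  unit :: 'o
  assoc :: "'o \<Rightarrow> 'o \<Rightarrow> 'o \<Rightarrow> 'a"
  lunit :: "'o \<Rightarrow> 'a"
  runit :: "'o \<Rightarrow> 'a"

definition hom :: "('o, 'a, 'x) cat_scheme \<Rightarrow> 'o \<Rightarrow> 'o \<Rightarrow> 'a set" where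
  "hom C A B = {f \<in> arr C. src C f = A \<and> trg C f = B}"

locale category =
  fixes C :: "('o, 'a, 'x) cat_scheme" (structure)
  assumes src_in_obj: "f \<in> arr C \<Longrightarrow> src C f \<in> obj C"
    and trg_in_obj: "f \<in> arr C \<Longrightarrow> trg C f \<in> obj C"
    and ident_in_hom: "A \<in> obj C \<Longrightarrow> ident C A \<in> hom C A A"
    and comp_in_hom: "\<lbrakk>f \<in> hom C A B; g \<in> hom C B D\<rbrakk> \<Longrightarrow> g \<cdot> f \<in> hom C A D"
    and comp_ident_right: "f \<in> hom C A B \<Longrightarrow> f \<cdot> ident C A = f"
    and comp_ident_left: "f \<in> hom C A B \<Longrightarrow> ident C B \<cdot> f = f"
    and comp_assoc: "\<lbrakk>f \<in> hom C A B; g \<in> hom C B D; h \<in> hom C D E\<rbrakk>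
        \<Longrightarrow> h \<cdot> (g \<cdot> f) = (h \<cdot> g) \<cdot> f"

definition inverse_arrows :: "('o, 'a, 'x) cat_scheme \<Rightarrow> 'a \<Rightarrow> 'a \<Rightarrow> bool" where
  "inverse_arrows C f g \<longleftrightarrow>
     f \<in> arr C \<and> g \<in> hom C (trg C f) (src C f) \<and>
     comp C g f = ident C (src C f) \<and> comp C f g = ident C (trg C f)"

definition iso :: "('o, 'a, 'x) cat_scheme \<Rightarrow> 'a \<Rightarrow> bool" where
  "iso C f \<longleftrightarrow> (\<exists>g. inverse_arrows C f g)"

definition inverse_arr :: "('o, 'a, 'x) cat_scheme \<Rightarrow> 'a \<Rightarrow> 'a" where
  "inverse_arr C f = (THE g. inverse_arrows C f g)"

locale monoidal_category = category C
  for C :: "('o, 'a, 'x) moncat_scheme" (structure) +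
  assumes unit_in_obj: "unit C \<in> obj C"
    and tensor_in_obj: "\<lbrakk>A \<in> obj C; B \<in> obj C\<rbrakk> \<Longrightarrow> A \<otimes> B \<in> obj C"
    and tensor_in_hom: "\<lbrakk>f \<in> hom C A A'; g \<in> hom C B B'\<rbrakk>
        \<Longrightarrow> f \<boxtimes> g \<in> hom C (A \<otimes> B) (A' \<otimes> B')"
    and tensor_ident: "\<lbrakk>A \<in> obj C; B \<in> obj C\<rbrakk>
        \<Longrightarrow> ident C A \<boxtimes> ident C B = ident C (A \<otimes> B)"
    and interchange: "\<lbrakk>f \<in> hom C A A'; f' \<in> hom C A' A''; g \<in> hom C B B'; g' \<in> hom C B' B''\<rbrakk>
        \<Longrightarrow> (f' \<cdot> f) \<boxtimes> (g' \<cdot> g) = (f' \<boxtimes> g') \<cdot> (f \<boxtimes> g)"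
    and assoc_in_hom: "\<lbrakk>A \<in> obj C; B \<in> obj C; D \<in> obj C\<rbrakk>
        \<Longrightarrow> assoc C A B D \<in> hom C ((A \<otimes> B) \<otimes> D) (A \<otimes> (B \<otimes> D))"
    and assoc_iso: "\<lbrakk>A \<in> obj C; B \<in> obj C; D \<in> obj C\<rbrakk> \<Longrightarrow> iso C (assoc C A B D)"
    and assoc_natural: "\<lbrakk>f \<in> hom C A A'; g \<in> hom C B B'; h \<in> hom C D D'\<rbrakk>
        \<Longrightarrow> assoc C A' B' D' \<cdot> ((f \<boxtimes> g) \<boxtimes> h) = (f \<boxtimes> (g \<boxtimes> h)) \<cdot> assoc C A B D"
    and lunit_in_hom: "A \<in> obj C \<Longrightarrow> lunit C A \<in> hom C (unit C \<otimes> A) A"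
    and lunit_iso: "A \<in> obj C \<Longrightarrow> iso C (lunit C A)"
    and lunit_natural: "f \<in> hom C A A'
        \<Longrightarrow> lunit C A' \<cdot> (ident C (unit C) \<boxtimes> f) = f \<cdot> lunit C A"
    and runit_in_hom: "A \<in> obj C \<Longrightarrow> runit C A \<in> hom C (A \<otimes> unit C) A"
    and runit_iso: "A \<in> obj C \<Longrightarrow> iso C (runit C A)"
    and runit_natural: "f \<in> hom C A A'
        \<Longrightarrow> runit C A' \<cdot> (f \<boxtimes> ident C (unit C)) = f \<cdot> runit C A"
    and pentagon: "\<lbrakk>A \<in> obj C; B \<in> obj C; D \<in> obj C; E \<in> obj C\<rbrakk>
        \<Longrightarrow> assoc C A B (D \<otimes> E) \<cdot> assoc C (A \<otimes> B) D E
          = (ident C A \<boxtimes> assoc C B D E) \<cdot> assoc C A (B \<otimes> D) E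
              \<cdot> (assoc C A B D \<boxtimes> ident C E)"
    and triangle: "\<lbrakk>A \<in> obj C; B \<in> obj C\<rbrakk>
        \<Longrightarrow> (ident C A \<boxtimes> lunit C B) \<cdot> assoc C A (unit C) B = runit C A \<boxtimes> ident C B"


section \<open>Autonomous categories\<close>

text \<open>
  \<open>adjunction C X A e n\<close> states that \<open>X\<close> is a left adjoint of \<open>A\<close> (equivalently, by
  definition, that \<open>A\<close> is a right adjoint of \<open>X\<close>), with counit \<open>e : X \<otimes> A \<rightarrow> I\<close> and
  unit \<open>n : I \<rightarrow> A \<otimes> X\<close>. The last two conjuncts are the snake equations on \<open>A\<close> and \<open>X\<close>.
\<close>

definition adjunction ::
  "('o, 'a, 'x) moncat_scheme \<Rightarrow> 'o \<Rightarrow> 'o \<Rightarrow> 'a \<Rightarrow> 'a \<Rightarrow> bool" where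
  "adjunction C X A e n \<longleftrightarrow>
     X \<in> obj C \<and> A \<in> obj C \<and>
     e \<in> hom C (X \<otimes>\<^bsub>C\<^esub> A) (unit C) \<and> n \<in> hom C (unit C) (A \<otimes>\<^bsub>C\<^esub> X) \<and>
     runit C A \<cdot>\<^bsub>C\<^esub> (ident C A \<boxtimes>\<^bsub>C\<^esub> e) \<cdot>\<^bsub>C\<^esub> assoc C A X A
       \<cdot>\<^bsub>C\<^esub> (n \<boxtimes>\<^bsub>C\<^esub> ident C A) \<cdot>\<^bsub>C\<^esub> inverse_arr C (lunit C A) = ident C A \<and>
     lunit C X \<cdot>\<^bsub>C\<^esub> (e \<boxtimes>\<^bsub>C\<^esub> ident C X) \<cdot>\<^bsub>C\<^esub> inverse_arr C (assoc C X A X)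
       \<cdot>\<^bsub>C\<^esub> (ident C X \<boxtimes>\<^bsub>C\<^esub> n) \<cdot>\<^bsub>C\<^esub> inverse_arr C (runit C X) = ident C X"

locale autonomous_category = monoidal_category C
  for C :: "('o, 'a, 'x) moncat_scheme" (structure) +
  assumes left_adjoint_exists: "A \<in> obj C \<Longrightarrow> \<exists>Al e n. adjunction C Al A e n"
    and right_adjoint_exists: "A \<in> obj C \<Longrightarrow> \<exists>Ar e n. adjunction C A Ar e n"


section \<open>Strong monoidal functors and monoidal natural isomorphisms\<close>

record ('o, 'a, 'p, 'b) monfun =
  fobj :: "'o \<Rightarrow> 'p"
  farr :: "'a \<Rightarrow> 'b"
  fmult :: "'o \<Rightarrow> 'o \<Rightarrow> 'b"
  funit :: 'b

locale strong_monoidal_functor =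
  C: monoidal_category C + D: monoidal_category D
  for C :: "('o, 'a) moncat" and D :: "('p, 'b) moncat" +
  fixes F :: "('o, 'a, 'p, 'b) monfun"
  assumes fobj_in_obj: "A \<in> obj C \<Longrightarrow> fobj F A \<in> obj D"
    and farr_in_hom: "f \<in> hom C A B \<Longrightarrow> farr F f \<in> hom D (fobj F A) (fobj F B)"
    and farr_ident: "A \<in> obj C \<Longrightarrow> farr F (ident C A) = ident D (fobj F A)"
    and farr_comp: "\<lbrakk>f \<in> hom C A B; g \<in> hom C B E\<rbrakk>
        \<Longrightarrow> farr F (g \<cdot>\<^bsub>C\<^esub> f) = farr F g \<cdot>\<^bsub>D\<^esub> farr F f"
    and fmult_in_hom: "\<lbrakk>A \<in> obj C; B \<in> obj C\<rbrakk>
        \<Longrightarrow> fmult F A B \<in> hom D (fobj F A \<otimes>\<^bsub>D\<^esub> fobj F B) (fobj F (A \<otimes>\<^bsub>C\<^esub> B))"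
    and fmult_iso: "\<lbrakk>A \<in> obj C; B \<in> obj C\<rbrakk> \<Longrightarrow> iso D (fmult F A B)"
    and fmult_natural: "\<lbrakk>f \<in> hom C A A'; g \<in> hom C B B'\<rbrakk>
        \<Longrightarrow> fmult F A' B' \<cdot>\<^bsub>D\<^esub> (farr F f \<boxtimes>\<^bsub>D\<^esub> farr F g)
          = farr F (f \<boxtimes>\<^bsub>C\<^esub> g) \<cdot>\<^bsub>D\<^esub> fmult F A B"
    and funit_in_hom: "funit F \<in> hom D (unit D) (fobj F (unit C))"
    and funit_iso: "iso D (funit F)"
    and assoc_coherence: "\<lbrakk>A \<in> obj C; B \<in> obj C; E \<in> obj C\<rbrakk>
        \<Longrightarrow> farr F (assoc C A B E) \<cdot>\<^bsub>D\<^esub> fmult F (A \<otimes>\<^bsub>C\<^esub> B) E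
              \<cdot>\<^bsub>D\<^esub> (fmult F A B \<boxtimes>\<^bsub>D\<^esub> ident D (fobj F E))
          = fmult F A (B \<otimes>\<^bsub>C\<^esub> E) \<cdot>\<^bsub>D\<^esub> (ident D (fobj F A) \<boxtimes>\<^bsub>D\<^esub> fmult F B E)
              \<cdot>\<^bsub>D\<^esub> assoc D (fobj F A) (fobj F B) (fobj F E)"
    and lunit_coherence: "A \<in> obj C
        \<Longrightarrow> farr F (lunit C A) \<cdot>\<^bsub>D\<^esub> fmult F (unit C) A
              \<cdot>\<^bsub>D\<^esub> (funit F \<boxtimes>\<^bsub>D\<^esub> ident D (fobj F A))
          = lunit D (fobj F A)"
    and runit_coherence: "A \<in> obj C
        \<Longrightarrow> farr F (runit C A) \<cdot>\<^bsub>D\<^esub> fmult F A (unit C)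
              \<cdot>\<^bsub>D\<^esub> (ident D (fobj F A) \<boxtimes>\<^bsub>D\<^esub> funit F)
          = runit D (fobj F A)"

definition monfun_comp ::
  "('q, 'c) moncat \<Rightarrow> ('p, 'b, 'q, 'c) monfun \<Rightarrow> ('o, 'a, 'p, 'b) monfun \<Rightarrow> ('o, 'a, 'q, 'c) monfun"
where
  "monfun_comp E G F =
     \<lparr>fobj = (\<lambda>A. fobj G (fobj F A)),
      farr = (\<lambda>f. farr G (farr F f)),
      fmult = (\<lambda>A B. farr G (fmult F A B) \<cdot>\<^bsub>E\<^esub> fmult G (fobj F A) (fobj F B)),
      funit = farr G (funit F) \<cdot>\<^bsub>E\<^esub> funit G\<rparr>"

text \<open>
  A transformation is its family of components. Membership in \<open>extensional (obj C)\<close> only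
  normalises the family outside the objects of \<open>C\<close>, so that two transformations are equal
  as functions iff their components agree.
\<close>

definition monoidal_nat_iso ::
  "('o, 'a) moncat \<Rightarrow> ('p, 'b) moncat \<Rightarrow> ('o, 'a, 'p, 'b) monfun \<Rightarrow> ('o, 'a, 'p, 'b) monfun
    \<Rightarrow> ('o \<Rightarrow> 'b) \<Rightarrow> bool" where
  "monoidal_nat_iso C D F G t \<longleftrightarrow>
     t \<in> extensional (obj C) \<and>
     (\<forall>A \<in> obj C. t A \<in> hom D (fobj F A) (fobj G A) \<and> iso D (t A)) \<and>
     (\<forall>A \<in> obj C. \<forall>B \<in> obj C. \<forall>f \<in> hom C A B.
        t B \<cdot>\<^bsub>D\<^esub> farr F f = farr G f \<cdot>\<^bsub>D\<^esub> t A) \<and>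
     (\<forall>A \<in> obj C. \<forall>B \<in> obj C.
        t (A \<otimes>\<^bsub>C\<^esub> B) \<cdot>\<^bsub>D\<^esub> fmult F A B = fmult G A B \<cdot>\<^bsub>D\<^esub> (t A \<boxtimes>\<^bsub>D\<^esub> t B)) \<and>
     t (unit C) \<cdot>\<^bsub>D\<^esub> funit F = funit G"

definition full_functor :: "('o, 'a) moncat \<Rightarrow> ('p, 'b) moncat \<Rightarrow> ('o, 'a, 'p, 'b) monfun \<Rightarrow> bool"
where
  "full_functor C D F \<longleftrightarrow>
     (\<forall>A \<in> obj C. \<forall>B \<in> obj C. \<forall>h \<in> hom D (fobj F A) (fobj F B).
        \<exists>g \<in> hom C A B. h = farr F g)"


section \<open>Free autonomous categories\<close>

text \<open>
  \<open>extension_along C L F D G G' \<phi>\<close>: the pair of \<open>G' : L \<rightarrow> D\<close> and \<open>\<phi> : G' \<circ> F \<Rightarrow> G\<close>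
  extends \<open>G : C \<rightarrow> D\<close> along \<open>F : C \<rightarrow> L\<close>.
\<close>

definition extension_along ::
  "('o, 'a) moncat \<Rightarrow> ('p, 'b) moncat \<Rightarrow> ('o, 'a, 'p, 'b) monfun
    \<Rightarrow> ('q, 'c) moncat \<Rightarrow> ('o, 'a, 'q, 'c) monfun
    \<Rightarrow> ('p, 'b, 'q, 'c) monfun \<Rightarrow> ('o \<Rightarrow> 'c) \<Rightarrow> bool" where
  "extension_along C L F D G G' \<phi> \<longleftrightarrow>
     strong_monoidal_functor L D G' \<and> monoidal_nat_iso C D (monfun_comp D G' F) G \<phi>"

text \<open>
  The universal property quantifies over all autonomous categories, which a formula of
  higher-order logic can only do for categories over a given type. The type \<open>'u\<close> plays the
  role of a universe: the test categories \<open>D\<close> are all autonomous categories whose objects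
  and arrows are elements of \<open>'u\<close>. This is meant to be used for an infinite type \<open>'u\<close> in
  which \<open>C\<close> and \<open>L\<close> themselves are small in the sense of \<open>small_in\<close> below.
\<close>

definition free_autonomous ::
  "'u itself \<Rightarrow> ('o, 'a) moncat \<Rightarrow> ('p, 'b) moncat \<Rightarrow> ('o, 'a, 'p, 'b) monfun \<Rightarrow> bool" where
  "free_autonomous U C L F \<longleftrightarrow>
     autonomous_category L \<and> strong_monoidal_functor C L F \<and>
     (\<forall>(D :: ('u, 'u) moncat) G.
        autonomous_category D \<longrightarrow> strong_monoidal_functor C D G \<longrightarrow>
          (\<exists>G' \<phi>. extension_along C L F D G G' \<phi>) \<and>
          (\<forall>G1 \<phi>1 G2 \<phi>2.
             extension_along C L F D G G1 \<phi>1 \<longrightarrow> extension_along C L F D G G2 \<phi>2 \<longrightarrow>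
             (\<exists>!\<theta>. monoidal_nat_iso L D G1 G2 \<theta> \<and>
                   (\<forall>A \<in> obj C. \<phi>2 A \<cdot>\<^bsub>D\<^esub> \<theta> (fobj F A) = \<phi>1 A))))"

text \<open>
  Only the arrows are mentioned, since objects inject into arrows via identities.
\<close>

definition small_in :: "'u itself \<Rightarrow> ('o, 'a, 'x) cat_scheme \<Rightarrow> bool" where
  "small_in U C \<longleftrightarrow> (\<exists>i :: 'a \<Rightarrow> 'u. inj_on i (arr C))"

end

theory Submission
  imports Defs
begin

text \<open>
  Up to isomorphism, the objects of \<open>L\<close> are words of letters \<open>A\<^sup>(\<^sup>n\<^sup>)\<close>, the \<open>n\<close>-th iterated dual
  (\<open>n \<in> \<int>\<close>, its winding) of \<open>F A\<close>, and the arrows are generated by the arrows of \<open>C\<close>, on letters of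
  winding \<open>0\<close>, and the caps \<open>A\<^sup>(\<^sup>n\<^sup>) A\<^sup>(\<^sup>n\<^sup>+\<^sup>1\<^sup>) \<rightarrow> I\<close> and cups \<open>I \<rightarrow> A\<^sup>(\<^sup>n\<^sup>+\<^sup>1\<^sup>) A\<^sup>(\<^sup>n\<^sup>)\<close>.
  In a composite of generators between words of winding \<open>0\<close>, a letter of the highest winding
  \<open>n > 0\<close> is created by a cup and destroyed by a cap, and no other generator touches it. In between it
  separates the plane, so that everything on its left can be done before everything on its right, and the
  cup and the cap cancel by a snake equation. Dually for the lowest winding. When no other winding
  is left, no cup or cap is left, and the composite lies in the image of \<open>F\<close>.

  That the arrows are generated in this way follows from the universal property. The composites
  of generators form an autonomous subcategory of a strictification \<open>W\<close> of \<open>L\<close>, so that \<open>F\<close> extends to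
  \<open>L\<close> with values in the subcategory. By uniqueness this extension is isomorphic, as a functor to \<open>W\<close>,
  to the embedding of \<open>L\<close> into \<open>W\<close>, compatibly with \<open>F\<close>.
\<close>

section \<open>Monoidal categories\<close>

text \<open>Three obstacles shape the formal proof. A cup and a cap that meet in a letter cancel
  only if they come from the same adjunction; so each pair of consecutive windings of a label
  \<open>A\<close> carries one chosen cap and one chosen cup. Next, in winding 0 the arrows of
  \<open>C\<close> are not enough: the isomorphisms
  \<open>F A \<otimes> F B \<cong> F (A \<otimes> B)\<close> and \<open>I \<cong> F I\<close> and
  their inverses change the length of a word. Such arrows are closed under composition and
  whiskering, so what is left after the elimination multiplies out to a single arrow of
  \<open>C\<close>. Finally, the universal property tests only categories over \<open>'u\<close>,
  while word categories live over lists and families of arrows. An arrow between words is determined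
  by its component at the unit object, and pairs and lists over the infinite type \<open>'u\<close>
  have codes in \<open>'u\<close>, so the word categories have isomorphic copies there.\<close>

lemma in_hom_iff: "f \<in> hom C A B \<longleftrightarrow> f \<in> arr C \<and> src C f = A \<and> trg C f = B"
  by (auto simp: hom_def)

context category
begin

lemma src_obj [simp]: "f \<in> arr C \<Longrightarrow> src C f \<in> obj C"
  and trg_obj [simp]: "f \<in> arr C \<Longrightarrow> trg C f \<in> obj C"
  by (fact src_in_obj trg_in_obj)+

lemma ident_simps [simp]:
  assumes "A \<in> obj C"
  shows "ident C A \<in> arr C" "src C (ident C A) = A" "trg C (ident C A) = A"
  using ident_in_hom[OF assms] by (auto simp: in_hom_iff)

lemma comp_simps [simp]:
  assumes "f \<in> arr C" "g \<in> arr C" "trg C f = src C g"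
  shows "g \<cdot> f \<in> arr C" "src C (g \<cdot> f) = src C f" "trg C (g \<cdot> f) = trg C g"
  using comp_in_hom[of f "src C f" "trg C f" g "trg C g"] assms by (auto simp: in_hom_iff)

lemma comp_ident [simp]:
  assumes "f \<in> arr C"
  shows "src C f = A \<Longrightarrow> f \<cdot> ident C A = f" "trg C f = A \<Longrightarrow> ident C A \<cdot> f = f"
  using comp_ident_right[of f] comp_ident_left[of f] assms by (auto simp: in_hom_iff)

lemma comp_comp [simp]:
  assumes "f \<in> arr C" "g \<in> arr C" "h \<in> arr C" "trg C f = src C g" "trg C g = src C h"
  shows "(h \<cdot> g) \<cdot> f = h \<cdot> (g \<cdot> f)"
  using comp_assoc[of f "src C f" "trg C f" g "trg C g" h "trg C h"] assms by (auto simp: in_hom_iff)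

text \<open>\<open>comp_comp\<close> nests composites to the right, which hides
  \<open>a \<cdot> b\<close> inside \<open>a \<cdot> (b \<cdot> y)\<close>. This form makes an
  equation for \<open>a \<cdot> b\<close> applicable there.\<close>

lemma comp_tail:
  assumes "a \<cdot> b = c" "a \<in> arr C" "b \<in> arr C" "trg C b = src C a" "y \<in> arr C" "trg C y = src C b"
  shows "a \<cdot> (b \<cdot> y) = c \<cdot> y"
  using comp_comp[of y b a] assms by simp

lemma inverse_arrows_unique:
  assumes "inverse_arrows C f g" "inverse_arrows C f h"
  shows "g = h"
proof -
  have "g = (h \<cdot> f) \<cdot> g" using assms by (simp add: inverse_arrows_def in_hom_iff)
  also have "\<dots> = h \<cdot> (f \<cdot> g)" using assms unfolding inverse_arrows_def in_hom_iff by (intro comp_comp) auto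
  also have "\<dots> = h" using assms by (simp add: inverse_arrows_def in_hom_iff)
  finally show ?thesis .
qed

lemma inverse_arr_eq: "inverse_arrows C f g \<Longrightarrow> inverse_arr C f = g"
  unfolding inverse_arr_def using inverse_arrows_unique by blast

lemma inverse_arr_inverse: "iso C f \<Longrightarrow> inverse_arrows C f (inverse_arr C f)"
  using inverse_arr_eq by (auto simp: iso_def)

lemma iso_arr: "iso C f \<Longrightarrow> f \<in> arr C"
  by (auto simp: iso_def inverse_arrows_def)

lemma inverse_simps [simp]:
  assumes "iso C f"
  shows "inverse_arr C f \<in> arr C" "src C (inverse_arr C f) = trg C f" "trg C (inverse_arr C f) = src C f"
    "f \<cdot> inverse_arr C f = ident C (trg C f)" "inverse_arr C f \<cdot> f = ident C (src C f)"
  using inverse_arr_inverse[OF assms] by (auto simp: inverse_arrows_def in_hom_iff)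

lemma inverse_tail [simp]:
  assumes "iso C f" "y \<in> arr C"
  shows "trg C y = trg C f \<Longrightarrow> f \<cdot> (inverse_arr C f \<cdot> y) = y"
    and "trg C y = src C f \<Longrightarrow> inverse_arr C f \<cdot> (f \<cdot> y) = y"
  using comp_tail[OF inverse_simps(4)[OF assms(1)], of y] comp_tail[OF inverse_simps(5)[OF assms(1)], of y]
    iso_arr[OF assms(1)] assms by auto

lemma inverse_arrows_sym: "inverse_arrows C f g \<Longrightarrow> inverse_arrows C g f"
  by (auto simp: inverse_arrows_def in_hom_iff)

lemma iso_inverse [simp]: "iso C f \<Longrightarrow> iso C (inverse_arr C f)"
  unfolding iso_def[of C "inverse_arr C f"] by (rule exI, rule inverse_arrows_sym, rule inverse_arr_inverse)

lemma iso_ident [simp]: "A \<in> obj C \<Longrightarrow> iso C (ident C A)"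
  and inverse_ident [simp]: "A \<in> obj C \<Longrightarrow> inverse_arr C (ident C A) = ident C A"
proof -
  assume "A \<in> obj C"
  then have "inverse_arrows C (ident C A) (ident C A)" by (auto simp: inverse_arrows_def in_hom_iff)
  then show "iso C (ident C A)" "inverse_arr C (ident C A) = ident C A"
    using inverse_arr_eq by (auto simp: iso_def)
qed

lemma iso_comp [simp]:
  assumes "iso C f" "iso C g" "trg C f = src C g"
  shows "iso C (g \<cdot> f)"
proof -
  have "inverse_arrows C (g \<cdot> f) (inverse_arr C f \<cdot> inverse_arr C g)"
    using assms assms(1,2)[THEN iso_arr] by (simp add: inverse_arrows_def in_hom_iff)
  then show ?thesis by (auto simp: iso_def)
qed

lemma inverse_comp:
  assumes "iso C f" "iso C g" "trg C f = src C g"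
  shows "inverse_arr C (g \<cdot> f) = inverse_arr C f \<cdot> inverse_arr C g"
  by (rule inverse_arr_eq) (use assms assms(1,2)[THEN iso_arr] in \<open>simp add: inverse_arrows_def in_hom_iff\<close>)

lemma iso_cancel_right:
  assumes "f \<cdot> y = g \<cdot> y" "iso C y" "f \<in> arr C" "g \<in> arr C" "src C f = trg C y" "src C g = trg C y"
  shows "f = g"
  using arg_cong[OF assms(1), of "\<lambda>k. k \<cdot> inverse_arr C y"] iso_arr[OF assms(2)] assms(2-) by simp

text \<open>Inverts two opposite sides of a commuting square. It turns naturality of a family of
  isomorphisms, or the pentagon, into the corresponding fact about the inverses.\<close>

lemma inverse_square:
  assumes "k' \<cdot> p = q \<cdot> k" "iso C k" "iso C k'" "p \<in> arr C" "q \<in> arr C"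
    and "trg C p = src C k'" "src C p = src C k" "src C q = trg C k" "trg C q = trg C k'"
  shows "inverse_arr C k' \<cdot> q = p \<cdot> inverse_arr C k"
proof -
  have [simp]: "k \<in> arr C" "k' \<in> arr C" using assms iso_arr by auto
  have "inverse_arr C k' \<cdot> q = inverse_arr C k' \<cdot> ((q \<cdot> k) \<cdot> inverse_arr C k)"
    using assms by simp
  also have "\<dots> = p \<cdot> inverse_arr C k"
    unfolding assms(1)[symmetric] using assms(2-) by simp
  finally show ?thesis .
qed

end

section \<open>Monoidal categories: unit coherence, and coherence acting on a further factor\<close>

context monoidal_category
begin

lemma unit_obj [simp]: "unit C \<in> obj C"
  by (fact unit_in_obj)

lemma tensor_obj [simp]: "\<lbrakk>A \<in> obj C; B \<in> obj C\<rbrakk> \<Longrightarrow> A \<otimes> B \<in> obj C"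
  by (fact tensor_in_obj)

lemma tensor_simps [simp]:
  assumes "f \<in> arr C" "g \<in> arr C"
  shows "f \<boxtimes> g \<in> arr C" "src C (f \<boxtimes> g) = src C f \<otimes> src C g" "trg C (f \<boxtimes> g) = trg C f \<otimes> trg C g"
  using tensor_in_hom[of f "src C f" "trg C f" g "src C g" "trg C g"] assms by (auto simp: in_hom_iff)

declare tensor_ident [simp]

lemma tensor_tensor [simp]:
  assumes "f \<in> arr C" "f' \<in> arr C" "g \<in> arr C" "g' \<in> arr C" "trg C f = src C f'" "trg C g = src C g'"
  shows "(f' \<boxtimes> g') \<cdot> (f \<boxtimes> g) = (f' \<cdot> f) \<boxtimes> (g' \<cdot> g)"
  using interchange[of f "src C f" "trg C f" f' "trg C f'" g "src C g" "trg C g" g' "trg C g'"] assms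
  by (auto simp: in_hom_iff)

lemma tensor_tail [simp]:
  assumes "f \<in> arr C" "f' \<in> arr C" "g \<in> arr C" "g' \<in> arr C" "trg C f = src C f'" "trg C g = src C g'"
    and "y \<in> arr C" "trg C y = src C f \<otimes> src C g"
  shows "(f' \<boxtimes> g') \<cdot> ((f \<boxtimes> g) \<cdot> y) = ((f' \<cdot> f) \<boxtimes> (g' \<cdot> g)) \<cdot> y"
  using comp_tail[OF tensor_tensor] assms by simp

lemma assoc_simps [simp]:
  assumes "A \<in> obj C" "B \<in> obj C" "D \<in> obj C"
  shows "assoc C A B D \<in> arr C" "src C (assoc C A B D) = (A \<otimes> B) \<otimes> D"
    "trg C (assoc C A B D) = A \<otimes> (B \<otimes> D)" "iso C (assoc C A B D)"
  using assoc_in_hom[OF assms] assoc_iso[OF assms] by (auto simp: in_hom_iff)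

lemma lunit_simps [simp]:
  assumes "A \<in> obj C"
  shows "lunit C A \<in> arr C" "src C (lunit C A) = unit C \<otimes> A" "trg C (lunit C A) = A" "iso C (lunit C A)"
  using lunit_in_hom[OF assms] lunit_iso[OF assms] by (auto simp: in_hom_iff)

lemma runit_simps [simp]:
  assumes "A \<in> obj C"
  shows "runit C A \<in> arr C" "src C (runit C A) = A \<otimes> unit C" "trg C (runit C A) = A" "iso C (runit C A)"
  using runit_in_hom[OF assms] runit_iso[OF assms] by (auto simp: in_hom_iff)

lemma assoc_nat:
  assumes "f \<in> arr C" "g \<in> arr C" "h \<in> arr C" "trg C f = A'" "trg C g = B'" "trg C h = D'"
  shows "assoc C A' B' D' \<cdot> ((f \<boxtimes> g) \<boxtimes> h) = (f \<boxtimes> (g \<boxtimes> h)) \<cdot> assoc C (src C f) (src C g) (src C h)"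
  using assoc_natural[of f "src C f" A' g "src C g" B' h "src C h" D'] assms by (auto simp: in_hom_iff)

lemma lunit_nat: "f \<in> arr C \<Longrightarrow> trg C f = A' \<Longrightarrow> lunit C A' \<cdot> (ident C (unit C) \<boxtimes> f) = f \<cdot> lunit C (src C f)"
  using lunit_natural[of f "src C f" A'] by (auto simp: in_hom_iff)

lemma runit_nat: "f \<in> arr C \<Longrightarrow> trg C f = A' \<Longrightarrow> runit C A' \<cdot> (f \<boxtimes> ident C (unit C)) = f \<cdot> runit C (src C f)"
  using runit_natural[of f "src C f" A'] by (auto simp: in_hom_iff)

lemma inverse_arrows_tensor:
  assumes "iso C f" "iso C g"
  shows "inverse_arrows C (f \<boxtimes> g) (inverse_arr C f \<boxtimes> inverse_arr C g)"
  using assms assms[THEN iso_arr] by (simp add: inverse_arrows_def in_hom_iff)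

lemma iso_tensor [simp]: "iso C f \<Longrightarrow> iso C g \<Longrightarrow> iso C (f \<boxtimes> g)"
  and inverse_tensor: "iso C f \<Longrightarrow> iso C g \<Longrightarrow> inverse_arr C (f \<boxtimes> g) = inverse_arr C f \<boxtimes> inverse_arr C g"
  using inverse_arrows_tensor inverse_arr_eq by (auto simp: iso_def)

text \<open>Naturality of \<open>lunit\<close> expresses \<open>f\<close> through
  \<open>ident C (unit C) \<boxtimes> f\<close>, up to the isomorphism
  \<open>lunit C A\<close>.\<close>

lemma unit_tensor_faithful:
  assumes "f \<in> hom C A B" "g \<in> hom C A B" "ident C (unit C) \<boxtimes> f = ident C (unit C) \<boxtimes> g"
  shows "f = g"
proof -
  have "f \<cdot> lunit C A = g \<cdot> lunit C A"
    using assms lunit_natural[of f A B] lunit_natural[of g A B] by simp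
  then show ?thesis using assms by (intro iso_cancel_right[of f "lunit C A" g]) (auto simp: in_hom_iff)
qed

text \<open>Kelly's argument: tensored with the unit on the left, both sides agree by the pentagon.\<close>

lemma lunit_tensor:
  assumes [simp]: "X \<in> obj C" "Z \<in> obj C"
  shows "lunit C (X \<otimes> Z) \<cdot> assoc C (unit C) X Z = lunit C X \<boxtimes> ident C Z"
proof -
  let ?I = "unit C" and ?i = "ident C"
  let ?y = "assoc C ?I (?I \<otimes> X) Z \<cdot> (assoc C ?I ?I X \<boxtimes> ?i Z)"
  have "(?i ?I \<boxtimes> (lunit C (X \<otimes> Z) \<cdot> assoc C ?I X Z)) \<cdot> ?y
    = (?i ?I \<boxtimes> lunit C (X \<otimes> Z)) \<cdot> ((?i ?I \<boxtimes> assoc C ?I X Z) \<cdot> ?y)" by simp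
  also have "(?i ?I \<boxtimes> assoc C ?I X Z) \<cdot> ?y = assoc C ?I ?I (X \<otimes> Z) \<cdot> assoc C (?I \<otimes> ?I) X Z"
    using pentagon[of ?I ?I X Z] by simp
  also have "(?i ?I \<boxtimes> lunit C (X \<otimes> Z)) \<cdot> (assoc C ?I ?I (X \<otimes> Z) \<cdot> assoc C (?I \<otimes> ?I) X Z)
    = (runit C ?I \<boxtimes> ?i (X \<otimes> Z)) \<cdot> assoc C (?I \<otimes> ?I) X Z"
    using comp_tail[OF triangle[of ?I "X \<otimes> Z"]] by simp
  also have "\<dots> = assoc C ?I X Z \<cdot> ((runit C ?I \<boxtimes> ?i X) \<boxtimes> ?i Z)"
    using assoc_nat[of "runit C ?I" "?i X" "?i Z"] by simp
  also have "\<dots> = assoc C ?I X Z \<cdot> (((?i ?I \<boxtimes> lunit C X) \<boxtimes> ?i Z) \<cdot> (assoc C ?I ?I X \<boxtimes> ?i Z))"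
    using triangle[of ?I X] by simp
  also have "\<dots> = (?i ?I \<boxtimes> (lunit C X \<boxtimes> ?i Z)) \<cdot> ?y"
    using comp_tail[OF assoc_nat[of "?i ?I" "lunit C X" "?i Z" ?I X Z], of "assoc C ?I ?I X \<boxtimes> ?i Z"]
    by (simp del: tensor_tensor tensor_tail)
  finally have "?i ?I \<boxtimes> (lunit C (X \<otimes> Z) \<cdot> assoc C ?I X Z) = ?i ?I \<boxtimes> (lunit C X \<boxtimes> ?i Z)"
    by (rule iso_cancel_right) simp_all
  then show ?thesis by (rule unit_tensor_faithful[rotated 2]) (auto simp: in_hom_iff)
qed

text \<open>Coherence of a monoidal functor, read as equations between operations applied to \<open>Z\<close>.\<close>

lemma assoc_act:
  assumes "s \<in> hom C r1 r" "m1 \<in> hom C (ab \<otimes> e) r1" "m \<in> hom C (a \<otimes> b) ab"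
    "m1' \<in> hom C (a \<otimes> be) r" "m' \<in> hom C (b \<otimes> e) be"
    and obj [simp]: "a \<in> obj C" "b \<in> obj C" "e \<in> obj C" "ab \<in> obj C" "be \<in> obj C" "Z \<in> obj C"
    and eq: "s \<cdot> (m1 \<cdot> (m \<boxtimes> ident C e)) = m1' \<cdot> ((ident C a \<boxtimes> m') \<cdot> assoc C a b e)"
  shows "(s \<boxtimes> ident C Z) \<cdot> ((m1 \<boxtimes> ident C Z) \<cdot> (inverse_arr C (assoc C ab e Z)
      \<cdot> ((m \<boxtimes> ident C (e \<otimes> Z)) \<cdot> inverse_arr C (assoc C a b (e \<otimes> Z)))))
    = (m1' \<boxtimes> ident C Z) \<cdot> (inverse_arr C (assoc C a be Z)
      \<cdot> (ident C a \<boxtimes> ((m' \<boxtimes> ident C Z) \<cdot> inverse_arr C (assoc C b e Z))))"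
proof -
  note [simp] = assms(1-5)[unfolded in_hom_iff]
  let ?i = "ident C" and ?a = "assoc C" and ?inv = "inverse_arr C"
  have 1: "?inv (?a ab e Z) \<cdot> (m \<boxtimes> ?i (e \<otimes> Z)) = ((m \<boxtimes> ?i e) \<boxtimes> ?i Z) \<cdot> ?inv (?a (a \<otimes> b) e Z)"
    using assoc_nat[of m "?i e" "?i Z"] by (intro inverse_square) auto
  have 2: "?inv (?a a be Z) \<cdot> (?i a \<boxtimes> (m' \<boxtimes> ?i Z)) = ((?i a \<boxtimes> m') \<boxtimes> ?i Z) \<cdot> ?inv (?a a (b \<otimes> e) Z)"
    using assoc_nat[of "?i a" m' "?i Z"] by (intro inverse_square) auto
  \<comment> \<open>The pentagon as a square with an identity as one side;
    \<open>inverse_square\<close> then inverts the two composites of associators at once.\<close>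
  have "((?i a \<boxtimes> ?a b e Z) \<cdot> ?a a (b \<otimes> e) Z) \<cdot> (?a a b e \<boxtimes> ?i Z)
    = ?i (a \<otimes> (b \<otimes> (e \<otimes> Z))) \<cdot> (?a a b (e \<otimes> Z) \<cdot> ?a (a \<otimes> b) e Z)"
    using pentagon[of a b e Z] by simp
  from inverse_square[OF this]
  have 3: "(?a a b e \<boxtimes> ?i Z) \<cdot> (?inv (?a (a \<otimes> b) e Z) \<cdot> ?inv (?a a b (e \<otimes> Z)))
    = ?inv (?a a (b \<otimes> e) Z) \<cdot> (?i a \<boxtimes> ?inv (?a b e Z))"
    by (simp add: inverse_comp inverse_tensor)
  have "(s \<boxtimes> ?i Z) \<cdot> ((m1 \<boxtimes> ?i Z) \<cdot> (?inv (?a ab e Z) \<cdot> ((m \<boxtimes> ?i (e \<otimes> Z)) \<cdot> ?inv (?a a b (e \<otimes> Z)))))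
    = ((s \<cdot> (m1 \<cdot> (m \<boxtimes> ?i e))) \<boxtimes> ?i Z) \<cdot> (?inv (?a (a \<otimes> b) e Z) \<cdot> ?inv (?a a b (e \<otimes> Z)))"
    using comp_tail[OF 1] by simp
  also have "\<dots> = ((m1' \<cdot> (?i a \<boxtimes> m')) \<boxtimes> ?i Z) \<cdot> ((?a a b e \<boxtimes> ?i Z)
      \<cdot> (?inv (?a (a \<otimes> b) e Z) \<cdot> ?inv (?a a b (e \<otimes> Z))))"
    unfolding eq by simp
  also have "\<dots> = (m1' \<boxtimes> ?i Z) \<cdot> ((((?i a \<boxtimes> m') \<boxtimes> ?i Z) \<cdot> ?inv (?a a (b \<otimes> e) Z)) \<cdot> (?i a \<boxtimes> ?inv (?a b e Z)))"
    unfolding 3 by simp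
  also have "\<dots> = (m1' \<boxtimes> ?i Z) \<cdot> (?inv (?a a be Z) \<cdot> (?i a \<boxtimes> ((m' \<boxtimes> ?i Z) \<cdot> ?inv (?a b e Z))))"
    unfolding 2[symmetric] by simp
  finally show ?thesis .
qed

lemma mult_act:
  assumes "f \<in> hom C a a'" "g \<in> hom C b b'" "m \<in> hom C (a \<otimes> b) c" "m' \<in> hom C (a' \<otimes> b') c'" "h \<in> hom C c c'"
    and obj [simp]: "a \<in> obj C" "b \<in> obj C" "a' \<in> obj C" "b' \<in> obj C" "Z \<in> obj C"
    and eq: "m' \<cdot> (f \<boxtimes> g) = h \<cdot> m"
  shows "(m' \<boxtimes> ident C Z) \<cdot> (inverse_arr C (assoc C a' b' Z) \<cdot> (f \<boxtimes> (g \<boxtimes> ident C Z)))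
    = (h \<boxtimes> ident C Z) \<cdot> ((m \<boxtimes> ident C Z) \<cdot> inverse_arr C (assoc C a b Z))"
proof -
  note [simp] = assms(1-5)[unfolded in_hom_iff]
  have "inverse_arr C (assoc C a' b' Z) \<cdot> (f \<boxtimes> (g \<boxtimes> ident C Z))
    = ((f \<boxtimes> g) \<boxtimes> ident C Z) \<cdot> inverse_arr C (assoc C a b Z)"
    using assoc_nat[of f g "ident C Z"] by (intro inverse_square) auto
  then show ?thesis using eq by simp
qed

lemma lunit_act:
  assumes "s \<in> hom C c a" "m \<in> hom C (i \<otimes> a) c" "u \<in> hom C (unit C) i"
    and obj [simp]: "a \<in> obj C" "i \<in> obj C" "Z \<in> obj C"
    and eq: "s \<cdot> (m \<cdot> (u \<boxtimes> ident C a)) = lunit C a"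
  shows "(s \<boxtimes> ident C Z) \<cdot> ((m \<boxtimes> ident C Z) \<cdot> (inverse_arr C (assoc C i a Z)
      \<cdot> ((u \<boxtimes> ident C (a \<otimes> Z)) \<cdot> inverse_arr C (lunit C (a \<otimes> Z))))) = ident C (a \<otimes> Z)"
proof -
  note [simp] = assms(1-3)[unfolded in_hom_iff]
  have 1: "inverse_arr C (assoc C i a Z) \<cdot> (u \<boxtimes> ident C (a \<otimes> Z))
    = ((u \<boxtimes> ident C a) \<boxtimes> ident C Z) \<cdot> inverse_arr C (assoc C (unit C) a Z)"
    using assoc_nat[of u "ident C a" "ident C Z"] by (intro inverse_square) auto
  have "(s \<boxtimes> ident C Z) \<cdot> ((m \<boxtimes> ident C Z) \<cdot> (inverse_arr C (assoc C i a Z)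
      \<cdot> ((u \<boxtimes> ident C (a \<otimes> Z)) \<cdot> inverse_arr C (lunit C (a \<otimes> Z)))))
    = ((s \<cdot> (m \<cdot> (u \<boxtimes> ident C a))) \<boxtimes> ident C Z) \<cdot> (inverse_arr C (assoc C (unit C) a Z) \<cdot> inverse_arr C (lunit C (a \<otimes> Z)))"
    using comp_tail[OF 1] by simp
  then show ?thesis unfolding eq lunit_tensor[OF obj(1,3), symmetric] by simp
qed

lemma runit_act:
  assumes "s \<in> hom C c a" "m \<in> hom C (a \<otimes> i) c" "u \<in> hom C (unit C) i"
    and obj [simp]: "a \<in> obj C" "i \<in> obj C" "Z \<in> obj C"
    and eq: "s \<cdot> (m \<cdot> (ident C a \<boxtimes> u)) = runit C a"
  shows "(s \<boxtimes> ident C Z) \<cdot> ((m \<boxtimes> ident C Z) \<cdot> (inverse_arr C (assoc C a i Z)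
      \<cdot> (ident C a \<boxtimes> ((u \<boxtimes> ident C Z) \<cdot> inverse_arr C (lunit C Z))))) = ident C (a \<otimes> Z)"
proof -
  note [simp] = assms(1-3)[unfolded in_hom_iff]
  have 1: "inverse_arr C (assoc C a i Z) \<cdot> (ident C a \<boxtimes> (u \<boxtimes> ident C Z))
    = ((ident C a \<boxtimes> u) \<boxtimes> ident C Z) \<cdot> inverse_arr C (assoc C a (unit C) Z)"
    using assoc_nat[of "ident C a" u "ident C Z"] by (intro inverse_square) auto
  have "ident C a \<boxtimes> ((u \<boxtimes> ident C Z) \<cdot> inverse_arr C (lunit C Z))
    = (ident C a \<boxtimes> (u \<boxtimes> ident C Z)) \<cdot> (ident C a \<boxtimes> inverse_arr C (lunit C Z))" by simp
  then have "(s \<boxtimes> ident C Z) \<cdot> ((m \<boxtimes> ident C Z) \<cdot> (inverse_arr C (assoc C a i Z)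
      \<cdot> (ident C a \<boxtimes> ((u \<boxtimes> ident C Z) \<cdot> inverse_arr C (lunit C Z)))))
    = (s \<boxtimes> ident C Z) \<cdot> ((m \<boxtimes> ident C Z) \<cdot> ((inverse_arr C (assoc C a i Z)
      \<cdot> (ident C a \<boxtimes> (u \<boxtimes> ident C Z))) \<cdot> (ident C a \<boxtimes> inverse_arr C (lunit C Z))))"
    by (simp del: tensor_tensor tensor_tail)
  also have "\<dots> = ((s \<cdot> (m \<cdot> (ident C a \<boxtimes> u))) \<boxtimes> ident C Z) \<cdot> (inverse_arr C (assoc C a (unit C) Z)
      \<cdot> (ident C a \<boxtimes> inverse_arr C (lunit C Z)))"
    unfolding 1 by simp
  also have "\<dots> = (ident C a \<boxtimes> lunit C Z) \<cdot> (ident C a \<boxtimes> inverse_arr C (lunit C Z))"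
    unfolding eq triangle[OF obj(1,3), symmetric] by (simp del: tensor_tensor tensor_tail)
  finally show ?thesis by simp
qed

end

section \<open>Strict whiskering and the elimination of cups and caps\<close>

declare in_lists_conv_set [simp del]

text \<open>A strict monoidal category whose objects are words, presented by whiskering instead of a
  tensor product of arrows. All laws but \<open>interchange\<close> are rewrite rules, which push
  whiskering into composites and nest composites to the right; the direction in which
  \<open>interchange\<close> is used depends on the diagram.\<close>

locale strict_whiskering =
  fixes G :: "'g set" and A :: "'k set" and dom cod :: "'k \<Rightarrow> 'g list"
    and idt :: "'g list \<Rightarrow> 'k" and cmp :: "'k \<Rightarrow> 'k \<Rightarrow> 'k" (infixr "\<odot>" 55)
    and lw :: "'g list \<Rightarrow> 'k \<Rightarrow> 'k" (infixr "\<rhd>" 70)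
    and rw :: "'k \<Rightarrow> 'g list \<Rightarrow> 'k" (infixl "\<lhd>" 71)
  assumes dom_in [simp]: "f \<in> A \<Longrightarrow> dom f \<in> lists G"
    and cod_in [simp]: "f \<in> A \<Longrightarrow> cod f \<in> lists G"
    and idt_in [simp]: "v \<in> lists G \<Longrightarrow> idt v \<in> A"
    and dom_idt [simp]: "v \<in> lists G \<Longrightarrow> dom (idt v) = v"
    and cod_idt [simp]: "v \<in> lists G \<Longrightarrow> cod (idt v) = v"
    and cmp_in [simp]: "\<lbrakk>f \<in> A; g \<in> A; cod f = dom g\<rbrakk> \<Longrightarrow> g \<odot> f \<in> A"
    and dom_cmp [simp]: "\<lbrakk>f \<in> A; g \<in> A; cod f = dom g\<rbrakk> \<Longrightarrow> dom (g \<odot> f) = dom f"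
    and cod_cmp [simp]: "\<lbrakk>f \<in> A; g \<in> A; cod f = dom g\<rbrakk> \<Longrightarrow> cod (g \<odot> f) = cod g"
    and cmp_idt_right [simp]: "\<lbrakk>f \<in> A; dom f = v\<rbrakk> \<Longrightarrow> f \<odot> idt v = f"
    and cmp_idt_left [simp]: "\<lbrakk>f \<in> A; cod f = v\<rbrakk> \<Longrightarrow> idt v \<odot> f = f"
    and cmp_cmp [simp]: "\<lbrakk>f \<in> A; g \<in> A; h \<in> A; cod f = dom g; cod g = dom h\<rbrakk>
      \<Longrightarrow> (h \<odot> g) \<odot> f = h \<odot> g \<odot> f"
    and lw_in [simp]: "\<lbrakk>u \<in> lists G; f \<in> A\<rbrakk> \<Longrightarrow> u \<rhd> f \<in> A"
    and dom_lw [simp]: "\<lbrakk>u \<in> lists G; f \<in> A\<rbrakk> \<Longrightarrow> dom (u \<rhd> f) = u @ dom f"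
    and cod_lw [simp]: "\<lbrakk>u \<in> lists G; f \<in> A\<rbrakk> \<Longrightarrow> cod (u \<rhd> f) = u @ cod f"
    and lw_idt [simp]: "\<lbrakk>u \<in> lists G; v \<in> lists G\<rbrakk> \<Longrightarrow> u \<rhd> idt v = idt (u @ v)"
    and lw_cmp [simp]: "\<lbrakk>u \<in> lists G; f \<in> A; g \<in> A; cod f = dom g\<rbrakk>
      \<Longrightarrow> u \<rhd> (g \<odot> f) = (u \<rhd> g) \<odot> (u \<rhd> f)"
    and lw_Nil [simp]: "f \<in> A \<Longrightarrow> [] \<rhd> f = f"
    and lw_lw [simp]: "\<lbrakk>u \<in> lists G; v \<in> lists G; f \<in> A\<rbrakk> \<Longrightarrow> u \<rhd> v \<rhd> f = (u @ v) \<rhd> f"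
    and rw_in [simp]: "\<lbrakk>u \<in> lists G; f \<in> A\<rbrakk> \<Longrightarrow> f \<lhd> u \<in> A"
    and dom_rw [simp]: "\<lbrakk>u \<in> lists G; f \<in> A\<rbrakk> \<Longrightarrow> dom (f \<lhd> u) = dom f @ u"
    and cod_rw [simp]: "\<lbrakk>u \<in> lists G; f \<in> A\<rbrakk> \<Longrightarrow> cod (f \<lhd> u) = cod f @ u"
    and rw_idt [simp]: "\<lbrakk>u \<in> lists G; v \<in> lists G\<rbrakk> \<Longrightarrow> idt v \<lhd> u = idt (v @ u)"
    and rw_cmp [simp]: "\<lbrakk>u \<in> lists G; f \<in> A; g \<in> A; cod f = dom g\<rbrakk>
      \<Longrightarrow> (g \<odot> f) \<lhd> u = (g \<lhd> u) \<odot> (f \<lhd> u)"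
    and rw_Nil [simp]: "f \<in> A \<Longrightarrow> f \<lhd> [] = f"
    and rw_rw [simp]: "\<lbrakk>u \<in> lists G; v \<in> lists G; f \<in> A\<rbrakk> \<Longrightarrow> f \<lhd> u \<lhd> v = f \<lhd> (u @ v)"
    and lw_rw [simp]: "\<lbrakk>u \<in> lists G; v \<in> lists G; f \<in> A\<rbrakk> \<Longrightarrow> (u \<rhd> f) \<lhd> v = u \<rhd> f \<lhd> v"
    and interchange: "\<lbrakk>f \<in> A; g \<in> A\<rbrakk>
      \<Longrightarrow> (cod f \<rhd> g) \<odot> (f \<lhd> dom g) = (f \<lhd> cod g) \<odot> (dom f \<rhd> g)"
begin

text \<open>\<open>interchange\<close> for \<open>f\<close> and \<open>y \<rhd> g\<close>, whiskered
  by \<open>x\<close>: the letters \<open>y\<close> between the two arrows are absorbed into the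
  right-hand one.\<close>

lemma slide:
  assumes "f \<in> A" "g \<in> A" "x \<in> lists G" "y \<in> lists G" and "dom f = a" "cod f = b"
  shows "(x \<rhd> f \<lhd> (y @ cod g)) \<odot> ((x @ a @ y) \<rhd> g) = ((x @ b @ y) \<rhd> g) \<odot> (x \<rhd> f \<lhd> (y @ dom g))"
proof -
  have [simp]: "a \<in> lists G" "b \<in> lists G" using dom_in cod_in assms by metis+
  have "x \<rhd> ((b @ y) \<rhd> g \<odot> f \<lhd> (y @ dom g)) = x \<rhd> (f \<lhd> (y @ cod g) \<odot> (a @ y) \<rhd> g)"
    using interchange[of f "y \<rhd> g"] assms by simp
  then show ?thesis using assms by simp
qed

lemma slide_cmp:
  assumes "f \<in> A" "g \<in> A" "x \<in> lists G" "y \<in> lists G" and "dom f = a" "cod f = b"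
    and "j \<in> A" "cod j = x @ a @ y @ dom g" "cod g = c" "dom g = d"
  shows "(x \<rhd> f \<lhd> (y @ c)) \<odot> ((x @ a @ y) \<rhd> g) \<odot> j
    = ((x @ b @ y) \<rhd> g) \<odot> (x \<rhd> f \<lhd> (y @ d)) \<odot> j"
proof -
  have [simp]: "a \<in> lists G" "b \<in> lists G" "c \<in> lists G" "d \<in> lists G" using dom_in cod_in assms by metis+
  have "((x \<rhd> f \<lhd> (y @ cod g)) \<odot> ((x @ a @ y) \<rhd> g)) \<odot> j
    = (((x @ b @ y) \<rhd> g) \<odot> (x \<rhd> f \<lhd> (y @ dom g))) \<odot> j"
    using slide[OF assms(1-6)] by simp
  then show ?thesis using assms by simp
qed

end

text \<open>A cup and a cap meet in the higher letter \<open>h\<close> in \<open>zig\<close> and in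
  the lower letter \<open>h\<close> in \<open>zag\<close>. Both laws include \<open>g' = g\<close>:
  the partner of a letter is determined, so a cup and a cap that meet always form a snake. Boxes
  stay abstract except for having winding 0.\<close>

locale zigzag = strict_whiskering +
  fixes wind :: "'a \<Rightarrow> int" and box :: "'a list \<Rightarrow> 'b \<Rightarrow> 'a list \<Rightarrow> bool"
    and cap cup :: "'a \<Rightarrow> 'a \<Rightarrow> 'b \<Rightarrow> bool"
  assumes box_in: "box a k b \<Longrightarrow> k \<in> A \<and> dom k = a \<and> cod k = b"
    and box_wind: "box a k b \<Longrightarrow> \<forall>g \<in> set a \<union> set b. wind g = 0"
    and cap_in: "cap g h e \<Longrightarrow> e \<in> A \<and> dom e = [g, h] \<and> cod e = []"
    and cap_wind: "cap g h e \<Longrightarrow> wind h = wind g + 1"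
    and cup_in: "cup h g n \<Longrightarrow> n \<in> A \<and> dom n = [] \<and> cod n = [h, g]"
    and cup_wind: "cup h g n \<Longrightarrow> wind h = wind g + 1"
    and zig: "\<lbrakk>cap g h e; cup h g' n\<rbrakk> \<Longrightarrow> g' = g \<and> (e \<lhd> [g]) \<odot> ([g] \<rhd> n) = idt [g]"
    and zag: "\<lbrakk>cup g h n; cap h g' e\<rbrakk> \<Longrightarrow> g' = g \<and> ([g] \<rhd> e) \<odot> (n \<lhd> [g]) = idt [g]"
begin

inductive gen :: "'a list \<Rightarrow> 'b \<Rightarrow> 'a list \<Rightarrow> bool" where
  gen_box: "box a k b \<Longrightarrow> gen a k b"
| gen_cap: "cap g h e \<Longrightarrow> gen [g, h] e []"
| gen_cup: "cup h g n \<Longrightarrow> gen [] n [h, g]"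

lemma gen_in:
  assumes "gen a j b"
  shows "j \<in> A" "dom j = a" "cod j = b" "a \<in> lists G" "b \<in> lists G"
proof -
  show *: "j \<in> A" "dom j = a" "cod j = b"
    using assms box_in cap_in cup_in by (auto elim!: gen.cases)
  show "a \<in> lists G" "b \<in> lists G" using * dom_in cod_in by blast+
qed

text \<open>The elimination leaves the arrow \<open>k\<close> unchanged and shrinks the set of
  letters met on the way, hence the bound \<open>Q\<close> on all intermediate words.\<close>

inductive der :: "'a set \<Rightarrow> 'a list \<Rightarrow> 'b \<Rightarrow> 'a list \<Rightarrow> bool" for Q where
  der_idt: "v \<in> lists Q \<Longrightarrow> der Q v (idt v) v"
| der_step: "\<lbrakk>der Q v k (x @ a @ y); gen a j b; b \<in> lists Q\<rbrakk>
    \<Longrightarrow> der Q v ((x \<rhd> j \<lhd> y) \<odot> k) (x @ b @ y)"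

lemma der_lists: "der Q v k w \<Longrightarrow> v \<in> lists Q \<and> w \<in> lists Q"
  by (induction rule: der.induct) auto

lemma der_mono: "der Q v k w \<Longrightarrow> Q \<subseteq> Q' \<Longrightarrow> der Q' v k w"
proof (induction rule: der.induct)
  case (der_idt v)
  then show ?case using lists_mono by (blast intro: der.der_idt)
next
  case (der_step v k x a y j b)
  then show ?case using lists_mono by (blast intro: der.der_step)
qed

section \<open>Closure of derivations under composition and whiskering\<close>

context
  fixes Q assumes QG: "Q \<subseteq> G"
begin

lemma lists_G: "v \<in> lists Q \<Longrightarrow> v \<in> lists G"
  using QG by auto

lemma der_in: "der Q v k w \<Longrightarrow> k \<in> A \<and> dom k = v \<and> cod k = w"
proof (induction rule: der.induct)
  case (der_idt v)
  then show ?case using lists_G by simp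
next
  case (der_step v k x a y j b)
  have "x \<in> lists G" "y \<in> lists G" using der_lists[OF der_step(1)] lists_G by auto
  then show ?case using der_step gen_in[OF der_step(2)] by simp
qed

lemma der_trans: "der Q v k w \<Longrightarrow> der Q u j v \<Longrightarrow> der Q u (k \<odot> j) w"
proof (induction rule: der.induct)
  case (der_idt v)
  then show ?case using der_in by fastforce
next
  case (der_step v k x a y i b)
  have xy: "x \<in> lists G" "y \<in> lists G" using der_lists[OF der_step(1)] lists_G by auto
  have "der Q u ((x \<rhd> i \<lhd> y) \<odot> k \<odot> j) (x @ b @ y)"
    using der_step by (blast intro: der.der_step)
  moreover have "(x \<rhd> i \<lhd> y) \<odot> k \<odot> j = ((x \<rhd> i \<lhd> y) \<odot> k) \<odot> j"
    using xy gen_in[OF der_step(2)] der_in[OF der_step(1)] der_in[OF der_step(5)] by simp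
  ultimately show ?case by simp
qed

lemma der_lw: "der Q v k w \<Longrightarrow> u \<in> lists Q \<Longrightarrow> der Q (u @ v) (u \<rhd> k) (u @ w)"
proof (induction rule: der.induct)
  case (der_idt v)
  then show ?case using lists_G der.der_idt[of "u @ v" Q] by simp
next
  case (der_step v k x a y i b)
  have xy: "x \<in> lists G" "y \<in> lists G" "u \<in> lists G"
    using der_lists[OF der_step(1)] lists_G der_step by auto
  have "der Q (u @ v) (((u @ x) \<rhd> i \<lhd> y) \<odot> (u \<rhd> k)) ((u @ x) @ b @ y)"
    using der_step by (intro der.der_step[of Q _ _ _ a]) auto
  then show ?case
    using xy gen_in[OF der_step(2)] der_in[OF der_step(1)] by simp
qed

lemma der_rw: "der Q v k w \<Longrightarrow> u \<in> lists Q \<Longrightarrow> der Q (v @ u) (k \<lhd> u) (w @ u)"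
proof (induction rule: der.induct)
  case (der_idt v)
  then show ?case using lists_G der.der_idt[of "v @ u" Q] by simp
next
  case (der_step v k x a y i b)
  have xy: "x \<in> lists G" "y \<in> lists G" "u \<in> lists G"
    using der_lists[OF der_step(1)] lists_G der_step by auto
  have "der Q (v @ u) ((x \<rhd> i \<lhd> (y @ u)) \<odot> (k \<lhd> u)) (x @ b @ y @ u)"
    using der_step by (intro der.der_step[of Q _ _ _ a]) auto
  then show ?case
    using xy gen_in[OF der_step(2)] der_in[OF der_step(1)] by simp
qed

lemma der_gen:
  assumes "gen a j b" "a \<in> lists Q" "b \<in> lists Q"
  shows "der Q a j b"
  using der_step[of Q a "idt a" "[]" a "[]" j b] der_idt[of a Q] assms gen_in[OF assms(1)] lists_G by simp

end

section \<open>Removing the highest winding\<close>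

context
  fixes Q and hi :: int
  assumes QG: "Q \<subseteq> G" and hi_pos: "hi > 0" and wind_le: "\<And>g. g \<in> Q \<Longrightarrow> wind g \<le> hi"
begin

abbreviation "Qlow \<equiv> {g \<in> Q. wind g < hi}"

text \<open>A letter of maximal winding \<open>hi\<close> only ever meets the cup that creates it and the cap that destroys
  it, and meanwhile the two sides of the letter evolve independently. In \<open>form v k w\<close>, everything
  to the left of the first such letter of \<open>w\<close> has been done before the cup that created it.\<close>

inductive form :: "'a list \<Rightarrow> 'b \<Rightarrow> 'a list \<Rightarrow> bool" where
  form_low: "der Qlow v k w \<Longrightarrow> form v k w"
| form_split: "\<lbrakk>der Qlow v j (p @ y); cup h g n; h \<in> Q; g \<in> Q; wind h = hi; form (g # y) r q\<rbrakk>
    \<Longrightarrow> form v ((p \<rhd> ([h] \<rhd> r \<odot> n \<lhd> y)) \<odot> j) (p @ h # q)"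

lemma low_G: "v \<in> lists Qlow \<Longrightarrow> v \<in> lists G"
  using QG by auto

lemma low_Q: "v \<in> lists Qlow \<Longrightarrow> v \<in> lists Q"
  by auto

lemma low_in: "der Qlow v k w \<Longrightarrow> k \<in> A \<and> dom k = v \<and> cod k = w \<and> v \<in> lists Qlow \<and> w \<in> lists Qlow"
  using der_in[of Qlow v k w] der_lists[of Qlow v k w] QG by auto

lemma form_in: "form v k w \<Longrightarrow> k \<in> A \<and> dom k = v \<and> cod k = w \<and> w \<in> lists Q"
proof (induction rule: form.induct)
  case (form_low v k w)
  then show ?case using low_in low_Q by blast
next
  case (form_split v j p y h g n r q)
  have [simp]: "p \<in> lists G" "y \<in> lists G" "h \<in> G"
    using low_in[OF form_split(1)] low_G QG form_split by auto
  have "p \<in> lists Q" using low_in[OF form_split(1)] by auto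
  then show ?case using low_in[OF form_split(1)] cup_in[OF form_split(2)] form_split by simp
qed

text \<open>Needed after a snake has been cancelled: the tail \<open>r\<close> that followed the cup
  may contain further letters of winding \<open>hi\<close>, and its low part absorbs
  \<open>j\<close> and the letters \<open>x\<close>.\<close>

lemma form_comp:
  assumes j: "der Qlow v j (x @ s)" and "form s r q"
  shows "form v ((x \<rhd> r) \<odot> j) (x @ q)"
  using assms(2)
proof cases
  case form_low
  have x: "x \<in> lists Qlow" using low_in[OF j] by simp
  have "der Qlow (x @ s) (x \<rhd> r) (x @ q)" using der_lw[OF _ form_low x] QG by auto
  then show ?thesis using der_trans[OF _ _ j] QG by (intro form.form_low) auto
next
  case (form_split i p y h g n r' q')
  have x: "x \<in> lists Qlow" using low_in[OF j] by simp
  have y: "p @ y \<in> lists Qlow" using low_in[OF form_split(3)] by simp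
  have [simp]: "x \<in> lists G" "p \<in> lists G" "y \<in> lists G" "h \<in> G"
    using low_G[OF x] low_G[OF y] QG form_split by auto
  have "der Qlow (x @ s) (x \<rhd> i) (x @ p @ y)"
    using der_lw[OF _ form_split(3) x] QG by auto
  then have "der Qlow v ((x \<rhd> i) \<odot> j) ((x @ p) @ y)"
    using der_trans[OF _ _ j] QG by auto
  from form.form_split[OF this form_split(4-8)]
  show ?thesis
    using form_split(1,2) low_in[OF j] low_in[OF form_split(3)] cup_in[OF form_split(4)]
      form_in[OF form_split(8)] by simp
qed

text \<open>A generator to the left of the first letter \<open>h\<close> of winding
  \<open>hi\<close> moves before the cup that created \<open>h\<close>; one to the right joins the
  tail \<open>r\<close>; one that touches \<open>h\<close> is a cap and cancels against the cup. A
  cup that creates a letter of winding \<open>hi\<close> opens a new split.\<close>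

lemma form_step:
  assumes "form v k w" and "w = x @ a @ y" and "gen a j b" and "b \<in> lists Q"
  shows "form v ((x \<rhd> j \<lhd> y) \<odot> k) (x @ b @ y)"
  using assms(1,2)
proof (induction arbitrary: x y rule: form.induct)
  case (form_low v k w)
  note k = low_in[OF form_low(1)]
  have xy: "x \<in> lists Qlow" "y \<in> lists Qlow" using k form_low by auto
  note [simp] = xy[THEN low_G]
  show ?case
  proof (cases "b \<in> lists Qlow")
    case True
    then show ?thesis using form_low assms(3) by (auto intro: form.form_low der_step)
  next
    case False
    \<comment> \<open>The target \<open>b\<close> contains a letter of winding
      \<open>hi > 0\<close>, so \<open>j\<close> is not a box; caps have an empty target. Hence
      \<open>j\<close> is a cup, whose upper leg has winding \<open>hi\<close> and whose lower leg
      stays in \<open>Qlow\<close>.\<close>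
    with assms(3,4) box_wind hi_pos have "gen a j b \<and> \<not> box a j b" by fastforce
    with False obtain h g where *: "a = []" "b = [h, g]" "cup h g j"
      by (auto elim: gen.cases)
    then have h: "wind h = hi" "h \<in> Q" "g \<in> Q" "g \<in> Qlow"
      using False cup_wind[OF *(3)] assms(4) wind_le[of h] by auto
    have "der Qlow (g # y) (idt (g # y)) (g # y)"
      using h xy by (intro der_idt) auto
    moreover have "der Qlow v k (x @ y)" using form_low * by simp
    moreover have "g \<in> G" "h \<in> G" using h QG by auto
    ultimately show ?thesis
      using form_split[of v k x y h g j "idt (g # y)" "g # y"] form.form_low * h cup_in[OF *(3)] k form_low
      by simp
  qed
next
  case (form_split v i p y' h g n r q)
  note i = low_in[OF form_split(1)] and n = cup_in[OF form_split(2)] and r = form_in[OF form_split(6)]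
    and j = gen_in[OF assms(3)]
  have p: "p \<in> lists Qlow" "y' \<in> lists Qlow" using i by auto
  have w: "x @ a @ y \<in> lists Q" using form_in[OF form.form_split[OF form_split(1-6)]] form_split(8) by simp
  then have [simp]: "x \<in> lists G" "a \<in> lists G" "y \<in> lists G" using QG by auto
  note [simp] = p[THEN low_G] i n r j
  have [simp]: "h \<in> G" "g \<in> G" using form_split QG by auto
  have g: "g \<in> Qlow" using cup_wind[OF form_split(2)] form_split by auto
  let ?t = "([h] \<rhd> r) \<odot> (n \<lhd> y')"
  have t: "?t \<in> A" "dom ?t = y'" "cod ?t = h # q" by auto
  have q: "q \<in> lists G" using r cod_in by blast
  \<comment> \<open>The position of the source \<open>a\<close> of the generator relative to the
    first letter \<open>h\<close> of winding \<open>hi\<close>.\<close>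
  consider (left) p2 where "p = x @ a @ p2" "y = p2 @ h # q"
    | (right) q1 where "x = p @ h # q1" "q = q1 @ a @ y"
    | (mid) a1 a2 where "a = a1 @ h # a2" "p = x @ a1" "q = a2 @ y"
    using form_split(8)
    by (auto simp: append_eq_append_conv2 Cons_eq_append_conv append_eq_Cons_conv)
  then show ?case
  proof cases
    case left
    then have p2: "p2 \<in> lists Qlow" "x \<in> lists Qlow" using p by auto
    note [simp] = p2[THEN low_G]
    \<comment> \<open>\<open>?t\<close> comprises the cup that creates \<open>h\<close> and all that
      follows on its right; \<open>j\<close> acts to the left of it and can therefore be done
      first.\<close>
    have slide: "(x \<rhd> j \<lhd> y) \<odot> (p \<rhd> ?t) \<odot> i = ((x @ b @ p2) \<rhd> ?t) \<odot> (x \<rhd> j \<lhd> (p2 @ y')) \<odot> i"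
      using slide_cmp[of j ?t x p2 a b i "h # q" y'] left t by simp
    show ?thesis
    proof (cases "b \<in> lists Qlow")
      case True
      have "der Qlow v ((x \<rhd> j \<lhd> (p2 @ y')) \<odot> i) (x @ b @ p2 @ y')"
        using form_split(1) assms(3) True left by (intro der_step[where a = a]) auto
      then have "form v (((x @ b @ p2) \<rhd> ?t) \<odot> (x \<rhd> j \<lhd> (p2 @ y')) \<odot> i) ((x @ b @ p2) @ h # q)"
        using form_split by (intro form.form_split[of _ _ _ _ _ g]) auto
      then show ?thesis using slide left by simp
    next
      \<comment> \<open>The letter of the new cup becomes the first one of winding
        \<open>hi\<close>. The old split moves into the tail of the new one, where it starts from an
        identity.\<close>
      case False
      with assms(3,4) box_wind hi_pos have "gen a j b \<and> \<not> box a j b" by fastforce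
      with False obtain h' g' where *: "a = []" "b = [h', g']" "cup h' g' j"
        by (auto elim: gen.cases)
      then have h': "wind h' = hi" "h' \<in> Q" "g' \<in> Q" "g' \<in> Qlow"
        using False cup_wind[OF *(3)] assms(4) wind_le[of h'] by auto
      have G': "h' \<in> G" "g' \<in> G" using h' QG by auto
      have "der Qlow (g' # p2 @ y') (idt (g' # p2 @ y')) ((g' # p2) @ y')"
        using der_idt[of "g' # p2 @ y'"] h' p2 p by auto
      then have "form (g' # p2 @ y') (((g' # p2) \<rhd> ?t) \<odot> idt (g' # p2 @ y')) ((g' # p2) @ h # q)"
        using form_split by (intro form.form_split[of _ _ _ _ _ g]) auto
      then have "form (g' # p2 @ y') ((g' # p2) \<rhd> ?t) ((g' # p2) @ h # q)"
        using t G' by simp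
      then have "form v ((x \<rhd> (([h'] \<rhd> (g' # p2) \<rhd> ?t) \<odot> (j \<lhd> (p2 @ y')))) \<odot> i) (x @ h' # (g' # p2) @ h # q)"
        using form_split(1) left * h' by (intro form.form_split[of _ _ _ _ _ g']) auto
      moreover have "(x \<rhd> (([h'] \<rhd> (g' # p2) \<rhd> ?t) \<odot> (j \<lhd> (p2 @ y')))) \<odot> i
        = ((x @ b @ p2) \<rhd> ?t) \<odot> (x \<rhd> j \<lhd> (p2 @ y')) \<odot> i"
        using * left G' t by simp
      ultimately show ?thesis using slide left * by simp
    qed
  next
    case right
    have "q1 \<in> lists G" using right w QG by auto
    have "form (g # y') ((q1 \<rhd> j \<lhd> y) \<odot> r) (q1 @ b @ y)"
      using form_split right by blast
    then have "form v ((p \<rhd> ([h] \<rhd> ((q1 \<rhd> j \<lhd> y) \<odot> r) \<odot> (n \<lhd> y'))) \<odot> i) (p @ h # q1 @ b @ y)"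
      using form_split by (intro form.form_split[of _ _ _ _ _ g]) auto
    then show ?thesis using right \<open>q1 \<in> lists G\<close> by simp
  next
    case mid
    \<comment> \<open>No box touches a letter of winding \<open>hi > 0\<close>, and a cup has an
      empty source. As the left leg of a cap, \<open>h\<close> would need a right leg of winding
      \<open>hi + 1\<close>. So \<open>h\<close> is the right leg, and \<open>zig\<close> identifies
      the left leg with \<open>g\<close>.\<close>
    from assms(3) have "a1 = [g] \<and> a2 = [] \<and> b = [] \<and> cap g h j"
    proof cases
      case gen_box
      then show ?thesis using box_wind[of a j b] mid hi_pos form_split by auto
    next
      case (gen_cap g' h')
      have "h' \<in> Q" using gen_cap w by simp
      then show ?thesis
        using mid gen_cap cap_wind[OF gen_cap(3)] wind_le[of h'] form_split zig[OF gen_cap(3)]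
        by (auto simp: Cons_eq_append_conv append_eq_Cons_conv)
    next
      case gen_cup
      then show ?thesis using mid by simp
    qed
    then have *: "a1 = [g]" "a2 = []" "b = []" "cap g h j" by auto
    have [simp]: "dom j = [g, h]" "cod j = []" "q = y" "p = x @ [g]" using cap_in[OF *(4)] mid * by auto
    \<comment> \<open>The cap slides before \<open>r\<close>, next to the cup, and the two form the
      snake of the next equation.\<close>
    have 1: "(j \<lhd> y) \<odot> ([g, h] \<rhd> r) = r \<odot> (j \<lhd> (g # y'))"
      using interchange[of j r] mid * by simp
    have 2: "(j \<lhd> (g # y')) \<odot> ([g] \<rhd> n \<lhd> y') = idt (g # y')"
      using arg_cong[OF conjunct2[OF zig[OF *(4) form_split(2)]], of "\<lambda>k. k \<lhd> y'"] mid * by simp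
    have "(j \<lhd> y) \<odot> ([g] \<rhd> ?t) = ((j \<lhd> y) \<odot> ([g, h] \<rhd> r)) \<odot> ([g] \<rhd> n \<lhd> y')" using mid * by simp
    also have "\<dots> = r" unfolding 1 using 2 mid * by simp
    finally have "x \<rhd> ((j \<lhd> y) \<odot> ([g] \<rhd> ?t)) = x \<rhd> r" by simp
    then have "(x \<rhd> r) \<odot> i = (x \<rhd> ((j \<lhd> y) \<odot> ([g] \<rhd> ?t))) \<odot> i" by simp
    also have "\<dots> = (x \<rhd> j \<lhd> y) \<odot> (p \<rhd> ?t) \<odot> i" using mid * by simp
    \<comment> \<open>The letter \<open>g\<close> that ended \<open>p\<close> now takes the place of
      the lower leg of the cancelled cup, so \<open>r\<close> can be applied directly after
      \<open>i\<close>.\<close>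
    finally show ?thesis
      using form_comp[of v i x "g # y'" r q] form_split(1,6) * by simp
  qed
qed

text \<open>A normal form obtained from \<open>form_split\<close> ends in a word with a letter of
  winding \<open>hi\<close>. Since \<open>w\<close> has none, only the low derivation
  remains.\<close>

lemma der_lower_high:
  assumes "der Q v k w" and "v \<in> lists Qlow" and "w \<in> lists Qlow"
  shows "der Qlow v k w"
proof -
  have "form v k w"
    using assms(1,2)
  proof (induction rule: der.induct)
    case (der_idt v)
    then show ?case by (intro form_low der.der_idt)
  next
    case (der_step v k x a y j b)
    then show ?case using form_step by blast
  qed
  then show ?thesis
    using assms(3) by cases auto
qed

end

text \<open>Reversing time exchanges cups and caps and negates the winding, so the lowest winding can be
  removed like the highest one.\<close>

lemma reversed: "zigzag G A cod dom idt (\<lambda>g f. f \<odot> g) lw rw (\<lambda>g. - wind g)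
    (\<lambda>a k b. box b k a) (\<lambda>g h e. cup g h e) (\<lambda>h g n. cap h g n)"
proof unfold_locales
  show "(\<And>f g. \<lbrakk>f \<in> A; g \<in> A\<rbrakk> \<Longrightarrow> f \<lhd> cod g \<odot> dom f \<rhd> g = cod f \<rhd> g \<odot> f \<lhd> dom g)"
    using interchange by simp
qed (use box_in box_wind cap_in cap_wind cup_in cup_wind zig zag in auto)

interpretation rev: zigzag G A cod dom idt "\<lambda>g f. f \<odot> g" lw rw "\<lambda>g. - wind g"
    "\<lambda>a k b. box b k a" "\<lambda>g h e. cup g h e" "\<lambda>h g n. cap h g n"
  by (rule reversed)

lemma rev_gen: "rev.gen a j b \<longleftrightarrow> gen b j a"
  by (auto elim!: gen.cases rev.gen.cases intro: gen.intros rev.gen.intros)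

lemma rev_der:
  assumes "Q \<subseteq> G"
  shows "der Q v k w \<Longrightarrow> rev.der Q w k v"
proof (induction rule: der.induct)
  case (der_idt v)
  then show ?case by (rule rev.der.der_idt)
next
  case (der_step v k x a y j b)
  have *: "x @ a @ y \<in> lists Q" using der_lists[OF der_step(1)] by simp
  have xy: "x \<in> lists G" "y \<in> lists G" "b \<in> lists G" using assms der_step(3) * by auto
  have "rev.der Q (x @ b @ y) (idt (x @ b @ y) \<odot> (x \<rhd> j \<lhd> y)) (x @ a @ y)"
    using der_step * by (intro rev.der.der_step[of Q _ _ _ b] rev.der.der_idt) (auto simp: rev_gen)
  from rev.der_trans[OF assms der_step(4) this]
  show ?case using xy gen_in[OF der_step(2)] by simp
qed

lemma der_rev:
  assumes "Q \<subseteq> G"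
  shows "rev.der Q v k w \<Longrightarrow> der Q w k v"
proof (induction rule: rev.der.induct)
  case (der_idt v)
  then show ?case by (rule der.der_idt)
next
  case (der_step v k x a y j b)
  have *: "x @ a @ y \<in> lists Q" using der_lists[OF der_step(4)] by simp
  have xy: "x \<in> lists G" "y \<in> lists G" "b \<in> lists G" using assms der_step(3) * by auto
  have g: "gen b j a" using der_step(2) rev_gen by simp
  have "der Q (x @ b @ y) ((x \<rhd> j \<lhd> y) \<odot> idt (x @ b @ y)) (x @ a @ y)"
    using der_step * g by (intro der.der_step[of Q _ _ _ b] der.der_idt) auto
  from der_trans[OF assms der_step(4) this]
  show ?case using xy gen_in[OF g] by simp
qed

lemma der_lower_low:
  assumes "Q \<subseteq> G" "lo < 0" "\<And>g. g \<in> Q \<Longrightarrow> lo \<le> wind g"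
    and "der Q v k w" and "v \<in> lists {g \<in> Q. lo < wind g}" and "w \<in> lists {g \<in> Q. lo < wind g}"
  shows "der {g \<in> Q. lo < wind g} v k w"
proof -
  have *: "{g \<in> Q. - wind g < - lo} = {g \<in> Q. lo < wind g}" by auto
  have "rev.der {g \<in> Q. - wind g < - lo} w k v"
    using assms rev_der[OF assms(1,4)] unfolding *
    by (intro rev.der_lower_high[of Q "- lo", unfolded *]) auto
  then show ?thesis using der_rev[of "{g \<in> Q. lo < wind g}"] assms(1) unfolding * by auto
qed

section \<open>Descent to winding 0\<close>

lemma der_range_high:
  assumes "der {g \<in> G. lo \<le> wind g \<and> wind g \<le> int m} v k w"
    and "v \<in> lists {g \<in> G. wind g = 0}" "w \<in> lists {g \<in> G. wind g = 0}" and "lo \<le> 0"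
  shows "der {g \<in> G. lo \<le> wind g \<and> wind g \<le> 0} v k w"
  using assms(1)
proof (induction m)
  case (Suc m)
  have *: "{g \<in> {g \<in> G. lo \<le> wind g \<and> wind g \<le> int (Suc m)}. wind g < int (Suc m)}
    = {g \<in> G. lo \<le> wind g \<and> wind g \<le> int m}" by auto
  show ?case
    using der_lower_high[OF _ _ _ Suc.prems, of "int (Suc m)", unfolded *] assms(2-4)
    by (intro Suc.IH) (auto simp: in_lists_conv_set)
qed simp

lemma der_range_low:
  assumes "der {g \<in> G. - int m \<le> wind g \<and> wind g \<le> 0} v k w"
    and "v \<in> lists {g \<in> G. wind g = 0}" "w \<in> lists {g \<in> G. wind g = 0}"
  shows "der {g \<in> G. wind g = 0} v k w"
  using assms(1)
proof (induction m)
  case 0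
  have "{g \<in> G. - int 0 \<le> wind g \<and> wind g \<le> 0} = {g \<in> G. wind g = 0}" by auto
  then show ?case using 0 by simp
next
  case (Suc m)
  have *: "{g \<in> {g \<in> G. - int (Suc m) \<le> wind g \<and> wind g \<le> 0}. - int (Suc m) < wind g}
    = {g \<in> G. - int m \<le> wind g \<and> wind g \<le> 0}" by auto
  show ?case
    using der_lower_low[OF _ _ _ Suc.prems, of "- int (Suc m)", unfolded *] assms(2-3)
    by (intro Suc.IH) (auto simp: in_lists_conv_set)
qed

lemma word_bounded:
  assumes "w \<in> lists G"
  shows "\<exists>m::nat. w \<in> lists {g \<in> G. - int m \<le> wind g \<and> wind g \<le> int m}"
  using assms
proof (induction w)
  case (Cons g w)
  then obtain m where m: "w \<in> lists {g \<in> G. - int m \<le> wind g \<and> wind g \<le> int m}" by auto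
  have "g # w \<in> lists {h \<in> G. - int (m + nat \<bar>wind g\<bar>) \<le> wind h \<and> wind h \<le> int (m + nat \<bar>wind g\<bar>)}"
    using m Cons by (fastforce simp: in_lists_conv_set)
  then show ?case by blast
qed auto

text \<open>A derivation passes through finitely many finite words, which gives the descent its
  starting point.\<close>

lemma der_bounded:
  assumes "der G v k w"
  shows "\<exists>m::nat. der {g \<in> G. - int m \<le> wind g \<and> wind g \<le> int m} v k w"
  using assms
proof (induction rule: der.induct)
  case (der_idt v)
  then show ?case using word_bounded der.der_idt by blast
next
  case (der_step v k x a y j b)
  let ?Q = "\<lambda>m::nat. {g \<in> G. - int m \<le> wind g \<and> wind g \<le> int m}"
  obtain m m' where m: "der (?Q m) v k (x @ a @ y)" "b \<in> lists (?Q m')"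
    using der_step word_bounded by meson
  have sub: "?Q m \<subseteq> ?Q (m + m')" "?Q m' \<subseteq> ?Q (m + m')" by auto
  have "der (?Q (m + m')) v k (x @ a @ y)" "b \<in> lists (?Q (m + m'))"
    using der_mono[OF m(1) sub(1)] m(2) lists_mono[OF sub(2)] by auto
  then show ?case using der.der_step der_step(2) by blast
qed

theorem der_wind_0:
  assumes "der G v k w" and "v \<in> lists {g \<in> G. wind g = 0}" and "w \<in> lists {g \<in> G. wind g = 0}"
  shows "der {g \<in> G. wind g = 0} v k w"
proof -
  obtain m where "der {g \<in> G. - int m \<le> wind g \<and> wind g \<le> int m} v k w"
    using der_bounded[OF assms(1)] by blast
  then have "der {g \<in> G. - int m \<le> wind g \<and> wind g \<le> 0} v k w"
    using assms by (intro der_range_high) auto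
  then show ?thesis using assms by (intro der_range_low)
qed

text \<open>The two legs of a cap or a cup have consecutive windings, so they cannot both have
  winding 0.\<close>

lemma gen_wind_0:
  assumes "gen a j b" "a \<in> lists {g \<in> G. wind g = 0}" "b \<in> lists {g \<in> G. wind g = 0}"
  shows "box a j b"
  using assms by cases (auto dest: cap_wind cup_wind)

end

section \<open>Strict monoidal categories of words\<close>

context strict_whiskering
begin

text \<open>The tensor product of arrows is one of the two composites that
  \<open>interchange\<close> identifies.\<close>

definition strict_moncat :: "('g list, 'k) moncat" where
  "strict_moncat = \<lparr>obj = lists G, arr = A, src = dom, trg = cod, ident = idt, comp = (\<odot>),
     tensor_obj = (@), tensor_arr = (\<lambda>f g. (cod f \<rhd> g) \<odot> (f \<lhd> dom g)), unit = [],
     assoc = (\<lambda>u v w. idt (u @ v @ w)), lunit = idt, runit = idt\<rparr>"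

lemma strict_moncat_sel [simp]:
  "obj strict_moncat = lists G" "arr strict_moncat = A" "src strict_moncat = dom"
  "trg strict_moncat = cod" "ident strict_moncat = idt" "comp strict_moncat = (\<odot>)"
  "tensor_obj strict_moncat = (@)"
  "tensor_arr strict_moncat f g = (cod f \<rhd> g) \<odot> (f \<lhd> dom g)"
  "unit strict_moncat = []" "assoc strict_moncat u v w = idt (u @ v @ w)"
  "lunit strict_moncat = idt" "runit strict_moncat = idt"
  by (simp_all add: strict_moncat_def)

lemma category_strict_moncat: "category strict_moncat"
  by unfold_locales (auto simp: in_hom_iff)

lemma iso_idt: "v \<in> lists G \<Longrightarrow> iso strict_moncat (idt v)"
  using category.iso_ident[OF category_strict_moncat] by simp

lemma inverse_idt: "v \<in> lists G \<Longrightarrow> inverse_arr strict_moncat (idt v) = idt v"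
  using category.inverse_ident[OF category_strict_moncat] by simp

lemma slide_plain:
  "\<lbrakk>f \<in> A; g \<in> A; dom f = a; cod f = b; dom g = c; cod g = d\<rbrakk>
    \<Longrightarrow> (f \<lhd> d) \<odot> (a \<rhd> g) = (b \<rhd> g) \<odot> (f \<lhd> c)"
  using interchange by auto

lemma slide_plain_cmp:
  assumes "f \<in> A" "g \<in> A" "dom f = a" "cod f = b" "dom g = c" "cod g = d" "k \<in> A" "cod k = a @ c"
  shows "(f \<lhd> d) \<odot> (a \<rhd> g) \<odot> k = (b \<rhd> g) \<odot> (f \<lhd> c) \<odot> k"
proof -
  have [simp]: "a \<in> lists G" "b \<in> lists G" "c \<in> lists G" "d \<in> lists G"
    using dom_in cod_in assms by metis+
  show ?thesis using arg_cong[OF slide_plain[OF assms(1-6)], of "\<lambda>x. x \<odot> k"] assms by simp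
qed

lemma monoidal_strict_moncat: "monoidal_category strict_moncat"
proof -
  interpret category strict_moncat by (rule category_strict_moncat)
  show ?thesis
  proof unfold_locales
    fix f a a' f' a'' g b b' g' b''
    assume "f \<in> hom strict_moncat a a'" "f' \<in> hom strict_moncat a' a''"
      "g \<in> hom strict_moncat b b'" "g' \<in> hom strict_moncat b' b''"
    then have *: "f \<in> A" "f' \<in> A" "g \<in> A" "g' \<in> A" "dom f = a" "cod f = a'" "dom f' = a'"
      "cod f' = a''" "dom g = b" "cod g = b'" "dom g' = b'" "cod g' = b''"
      by (auto simp: in_hom_iff)
    then have [simp]: "a' \<in> lists G" "a'' \<in> lists G" "b \<in> lists G" "b' \<in> lists G"
      using dom_in cod_in by metis+
    show "tensor_arr strict_moncat (comp strict_moncat f' f) (comp strict_moncat g' g)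
      = comp strict_moncat (tensor_arr strict_moncat f' g') (tensor_arr strict_moncat f g)"
      \<comment> \<open>Both sides consist of four whiskered factors, of which only the middle two
        have to change places.\<close>
      using slide_plain_cmp[of f' g a' a'' b b' "f \<lhd> b"] * by simp
  qed (auto simp: in_hom_iff iso_idt)
qed

text \<open>\<open>adjunction\<close> in \<open>strict_moncat\<close> without the associators and
  unitors, which are identities there.\<close>

definition dual_pair :: "'g list \<Rightarrow> 'g list \<Rightarrow> 'k \<Rightarrow> 'k \<Rightarrow> bool" where
  "dual_pair x y e n \<longleftrightarrow> x \<in> lists G \<and> y \<in> lists G \<and>
     e \<in> A \<and> dom e = x @ y \<and> cod e = [] \<and> n \<in> A \<and> dom n = [] \<and> cod n = y @ x \<and>
     (y \<rhd> e) \<odot> (n \<lhd> y) = idt y \<and> (e \<lhd> x) \<odot> (x \<rhd> n) = idt x"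

lemma adjunction_dual_pair:
  assumes "dual_pair x y e n"
  shows "adjunction strict_moncat x y e n"
  using assms unfolding dual_pair_def adjunction_def by (auto simp: in_hom_iff inverse_idt)

lemma dual_pair_Nil: "dual_pair [] [] (idt []) (idt [])"
  by (simp add: dual_pair_def)

text \<open>Duals of a concatenation come in the reverse order, with caps and cups nested. In each
  snake equation the cap of one pair slides past the cup of the other, after which two separate
  snakes remain.\<close>

lemma dual_pair_append:
  assumes "dual_pair x a e n" "dual_pair y b e' n'"
  shows "dual_pair (y @ x) (a @ b) (e' \<odot> (y \<rhd> e \<lhd> b)) ((a \<rhd> n' \<lhd> x) \<odot> n)"
proof -
  note d = assms[unfolded dual_pair_def]
  have [simp]: "x \<in> lists G" "y \<in> lists G" "a \<in> lists G" "b \<in> lists G" "e \<in> A" "e' \<in> A" "n \<in> A" "n' \<in> A"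
    "dom e = x @ a" "cod e = []" "dom e' = y @ b" "cod e' = []"
    "dom n = []" "cod n = a @ x" "dom n' = []" "cod n' = b @ y" using d by auto
  have z: "(a \<rhd> e) \<odot> (n \<lhd> a) = idt a" "(e \<lhd> x) \<odot> (x \<rhd> n) = idt x"
    "(b \<rhd> e') \<odot> (n' \<lhd> b) = idt b" "(e' \<lhd> y) \<odot> (y \<rhd> n') = idt y" using d by auto
  have 1: "((b @ y) \<rhd> e \<lhd> b) \<odot> (n' \<lhd> (x @ a @ b)) = (n' \<lhd> b) \<odot> (e \<lhd> b)"
    using interchange[of n' "e \<lhd> b"] by simp
  have "((a @ b) \<rhd> (e' \<odot> (y \<rhd> e \<lhd> b))) \<odot> (((a \<rhd> n' \<lhd> x) \<odot> n) \<lhd> (a @ b))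
    = (a \<rhd> ((b \<rhd> e') \<odot> (((b @ y) \<rhd> e \<lhd> b) \<odot> (n' \<lhd> (x @ a @ b))))) \<odot> (n \<lhd> (a @ b))" by simp
  also have "\<dots> = (a \<rhd> (((b \<rhd> e') \<odot> (n' \<lhd> b)) \<odot> (e \<lhd> b))) \<odot> (n \<lhd> (a @ b))"
    unfolding 1 by simp
  also have "\<dots> = ((a \<rhd> e) \<odot> (n \<lhd> a)) \<lhd> b" unfolding z(3) by simp
  also have "\<dots> = idt (a @ b)" unfolding z by simp
  finally have A: "((a @ b) \<rhd> (e' \<odot> (y \<rhd> e \<lhd> b))) \<odot> (((a \<rhd> n' \<lhd> x) \<odot> n) \<lhd> (a @ b)) = idt (a @ b)" .
  have 2: "(e \<lhd> (b @ y @ x)) \<odot> ((x @ a) \<rhd> n' \<lhd> x) = (n' \<lhd> x) \<odot> (e \<lhd> x)"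
    using interchange[of e "n' \<lhd> x"] by simp
  have "((e' \<odot> (y \<rhd> e \<lhd> b)) \<lhd> (y @ x)) \<odot> ((y @ x) \<rhd> ((a \<rhd> n' \<lhd> x) \<odot> n))
    = (e' \<lhd> (y @ x)) \<odot> (y \<rhd> ((e \<lhd> (b @ y @ x)) \<odot> ((x @ a) \<rhd> n' \<lhd> x))) \<odot> ((y @ x) \<rhd> n)" by simp
  also have "\<dots> = (((e' \<lhd> y) \<odot> (y \<rhd> n')) \<lhd> x) \<odot> (y \<rhd> ((e \<lhd> x) \<odot> (x \<rhd> n)))"
    unfolding 2 by simp
  also have "\<dots> = idt (y @ x)" unfolding z by simp
  finally show ?thesis using A unfolding dual_pair_def by simp
qed

lemma autonomous_strict_moncat:
  assumes "\<And>g. g \<in> G \<Longrightarrow> \<exists>h e n. dual_pair [h] [g] e n"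
    and "\<And>g. g \<in> G \<Longrightarrow> \<exists>h e n. dual_pair [g] [h] e n"
  shows "autonomous_category strict_moncat"
proof -
  interpret monoidal_category strict_moncat by (rule monoidal_strict_moncat)
  have "\<exists>x e n. dual_pair x v e n" if "v \<in> lists G" for v
    using that
  proof (induction v)
    case (Cons g v)
    then show ?case using assms(1)[OF Cons(1)] dual_pair_append[of _ "[g]" _ _ _ v] by fastforce
  qed (use dual_pair_Nil in blast)
  moreover have "\<exists>x e n. dual_pair v x e n" if "v \<in> lists G" for v
    using that
  proof (induction v)
    case (Cons g v)
    then show ?case using assms(2)[OF Cons(1)] dual_pair_append[of v _ _ _ "[g]"] by fastforce
  qed (use dual_pair_Nil in blast)
  ultimately show ?thesis
    using adjunction_dual_pair by unfold_locales (fastforce simp del: in_lists_conv_set)+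
qed

lemma sub_whiskering:
  assumes "G' \<subseteq> G" "A' \<subseteq> A"
    and "\<And>f. f \<in> A' \<Longrightarrow> dom f \<in> lists G' \<and> cod f \<in> lists G'"
    and "\<And>v. v \<in> lists G' \<Longrightarrow> idt v \<in> A'"
    and "\<And>f g. \<lbrakk>f \<in> A'; g \<in> A'; cod f = dom g\<rbrakk> \<Longrightarrow> g \<odot> f \<in> A'"
    and "\<And>u f. \<lbrakk>u \<in> lists G'; f \<in> A'\<rbrakk> \<Longrightarrow> u \<rhd> f \<in> A'"
    and "\<And>u f. \<lbrakk>u \<in> lists G'; f \<in> A'\<rbrakk> \<Longrightarrow> f \<lhd> u \<in> A'"
  shows "strict_whiskering G' A' dom cod idt (\<odot>) (\<rhd>) (\<lhd>)"
proof -
  have [simp]: "v \<in> lists G' \<Longrightarrow> v \<in> lists G" "f \<in> A' \<Longrightarrow> f \<in> A" for v f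
    using assms(1,2) by auto
  show ?thesis
    by unfold_locales (simp_all add: assms(3-7) interchange)
qed

end

context zigzag
begin

lemma der_whiskering:
  assumes "Q \<subseteq> G"
  shows "strict_whiskering Q {f. der Q (dom f) f (cod f)} dom cod idt (\<odot>) (\<rhd>) (\<lhd>)"
proof -
  have in': "f \<in> A" if "der Q (dom f) f (cod f)" for f using der_in[OF assms that] by blast
  have G: "v \<in> lists Q \<Longrightarrow> v \<in> lists G" for v using assms by auto
  show ?thesis
  proof (rule sub_whiskering)
    show "g \<odot> f \<in> {f. der Q (dom f) f (cod f)}"
      if "f \<in> {f. der Q (dom f) f (cod f)}" "g \<in> {f. der Q (dom f) f (cod f)}" "cod f = dom g" for f g
      using that der_trans[OF assms, of "dom g" g "cod g" "dom f" f] in'[of f] in'[of g] by simp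
    show "u \<rhd> f \<in> {f. der Q (dom f) f (cod f)}" "f \<lhd> u \<in> {f. der Q (dom f) f (cod f)}"
      if "u \<in> lists Q" "f \<in> {f. der Q (dom f) f (cod f)}" for u f
      using that der_lw[OF assms, of "dom f" f "cod f" u] der_rw[OF assms, of "dom f" f "cod f" u]
        in'[of f] G by simp_all
  qed (use assms in' G der_lists der_idt in auto)
qed

end

section \<open>Words acting on a monoidal category\<close>

text \<open>Each word over an alphabet of objects of \<open>C\<close> acts on \<open>C\<close> by tensoring from the left.
  Endofunctors compose strictly, which strictifies \<open>C\<close>: the arrows between words are the
  natural transformations that commute with tensoring from the right.\<close>

locale word_action = monoidal_category C
  for C :: "('o, 'a) moncat" (structure) +
  fixes d :: "'g \<Rightarrow> 'o" and letter :: "'o \<Rightarrow> 'g" and G :: "'g set"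
  assumes d_obj [simp]: "g \<in> G \<Longrightarrow> d g \<in> obj C"
    and letter_in [simp]: "X \<in> obj C \<Longrightarrow> letter X \<in> G"
    and d_letter [simp]: "X \<in> obj C \<Longrightarrow> d (letter X) = X"
begin

primrec act :: "'g list \<Rightarrow> 'o \<Rightarrow> 'o" where
  "act [] Z = Z"
| "act (g # v) Z = d g \<otimes> act v Z"

primrec act_arr :: "'g list \<Rightarrow> 'a \<Rightarrow> 'a" where
  "act_arr [] f = f"
| "act_arr (g # v) f = ident C (d g) \<boxtimes> act_arr v f"

text \<open>An iterated associator. It makes the action of a word an endofunctor compatible with
  tensoring from the right.\<close>

primrec strength :: "'g list \<Rightarrow> 'o \<Rightarrow> 'o \<Rightarrow> 'a" where
  "strength [] Y Z = ident C (Y \<otimes> Z)"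
| "strength (g # v) Y Z = (ident C (d g) \<boxtimes> strength v Y Z) \<cdot> assoc C (d g) (act v Y) Z"

lemma act_append [simp]: "act (u @ v) Z = act u (act v Z)"
  by (induction u) auto

lemma act_arr_append [simp]: "act_arr (u @ v) f = act_arr u (act_arr v f)"
  by (induction u) auto

lemma act_obj [simp]: "v \<in> lists G \<Longrightarrow> Z \<in> obj C \<Longrightarrow> act v Z \<in> obj C"
  by (induction v) auto

lemma act_arr_simps [simp]:
  assumes "v \<in> lists G" "f \<in> arr C"
  shows "act_arr v f \<in> arr C" "src C (act_arr v f) = act v (src C f)" "trg C (act_arr v f) = act v (trg C f)"
  using assms by (induction v) auto

lemma act_arr_ident [simp]: "v \<in> lists G \<Longrightarrow> Z \<in> obj C \<Longrightarrow> act_arr v (ident C Z) = ident C (act v Z)"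
  by (induction v) auto

lemma act_arr_comp:
  assumes "v \<in> lists G" "f \<in> arr C" "g \<in> arr C" "trg C f = src C g"
  shows "act_arr v (g \<cdot> f) = act_arr v g \<cdot> act_arr v f"
  using assms by (induction v) auto

lemma act_arr_iso [simp]: "v \<in> lists G \<Longrightarrow> iso C f \<Longrightarrow> iso C (act_arr v f)"
  by (induction v) auto

lemma strength_simps [simp]:
  assumes "v \<in> lists G" "Y \<in> obj C" "Z \<in> obj C"
  shows "strength v Y Z \<in> arr C" "src C (strength v Y Z) = act v Y \<otimes> Z"
    "trg C (strength v Y Z) = act v (Y \<otimes> Z)" "iso C (strength v Y Z)"
  using assms by (induction v) auto

lemma strength_append:
  assumes "u \<in> lists G" "v \<in> lists G" "Y \<in> obj C" "Z \<in> obj C"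
  shows "strength (u @ v) Y Z = act_arr u (strength v Y Z) \<cdot> strength u (act v Y) Z"
  using assms by (induction u) auto

lemma strength_natural:
  assumes "u \<in> lists G" "f \<in> arr C" "Z \<in> obj C"
  shows "act_arr u (f \<boxtimes> ident C Z) \<cdot> strength u (src C f) Z
    = strength u (trg C f) Z \<cdot> (act_arr u f \<boxtimes> ident C Z)"
  using assms
proof (induction u)
  case (Cons g u)
  then have [simp]: "u \<in> lists G" "d g \<in> obj C" by auto
  have "act_arr (g # u) (f \<boxtimes> ident C Z) \<cdot> strength (g # u) (src C f) Z
    = (ident C (d g) \<boxtimes> (act_arr u (f \<boxtimes> ident C Z) \<cdot> strength u (src C f) Z)) \<cdot> assoc C (d g) (act u (src C f)) Z"
    using Cons by simp
  also have "\<dots> = (ident C (d g) \<boxtimes> strength u (trg C f) Z)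
      \<cdot> ((ident C (d g) \<boxtimes> (act_arr u f \<boxtimes> ident C Z)) \<cdot> assoc C (d g) (act u (src C f)) Z)"
    using Cons by simp
  also have "\<dots> = strength (g # u) (trg C f) Z \<cdot> (act_arr (g # u) f \<boxtimes> ident C Z)"
    using Cons assoc_nat[of "ident C (d g)" "act_arr u f" "ident C Z"] by simp
  finally show ?case .
qed auto

text \<open>The two words are stored with the family because different words may act in the same
  way. Membership in \<open>extensional\<close> makes families equal as soon as their components on
  objects agree.\<close>

definition fams :: "('g list \<times> ('o \<Rightarrow> 'a) \<times> 'g list) set" where
  "fams = {(v, k, w). v \<in> lists G \<and> w \<in> lists G \<and> k \<in> extensional (obj C) \<and>
     (\<forall>Z \<in> obj C. k Z \<in> hom C (act v Z) (act w Z)) \<and>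
     (\<forall>f \<in> arr C. act_arr w f \<cdot> k (src C f) = k (trg C f) \<cdot> act_arr v f) \<and>
     (\<forall>Y \<in> obj C. \<forall>Z \<in> obj C. k (Y \<otimes> Z) \<cdot> strength v Y Z = strength w Y Z \<cdot> (k Y \<boxtimes> ident C Z))}"

definition fam_dom :: "'g list \<times> ('o \<Rightarrow> 'a) \<times> 'g list \<Rightarrow> 'g list" where
  "fam_dom f = fst f"

definition fam_cod :: "'g list \<times> ('o \<Rightarrow> 'a) \<times> 'g list \<Rightarrow> 'g list" where
  "fam_cod f = snd (snd f)"

definition cmpt :: "'g list \<times> ('o \<Rightarrow> 'a) \<times> 'g list \<Rightarrow> 'o \<Rightarrow> 'a" where
  "cmpt f = fst (snd f)"

definition mk_fam :: "'g list \<Rightarrow> ('o \<Rightarrow> 'a) \<Rightarrow> 'g list \<Rightarrow> 'g list \<times> ('o \<Rightarrow> 'a) \<times> 'g list" where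
  "mk_fam v k w = (v, restrict k (obj C), w)"

lemma mk_fam_simps [simp]:
  "fam_dom (mk_fam v k w) = v" "fam_cod (mk_fam v k w) = w"
  "Z \<in> obj C \<Longrightarrow> cmpt (mk_fam v k w) Z = k Z"
  by (simp_all add: mk_fam_def fam_dom_def fam_cod_def cmpt_def)

lemma mk_famI:
  assumes "v \<in> lists G" "w \<in> lists G"
    and "\<And>Z. Z \<in> obj C \<Longrightarrow> k Z \<in> arr C \<and> src C (k Z) = act v Z \<and> trg C (k Z) = act w Z"
    and "\<And>f. f \<in> arr C \<Longrightarrow> act_arr w f \<cdot> k (src C f) = k (trg C f) \<cdot> act_arr v f"
    and "\<And>Y Z. \<lbrakk>Y \<in> obj C; Z \<in> obj C\<rbrakk>
      \<Longrightarrow> k (Y \<otimes> Z) \<cdot> strength v Y Z = strength w Y Z \<cdot> (k Y \<boxtimes> ident C Z)"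
  shows "mk_fam v k w \<in> fams"
  using assms unfolding fams_def mk_fam_def by (auto simp: in_hom_iff)

lemma fams_simps [simp]:
  assumes "f \<in> fams"
  shows "fam_dom f \<in> lists G" "fam_cod f \<in> lists G"
    and "Z \<in> obj C \<Longrightarrow> cmpt f Z \<in> arr C"
    and "Z \<in> obj C \<Longrightarrow> src C (cmpt f Z) = act (fam_dom f) Z"
    and "Z \<in> obj C \<Longrightarrow> trg C (cmpt f Z) = act (fam_cod f) Z"
  using assms by (auto simp: fams_def fam_dom_def fam_cod_def cmpt_def in_hom_iff)

lemma fams_natural:
  assumes "f \<in> fams" "h \<in> arr C" "src C h = Z" "trg C h = Z'"
  shows "act_arr (fam_cod f) h \<cdot> cmpt f Z = cmpt f Z' \<cdot> act_arr (fam_dom f) h"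
  using assms by (auto simp: fams_def fam_dom_def fam_cod_def cmpt_def)

lemma fams_strength:
  assumes "f \<in> fams" "Y \<in> obj C" "Z \<in> obj C"
  shows "cmpt f (Y \<otimes> Z) \<cdot> strength (fam_dom f) Y Z = strength (fam_cod f) Y Z \<cdot> (cmpt f Y \<boxtimes> ident C Z)"
  using assms by (auto simp: fams_def fam_dom_def fam_cod_def cmpt_def)

lemma fam_eqI:
  assumes "f \<in> fams" "g \<in> fams" "fam_dom f = fam_dom g" "fam_cod f = fam_cod g"
    and "\<And>Z. Z \<in> obj C \<Longrightarrow> cmpt f Z = cmpt g Z"
  shows "f = g"
proof -
  have "cmpt f = cmpt g"
    using assms by (intro extensionalityI[of _ "obj C"]) (auto simp: fams_def cmpt_def)
  then show ?thesis using assms by (simp add: fam_dom_def fam_cod_def cmpt_def prod_eq_iff)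
qed

definition fam_idt :: "'g list \<Rightarrow> 'g list \<times> ('o \<Rightarrow> 'a) \<times> 'g list" where
  "fam_idt v = mk_fam v (\<lambda>Z. ident C (act v Z)) v"

definition fam_cmp where
  "fam_cmp g f = mk_fam (fam_dom f) (\<lambda>Z. cmpt g Z \<cdot> cmpt f Z) (fam_cod g)"

text \<open>Whiskering of natural transformations: from the left it applies the functor
  \<open>act_arr u\<close> to the components, from the right it evaluates them at
  \<open>act u Z\<close>. Since \<open>act\<close> turns concatenation into composition, the
  whiskering laws hold strictly.\<close>

definition fam_lw where
  "fam_lw u f = mk_fam (u @ fam_dom f) (\<lambda>Z. act_arr u (cmpt f Z)) (u @ fam_cod f)"

definition fam_rw where
  "fam_rw f u = mk_fam (fam_dom f @ u) (\<lambda>Z. cmpt f (act u Z)) (fam_cod f @ u)"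

lemma fam_idt_in: "v \<in> lists G \<Longrightarrow> fam_idt v \<in> fams"
  unfolding fam_idt_def by (intro mk_famI) auto

lemma fam_cmp_in:
  assumes "f \<in> fams" "g \<in> fams" "fam_cod f = fam_dom g"
  shows "fam_cmp g f \<in> fams"
  unfolding fam_cmp_def
proof (intro mk_famI)
  fix h assume h: "h \<in> arr C"
  show "act_arr (fam_cod g) h \<cdot> (cmpt g (src C h) \<cdot> cmpt f (src C h)) =
        cmpt g (trg C h) \<cdot> cmpt f (trg C h) \<cdot> act_arr (fam_dom f) h"
    using assms h comp_tail[OF fams_natural[OF assms(2) h], of "src C h" "trg C h" "cmpt f (src C h)"]
      fams_natural[OF assms(1) h]
    by simp
next
  fix Y Z assume YZ: "Y \<in> obj C" "Z \<in> obj C"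
  then have [simp]: "strength (fam_dom g) Y Z \<in> arr C" "src C (strength (fam_dom g) Y Z) = act (fam_dom g) Y \<otimes> Z"
     "trg C (strength (fam_dom g) Y Z) = act (fam_dom g) (Y \<otimes> Z)" using assms by auto
  have 1: "cmpt g (Y \<otimes> Z) \<cdot> (strength (fam_dom g) Y Z \<cdot> (cmpt f Y \<boxtimes> ident C Z))
    = (strength (fam_cod g) Y Z \<cdot> (cmpt g Y \<boxtimes> ident C Z)) \<cdot> (cmpt f Y \<boxtimes> ident C Z)"
    using comp_tail[OF fams_strength[OF assms(2) YZ]] assms YZ by simp
  show "cmpt g (Y \<otimes> Z) \<cdot> cmpt f (Y \<otimes> Z) \<cdot> strength (fam_dom f) Y Z =
        strength (fam_cod g) Y Z \<cdot> ((cmpt g Y \<cdot> cmpt f Y) \<boxtimes> ident C Z)"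
    using assms YZ 1 fams_strength[OF assms(1) YZ] by simp
qed (use assms in auto)

lemma fam_lw_in:
  assumes "f \<in> fams" "u \<in> lists G"
  shows "fam_lw u f \<in> fams"
  unfolding fam_lw_def
proof (intro mk_famI)
  fix h assume h: "h \<in> arr C"
  then show "act_arr (u @ fam_cod f) h \<cdot> act_arr u (cmpt f (src C h)) =
         act_arr u (cmpt f (trg C h)) \<cdot> act_arr (u @ fam_dom f) h"
    using fams_natural[OF assms(1) h] assms by (simp add: act_arr_comp[symmetric])
next
  fix Y Z assume YZ [simp]: "Y \<in> obj C" "Z \<in> obj C"
  note [simp] = assms
  have "act_arr u (cmpt f (Y \<otimes> Z)) \<cdot> strength (u @ fam_dom f) Y Z
    = act_arr u (cmpt f (Y \<otimes> Z) \<cdot> strength (fam_dom f) Y Z) \<cdot> strength u (act (fam_dom f) Y) Z"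
    by (simp add: act_arr_comp strength_append)
  also have "\<dots> = act_arr u (strength (fam_cod f) Y Z)
      \<cdot> (act_arr u (cmpt f Y \<boxtimes> ident C Z) \<cdot> strength u (act (fam_dom f) Y) Z)"
    unfolding fams_strength[OF assms(1) YZ] by (simp add: act_arr_comp)
  also have "act_arr u (cmpt f Y \<boxtimes> ident C Z) \<cdot> strength u (act (fam_dom f) Y) Z
    = strength u (act (fam_cod f) Y) Z \<cdot> (act_arr u (cmpt f Y) \<boxtimes> ident C Z)"
    using strength_natural[of u "cmpt f Y" Z] by simp
  also have "act_arr u (strength (fam_cod f) Y Z) \<cdot> \<dots>
     = strength (u @ fam_cod f) Y Z \<cdot> (act_arr u (cmpt f Y) \<boxtimes> ident C Z)"
    by (simp add: strength_append)
  finally show "act_arr u (cmpt f (Y \<otimes> Z)) \<cdot> strength (u @ fam_dom f) Y Z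
    = strength (u @ fam_cod f) Y Z \<cdot> (act_arr u (cmpt f Y) \<boxtimes> ident C Z)" .
qed (use assms in auto)

lemma fam_rw_in:
  assumes "f \<in> fams" "u \<in> lists G"
  shows "fam_rw f u \<in> fams"
  unfolding fam_rw_def
proof (intro mk_famI)
  fix h assume h: "h \<in> arr C"
  show "act_arr (fam_cod f @ u) h \<cdot> cmpt f (act u (src C h)) =
         cmpt f (act u (trg C h)) \<cdot> act_arr (fam_dom f @ u) h"
    using fams_natural[OF assms(1), of "act_arr u h"] assms h by simp
next
  fix Y Z assume YZ [simp]: "Y \<in> obj C" "Z \<in> obj C"
  note [simp] = assms
  have n: "cmpt f (act u (Y \<otimes> Z)) \<cdot> act_arr (fam_dom f) (strength u Y Z)
    = act_arr (fam_cod f) (strength u Y Z) \<cdot> cmpt f (act u Y \<otimes> Z)"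
    using fams_natural[OF assms(1), of "strength u Y Z"] by simp
  have "cmpt f (act u (Y \<otimes> Z)) \<cdot> strength (fam_dom f @ u) Y Z
    = act_arr (fam_cod f) (strength u Y Z) \<cdot> (cmpt f (act u Y \<otimes> Z) \<cdot> strength (fam_dom f) (act u Y) Z)"
    using comp_tail[OF n] by (simp add: strength_append)
  also have "\<dots> = strength (fam_cod f @ u) Y Z \<cdot> (cmpt f (act u Y) \<boxtimes> ident C Z)"
    using fams_strength[OF assms(1), of "act u Y" Z] by (simp add: strength_append)
  finally show "cmpt f (act u (Y \<otimes> Z)) \<cdot> strength (fam_dom f @ u) Y Z
    = strength (fam_cod f @ u) Y Z \<cdot> (cmpt f (act u Y) \<boxtimes> ident C Z)" .
qed (use assms in auto)

lemma fam_simps [simp]: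
  "fam_dom (fam_idt v) = v" "fam_cod (fam_idt v) = v"
  "fam_dom (fam_cmp g f) = fam_dom f" "fam_cod (fam_cmp g f) = fam_cod g"
  "fam_dom (fam_lw u f) = u @ fam_dom f" "fam_cod (fam_lw u f) = u @ fam_cod f"
  "fam_dom (fam_rw f u) = fam_dom f @ u" "fam_cod (fam_rw f u) = fam_cod f @ u"
  "Z \<in> obj C \<Longrightarrow> cmpt (fam_idt v) Z = ident C (act v Z)"
  "Z \<in> obj C \<Longrightarrow> cmpt (fam_cmp g f) Z = cmpt g Z \<cdot> cmpt f Z"
  "Z \<in> obj C \<Longrightarrow> cmpt (fam_lw u f) Z = act_arr u (cmpt f Z)"
  "Z \<in> obj C \<Longrightarrow> cmpt (fam_rw f u) Z = cmpt f (act u Z)"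
  by (simp_all add: fam_idt_def fam_cmp_def fam_lw_def fam_rw_def)

lemma fam_cmp_idt:
  assumes "f \<in> fams"
  shows "fam_cmp f (fam_idt (fam_dom f)) = f" "fam_cmp (fam_idt (fam_cod f)) f = f"
  by (rule fam_eqI; use assms in \<open>simp add: fam_idt_in fam_cmp_in\<close>)+

sublocale strict_whiskering G fams fam_dom fam_cod fam_idt fam_cmp fam_lw fam_rw
proof
  show "fam_cmp f (fam_idt v) = f" if "f \<in> fams" "fam_dom f = v" for f v
    using fam_cmp_idt[of f] that by simp
  show "fam_cmp (fam_idt v) f = f" if "f \<in> fams" "fam_cod f = v" for f v
    using fam_cmp_idt[of f] that by simp
qed ((rule fam_eqI)?; simp add: fam_idt_in fam_cmp_in fam_lw_in fam_rw_in act_arr_comp fams_natural)+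

end

section \<open>Boxes, fusions, caps and cups as arrows between words\<close>

context word_action
begin

definition fam_inv where
  "fam_inv f = mk_fam (fam_cod f) (\<lambda>Z. inverse_arr C (cmpt f Z)) (fam_dom f)"

definition box_fam where
  "box_fam x h y = mk_fam [x] (\<lambda>Z. h \<boxtimes> ident C Z) [y]"

text \<open>The associator, read as an arrow from a one-letter word to a two-letter word;
  \<open>letter\<close> supplies a letter for the product. Its inverse is what allows an arrow out
  of \<open>d x \<otimes> d y\<close> to act on the word \<open>[x, y]\<close>.\<close>

definition split_fam where
  "split_fam x y = mk_fam [letter (d x \<otimes> d y)] (\<lambda>Z. assoc C (d x) (d y) Z) [x, y]"

definition counit_fam where
  "counit_fam = mk_fam [letter (unit C)] (lunit C) []"

definition fuse_fam where
  "fuse_fam x y h z = fam_cmp (box_fam (letter (d x \<otimes> d y)) h z) (fam_inv (split_fam x y))"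

definition intro_fam where
  "intro_fam h z = fam_cmp (box_fam (letter (unit C)) h z) (fam_inv counit_fam)"

definition cap_fam where
  "cap_fam x y e = fam_cmp counit_fam (fuse_fam x y e (letter (unit C)))"

definition cup_fam where
  "cup_fam y x n = fam_cmp (split_fam y x) (intro_fam n (letter (d y \<otimes> d x)))"

lemma gen_fam_simps [simp]:
  "fam_dom (fam_inv f) = fam_cod f" "fam_cod (fam_inv f) = fam_dom f"
  "fam_dom (box_fam x h y) = [x]" "fam_cod (box_fam x h y) = [y]"
  "fam_dom (split_fam x y) = [letter (d x \<otimes> d y)]" "fam_cod (split_fam x y) = [x, y]"
  "fam_dom counit_fam = [letter (unit C)]" "fam_cod counit_fam = []"
  "fam_dom (fuse_fam x y h z) = [x, y]" "fam_cod (fuse_fam x y h z) = [z]"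
  "fam_dom (intro_fam h z) = []" "fam_cod (intro_fam h z) = [z]"
  "fam_dom (cap_fam x y e) = [x, y]" "fam_cod (cap_fam x y e) = []"
  "fam_dom (cup_fam y x n) = []" "fam_cod (cup_fam y x n) = [y, x]"
  "Z \<in> obj C \<Longrightarrow> cmpt (fam_inv f) Z = inverse_arr C (cmpt f Z)"
  "Z \<in> obj C \<Longrightarrow> cmpt (box_fam x h y) Z = h \<boxtimes> ident C Z"
  "Z \<in> obj C \<Longrightarrow> cmpt (split_fam x y) Z = assoc C (d x) (d y) Z"
  "Z \<in> obj C \<Longrightarrow> cmpt counit_fam Z = lunit C Z"
  "Z \<in> obj C \<Longrightarrow> cmpt (fuse_fam x y h z) Z = (h \<boxtimes> ident C Z) \<cdot> inverse_arr C (assoc C (d x) (d y) Z)"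
  "Z \<in> obj C \<Longrightarrow> cmpt (intro_fam h z) Z = (h \<boxtimes> ident C Z) \<cdot> inverse_arr C (lunit C Z)"
  "Z \<in> obj C \<Longrightarrow> cmpt (cap_fam x y e) Z
    = lunit C Z \<cdot> ((e \<boxtimes> ident C Z) \<cdot> inverse_arr C (assoc C (d x) (d y) Z))"
  "Z \<in> obj C \<Longrightarrow> cmpt (cup_fam y x n) Z
    = assoc C (d y) (d x) Z \<cdot> ((n \<boxtimes> ident C Z) \<cdot> inverse_arr C (lunit C Z))"
  by (simp_all add: fam_inv_def box_fam_def split_fam_def counit_fam_def fuse_fam_def intro_fam_def
      cap_fam_def cup_fam_def)

lemma fam_inv_in:
  assumes "f \<in> fams" "\<And>Z. Z \<in> obj C \<Longrightarrow> iso C (cmpt f Z)"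
  shows "fam_inv f \<in> fams"
  unfolding fam_inv_def
proof (intro mk_famI)
  fix h assume "h \<in> arr C"
  then show "act_arr (fam_dom f) h \<cdot> inverse_arr C (cmpt f (src C h))
    = inverse_arr C (cmpt f (trg C h)) \<cdot> act_arr (fam_cod f) h"
    using fams_natural[OF assms(1), of h] assms by (intro inverse_square[symmetric]) auto
next
  fix Y Z assume "Y \<in> obj C" "Z \<in> obj C"
  then show "inverse_arr C (cmpt f (Y \<otimes> Z)) \<cdot> strength (fam_cod f) Y Z
    = strength (fam_dom f) Y Z \<cdot> (inverse_arr C (cmpt f Y) \<boxtimes> ident C Z)"
    using inverse_square[OF fams_strength[OF assms(1), of Y Z]] assms by (simp add: inverse_tensor)
qed (use assms in auto)

lemma box_fam_in [simp]:
  assumes "x \<in> G" "y \<in> G" "h \<in> arr C" "src C h = d x" "trg C h = d y"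
  shows "box_fam x h y \<in> fams"
  unfolding box_fam_def
proof (intro mk_famI)
  fix Y Z assume "Y \<in> obj C" "Z \<in> obj C"
  then show "(h \<boxtimes> ident C (Y \<otimes> Z)) \<cdot> strength [x] Y Z = strength [y] Y Z \<cdot> ((h \<boxtimes> ident C Y) \<boxtimes> ident C Z)"
    using assms assoc_nat[of h "ident C Y" "ident C Z" "d y"] by simp
qed (use assms in auto)

lemma split_fam_in [simp]:
  assumes [simp]: "x \<in> G" "y \<in> G"
  shows "split_fam x y \<in> fams"
  unfolding split_fam_def
proof (intro mk_famI)
  fix h assume "h \<in> arr C"
  then show "act_arr [x, y] h \<cdot> assoc C (d x) (d y) (src C h)
    = assoc C (d x) (d y) (trg C h) \<cdot> act_arr [letter (d x \<otimes> d y)] h"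
    using assoc_nat[of "ident C (d x)" "ident C (d y)" h "d x" "d y" "trg C h"] by simp
next
  fix Y Z assume "Y \<in> obj C" "Z \<in> obj C"
  then show "assoc C (d x) (d y) (Y \<otimes> Z) \<cdot> strength [letter (d x \<otimes> d y)] Y Z
    = strength [x, y] Y Z \<cdot> (assoc C (d x) (d y) Y \<boxtimes> ident C Z)"
    using pentagon[of "d x" "d y" Y Z] by simp
qed auto

text \<open>Naturality is that of \<open>lunit\<close>, and compatibility with
  \<open>strength\<close> is \<open>lunit_tensor\<close>. For \<open>split_fam\<close> the pentagon
  plays the latter role.\<close>

lemma counit_fam_in [simp]: "counit_fam \<in> fams"
  unfolding counit_fam_def
proof (intro mk_famI)
  fix h assume "h \<in> arr C"
  then show "act_arr [] h \<cdot> lunit C (src C h) = lunit C (trg C h) \<cdot> act_arr [letter (unit C)] h"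
    using lunit_nat[of h] by simp
next
  fix Y Z assume "Y \<in> obj C" "Z \<in> obj C"
  then show "lunit C (Y \<otimes> Z) \<cdot> strength [letter (unit C)] Y Z
    = strength [] Y Z \<cdot> (lunit C Y \<boxtimes> ident C Z)"
    using lunit_tensor[of Y Z] by simp
qed auto

lemma fuse_fam_in [simp]:
  "\<lbrakk>x \<in> G; y \<in> G; z \<in> G; h \<in> arr C; src C h = d x \<otimes> d y; trg C h = d z\<rbrakk> \<Longrightarrow> fuse_fam x y h z \<in> fams"
  unfolding fuse_fam_def by (intro fam_cmp_in fam_inv_in box_fam_in) auto

lemma intro_fam_in [simp]:
  "\<lbrakk>z \<in> G; h \<in> arr C; src C h = unit C; trg C h = d z\<rbrakk> \<Longrightarrow> intro_fam h z \<in> fams"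
  unfolding intro_fam_def by (intro fam_cmp_in fam_inv_in box_fam_in) auto

lemma cap_fam_in [simp]:
  "\<lbrakk>x \<in> G; y \<in> G; e \<in> arr C; src C e = d x \<otimes> d y; trg C e = unit C\<rbrakk> \<Longrightarrow> cap_fam x y e \<in> fams"
  unfolding cap_fam_def by (intro fam_cmp_in fuse_fam_in) auto

lemma cup_fam_in [simp]:
  "\<lbrakk>x \<in> G; y \<in> G; n \<in> arr C; src C n = unit C; trg C n = d y \<otimes> d x\<rbrakk> \<Longrightarrow> cup_fam y x n \<in> fams"
  unfolding cup_fam_def by (intro fam_cmp_in intro_fam_in) auto

text \<open>Up to associators and unitors this is the snake equation on \<open>A\<close>, tensored
  with \<open>Z\<close>. The numbered equations carry these to the outer end, where the triangle
  removes the last associator.\<close>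

lemma snake_right:
  assumes "adjunction C X A e n" "Z \<in> obj C"
  shows "(ident C A \<boxtimes> (lunit C Z \<cdot> ((e \<boxtimes> ident C Z) \<cdot> inverse_arr C (assoc C X A Z))))
    \<cdot> (assoc C A X (A \<otimes> Z) \<cdot> ((n \<boxtimes> ident C (A \<otimes> Z)) \<cdot> inverse_arr C (lunit C (A \<otimes> Z))))
    = ident C (A \<otimes> Z)"
proof -
  note adj = assms(1)[unfolded adjunction_def in_hom_iff]
  have [simp]: "X \<in> obj C" "A \<in> obj C" "e \<in> arr C" "src C e = X \<otimes> A" "trg C e = unit C"
    "n \<in> arr C" "src C n = unit C" "trg C n = A \<otimes> X" "Z \<in> obj C"
    using adj assms by auto
  note [simp del] = tensor_tensor tensor_tail
  let ?i = "ident C" and ?l = "lunit C" and ?a = "assoc C" and ?inv = "inverse_arr C" and ?I = "unit C"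
  have s: "runit C A \<cdot> ((?i A \<boxtimes> e) \<cdot> (?a A X A \<cdot> ((n \<boxtimes> ?i A) \<cdot> ?inv (?l A)))) = ?i A"
    using adj by simp
  have 1: "?inv (?l (A \<otimes> Z)) = ?a ?I A Z \<cdot> (?inv (?l A) \<boxtimes> ?i Z)"
    using inverse_square[of "?l (A \<otimes> Z)" "?a ?I A Z" "?i (A \<otimes> Z)" "?l A \<boxtimes> ?i Z"]
      lunit_tensor[of A Z] by (simp add: inverse_tensor)
  have 2: "(n \<boxtimes> ?i (A \<otimes> Z)) \<cdot> ?a ?I A Z = ?a (A \<otimes> X) A Z \<cdot> ((n \<boxtimes> ?i A) \<boxtimes> ?i Z)"
    using assoc_nat[of n "?i A" "?i Z"] by simp
  have 3: "(?i A \<boxtimes> ?inv (?a X A Z)) \<cdot> (?a A X (A \<otimes> Z) \<cdot> ?a (A \<otimes> X) A Z)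
    = ?a A (X \<otimes> A) Z \<cdot> (?a A X A \<boxtimes> ?i Z)"
    using inverse_tail(2)[of "?i A \<boxtimes> ?a X A Z" "?a A (X \<otimes> A) Z \<cdot> (?a A X A \<boxtimes> ?i Z)"]
      pentagon[of A X A Z] by (simp add: inverse_tensor)
  have 4: "(?i A \<boxtimes> (e \<boxtimes> ?i Z)) \<cdot> ?a A (X \<otimes> A) Z = ?a A ?I Z \<cdot> ((?i A \<boxtimes> e) \<boxtimes> ?i Z)"
    using assoc_nat[of "?i A" e "?i Z"] by simp
  have "(?i A \<boxtimes> (?l Z \<cdot> ((e \<boxtimes> ?i Z) \<cdot> ?inv (?a X A Z)))) 
      \<cdot> (?a A X (A \<otimes> Z) \<cdot> ((n \<boxtimes> ?i (A \<otimes> Z)) \<cdot> ?inv (?l (A \<otimes> Z))))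
    = (?i A \<boxtimes> ?l Z) \<cdot> ((?i A \<boxtimes> (e \<boxtimes> ?i Z)) \<cdot> ((?i A \<boxtimes> ?inv (?a X A Z)) \<cdot> 
        (?a A X (A \<otimes> Z) \<cdot> ((n \<boxtimes> ?i (A \<otimes> Z)) \<cdot> (?a ?I A Z \<cdot> (?inv (?l A) \<boxtimes> ?i Z))))))"
    unfolding 1 by (simp add: tensor_tensor tensor_tail)
  also have "\<dots> = (?i A \<boxtimes> ?l Z) \<cdot> ((?i A \<boxtimes> (e \<boxtimes> ?i Z)) \<cdot> ((?i A \<boxtimes> ?inv (?a X A Z)) \<cdot> 
        (?a A X (A \<otimes> Z) \<cdot> (?a (A \<otimes> X) A Z \<cdot> (((n \<boxtimes> ?i A) \<boxtimes> ?i Z) \<cdot> (?inv (?l A) \<boxtimes> ?i Z))))))"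
    using comp_tail[OF 2] by simp
  also have "\<dots> = (?i A \<boxtimes> ?l Z) \<cdot> ((?i A \<boxtimes> (e \<boxtimes> ?i Z)) \<cdot> (?a A (X \<otimes> A) Z \<cdot> (
        (?a A X A \<boxtimes> ?i Z) \<cdot> (((n \<boxtimes> ?i A) \<boxtimes> ?i Z) \<cdot> (?inv (?l A) \<boxtimes> ?i Z)))))"
    using comp_tail[OF 3] by simp
  also have "\<dots> = (?i A \<boxtimes> ?l Z) \<cdot> (?a A ?I Z \<cdot> (((?i A \<boxtimes> e) \<boxtimes> ?i Z) \<cdot> (
        (?a A X A \<boxtimes> ?i Z) \<cdot> (((n \<boxtimes> ?i A) \<boxtimes> ?i Z) \<cdot> (?inv (?l A) \<boxtimes> ?i Z)))))"
    using comp_tail[OF 4] by simp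
  also have "\<dots> = (runit C A \<boxtimes> ?i Z) \<cdot> (((?i A \<boxtimes> e) \<boxtimes> ?i Z) \<cdot> (
        (?a A X A \<boxtimes> ?i Z) \<cdot> (((n \<boxtimes> ?i A) \<boxtimes> ?i Z) \<cdot> (?inv (?l A) \<boxtimes> ?i Z))))"
    using comp_tail[OF triangle[of A Z]] by simp
  also have "\<dots> = (runit C A \<cdot> ((?i A \<boxtimes> e) \<cdot> (?a A X A \<cdot> ((n \<boxtimes> ?i A) \<cdot> ?inv (?l A))))) \<boxtimes> ?i Z"
    by (simp add: tensor_tensor tensor_tail)
  also have "\<dots> = ?i (A \<otimes> Z)" unfolding s by simp
  finally show ?thesis .
qed

lemma snake_left:
  assumes "adjunction C X A e n" "Z \<in> obj C"
  shows "lunit C (X \<otimes> Z) \<cdot> ((e \<boxtimes> ident C (X \<otimes> Z)) \<cdot> (inverse_arr C (assoc C X A (X \<otimes> Z))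
    \<cdot> (ident C X \<boxtimes> (assoc C A X Z \<cdot> ((n \<boxtimes> ident C Z) \<cdot> inverse_arr C (lunit C Z))))))
    = ident C (X \<otimes> Z)"
proof -
  note adj = assms(1)[unfolded adjunction_def in_hom_iff]
  have [simp]: "X \<in> obj C" "A \<in> obj C" "e \<in> arr C" "src C e = X \<otimes> A" "trg C e = unit C"
    "n \<in> arr C" "src C n = unit C" "trg C n = A \<otimes> X" "Z \<in> obj C"
    using adj assms by auto
  note [simp del] = tensor_tensor tensor_tail
  let ?i = "ident C" and ?l = "lunit C" and ?r = "runit C" and ?a = "assoc C" and ?inv = "inverse_arr C" and ?I = "unit C"
  have s: "?l X \<cdot> ((e \<boxtimes> ?i X) \<cdot> (?inv (?a X A X) \<cdot> ((?i X \<boxtimes> n) \<cdot> ?inv (?r X)))) = ?i X"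
    using adj by simp
  have 1: "?i X \<boxtimes> ?inv (?l Z) = ?a X ?I Z \<cdot> (?inv (?r X) \<boxtimes> ?i Z)"
    using inverse_square[of "?i X \<boxtimes> ?l Z" "?a X ?I Z" "?i (X \<otimes> Z)" "?r X \<boxtimes> ?i Z"]
      triangle[of X Z] by (simp add: inverse_tensor)
  have 2: "(?i X \<boxtimes> (n \<boxtimes> ?i Z)) \<cdot> ?a X ?I Z = ?a X (A \<otimes> X) Z \<cdot> ((?i X \<boxtimes> n) \<boxtimes> ?i Z)"
    using assoc_nat[of "?i X" n "?i Z"] by simp
  have p: "?a X A (X \<otimes> Z) \<cdot> ?a (X \<otimes> A) X Z
     = ((?i X \<boxtimes> ?a A X Z) \<cdot> ?a X (A \<otimes> X) Z) \<cdot> (?a X A X \<boxtimes> ?i Z)"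
    using pentagon[of X A X Z] by simp
  have 3: "?inv (?a X A (X \<otimes> Z)) \<cdot> ((?i X \<boxtimes> ?a A X Z) \<cdot> ?a X (A \<otimes> X) Z)
    = ?a (X \<otimes> A) X Z \<cdot> (?inv (?a X A X) \<boxtimes> ?i Z)"
    using inverse_square[OF p] by (simp add: inverse_tensor)
  \<comment> \<open>Restated with a tail \<open>y\<close>: in a composite nested to the right, the
    three factors on the left-hand side are no longer a subterm of their own.\<close>
  have 3: "?inv (?a X A (X \<otimes> Z)) \<cdot> ((?i X \<boxtimes> ?a A X Z) \<cdot> (?a X (A \<otimes> X) Z \<cdot> y))
    = ?a (X \<otimes> A) X Z \<cdot> ((?inv (?a X A X) \<boxtimes> ?i Z) \<cdot> y)"
    if "y \<in> arr C" "trg C y = (X \<otimes> (A \<otimes> X)) \<otimes> Z" for y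
    using comp_tail[OF 3, of y] that by simp
  have 4: "(e \<boxtimes> ?i (X \<otimes> Z)) \<cdot> ?a (X \<otimes> A) X Z = ?a ?I X Z \<cdot> ((e \<boxtimes> ?i X) \<boxtimes> ?i Z)"
    using assoc_nat[of e "?i X" "?i Z"] by simp
  have "?l (X \<otimes> Z) \<cdot> ((e \<boxtimes> ?i (X \<otimes> Z)) \<cdot> (?inv (?a X A (X \<otimes> Z))
      \<cdot> (?i X \<boxtimes> (?a A X Z \<cdot> ((n \<boxtimes> ?i Z) \<cdot> ?inv (?l Z))))))
    = ?l (X \<otimes> Z) \<cdot> ((e \<boxtimes> ?i (X \<otimes> Z)) \<cdot> (?inv (?a X A (X \<otimes> Z))
      \<cdot> ((?i X \<boxtimes> ?a A X Z) \<cdot> ((?i X \<boxtimes> (n \<boxtimes> ?i Z)) \<cdot> (?i X \<boxtimes> ?inv (?l Z))))))"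
    by (simp add: tensor_tensor)
  also have "\<dots> = ?l (X \<otimes> Z) \<cdot> ((e \<boxtimes> ?i (X \<otimes> Z)) \<cdot> (?inv (?a X A (X \<otimes> Z))
      \<cdot> ((?i X \<boxtimes> ?a A X Z) \<cdot> (?a X (A \<otimes> X) Z \<cdot> (((?i X \<boxtimes> n) \<boxtimes> ?i Z) \<cdot> (?inv (?r X) \<boxtimes> ?i Z))))))"
    unfolding 1 using comp_tail[OF 2] by simp
  also have "\<dots> = ?l (X \<otimes> Z) \<cdot> ((e \<boxtimes> ?i (X \<otimes> Z)) \<cdot> (?a (X \<otimes> A) X Z \<cdot> ((?inv (?a X A X) \<boxtimes> ?i Z)
      \<cdot> (((?i X \<boxtimes> n) \<boxtimes> ?i Z) \<cdot> (?inv (?r X) \<boxtimes> ?i Z)))))"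
    using 3 by simp
  also have "\<dots> = ?l (X \<otimes> Z) \<cdot> (?a ?I X Z \<cdot> (((e \<boxtimes> ?i X) \<boxtimes> ?i Z) \<cdot> ((?inv (?a X A X) \<boxtimes> ?i Z)
      \<cdot> (((?i X \<boxtimes> n) \<boxtimes> ?i Z) \<cdot> (?inv (?r X) \<boxtimes> ?i Z)))))"
    using comp_tail[OF 4] by simp
  also have "\<dots> = (?l X \<boxtimes> ?i Z) \<cdot> (((e \<boxtimes> ?i X) \<boxtimes> ?i Z) \<cdot> ((?inv (?a X A X) \<boxtimes> ?i Z)
      \<cdot> (((?i X \<boxtimes> n) \<boxtimes> ?i Z) \<cdot> (?inv (?r X) \<boxtimes> ?i Z))))"
    using comp_tail[OF lunit_tensor[of X Z]] by simp
  also have "\<dots> = (?l X \<cdot> ((e \<boxtimes> ?i X) \<cdot> (?inv (?a X A X) \<cdot> ((?i X \<boxtimes> n) \<cdot> ?inv (?r X))))) \<boxtimes> ?i Z"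
    by (simp add: tensor_tensor tensor_tail)
  also have "\<dots> = ?i (X \<otimes> Z)" unfolding s by simp
  finally show ?thesis .
qed

lemma dual_pair_fam:
  assumes "adjunction C (d x) (d y) e n" "x \<in> G" "y \<in> G"
  shows "dual_pair [x] [y] (cap_fam x y e) (cup_fam y x n)"
proof -
  have [simp]: "e \<in> arr C" "src C e = d x \<otimes> d y" "trg C e = unit C"
    "n \<in> arr C" "src C n = unit C" "trg C n = d y \<otimes> d x" "x \<in> G" "y \<in> G"
    using assms unfolding adjunction_def in_hom_iff by auto
  have "fam_cmp (fam_lw [y] (cap_fam x y e)) (fam_rw (cup_fam y x n) [y]) = fam_idt [y]"
    using snake_right[OF assms(1)] by (intro fam_eqI) (simp_all del: tensor_tensor tensor_tail)
  moreover have "fam_cmp (fam_rw (cap_fam x y e) [x]) (fam_lw [x] (cup_fam y x n)) = fam_idt [x]"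
    using snake_left[OF assms(1)] by (intro fam_eqI) (simp_all del: tensor_tensor tensor_tail)
  ultimately show ?thesis unfolding dual_pair_def by simp
qed

end

context word_action
begin

lemma fam_inv_cmp:
  assumes "f \<in> fams" "\<And>Z. Z \<in> obj C \<Longrightarrow> iso C (cmpt f Z)"
  shows "fam_cmp (fam_inv f) f = fam_idt (fam_dom f)" "fam_cmp f (fam_inv f) = fam_idt (fam_cod f)"
  using assms fam_inv_in[OF assms] by (auto intro!: fam_eqI simp: fam_cmp_in fam_idt_in)

lemma inverse_arrows_fam_inv:
  assumes "f \<in> fams" "\<And>Z. Z \<in> obj C \<Longrightarrow> iso C (cmpt f Z)"
  shows "inverse_arrows strict_moncat f (fam_inv f)"
  using fam_inv_cmp[OF assms] fam_inv_in[OF assms] assms(1)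
  unfolding inverse_arrows_def by (simp add: in_hom_iff)

lemma fam_inv_fuse_in [simp]:
  assumes "x \<in> G" "y \<in> G" "z \<in> G" "iso C h" "src C h = d x \<otimes> d y" "trg C h = d z"
  shows "fam_inv (fuse_fam x y h z) \<in> fams"
  using assms iso_arr[OF assms(4)] by (intro fam_inv_in) auto

lemma fam_inv_intro_in [simp]:
  assumes "z \<in> G" "iso C h" "src C h = unit C" "trg C h = d z"
  shows "fam_inv (intro_fam h z) \<in> fams"
  using assms iso_arr[OF assms(2)] by (intro fam_inv_in) auto

text \<open>Commuting with tensoring from the right is what keeps the category of words small.\<close>

lemma fams_determined:
  assumes f: "f \<in> fams" and g: "g \<in> fams" and "fam_dom f = fam_dom g" "fam_cod f = fam_cod g"
    and eq: "cmpt f (unit C) = cmpt g (unit C)"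
  shows "f = g"
proof (rule fam_eqI)
  fix Z assume Z [simp]: "Z \<in> obj C"
  note [simp] = f g assms(3,4) iso_arr
  let ?v = "fam_dom g" and ?w = "fam_cod g"
  have [simp]: "?v \<in> lists G" using g by (rule fams_simps)
  \<comment> \<open>Compatibility with \<open>strength\<close> fixes the component at
    \<open>unit C \<otimes> Z\<close> from the one at the unit; naturality along
    \<open>lunit C Z\<close> then carries it to \<open>Z\<close>.\<close>
  have "cmpt f (unit C \<otimes> Z) \<cdot> strength ?v (unit C) Z = cmpt g (unit C \<otimes> Z) \<cdot> strength ?v (unit C) Z"
    using fams_strength[OF f, of "unit C" Z] fams_strength[OF g, of "unit C" Z] eq by simp
  then have u: "cmpt f (unit C \<otimes> Z) = cmpt g (unit C \<otimes> Z)"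
    by (rule iso_cancel_right) simp_all
  have "cmpt f Z \<cdot> act_arr ?v (lunit C Z) = cmpt g Z \<cdot> act_arr ?v (lunit C Z)"
    using fams_natural[OF f, of "lunit C Z" "unit C \<otimes> Z" Z]
      fams_natural[OF g, of "lunit C Z" "unit C \<otimes> Z" Z] u by simp
  then show "cmpt f Z = cmpt g Z"
    by (rule iso_cancel_right) simp_all
qed fact+

text \<open>The labelling \<open>l\<close> is a parameter because one object may be denoted by
  several letters; the construction is used once with formal wires for \<open>F\<close> and once
  with the objects of \<open>L\<close> as letters for the identity functor.\<close>

definition lift :: "('x, 'y) moncat \<Rightarrow> ('x, 'y, 'o, 'a) monfun \<Rightarrow> ('x \<Rightarrow> 'g)
    \<Rightarrow> ('x, 'y, 'g list, 'g list \<times> ('o \<Rightarrow> 'a) \<times> 'g list) monfun" where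
  "lift X K l = \<lparr>fobj = (\<lambda>A. [l A]),
     farr = (\<lambda>f. box_fam (l (src X f)) (farr K f) (l (trg X f))),
     fmult = (\<lambda>A B. fuse_fam (l A) (l B) (fmult K A B) (l (A \<otimes>\<^bsub>X\<^esub> B))),
     funit = intro_fam (funit K) (l (unit X))\<rparr>"

lemma lift_sel [simp]:
  "fobj (lift X K l) A = [l A]"
  "farr (lift X K l) f = box_fam (l (src X f)) (farr K f) (l (trg X f))"
  "fmult (lift X K l) A B = fuse_fam (l A) (l B) (fmult K A B) (l (A \<otimes>\<^bsub>X\<^esub> B))"
  "funit (lift X K l) = intro_fam (funit K) (l (unit X))"
  by (simp_all add: lift_def)

text \<open>Stated for a subcategory \<open>A'\<close>, so that it covers all arrows between words
  as well as those built from generators. Whether an arrow is invertible depends on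
  \<open>A'\<close>, hence the conditions on \<open>fam_inv\<close>.\<close>

lemma strong_monoidal_lift:
  fixes X :: "('x, 'y) moncat"
  assumes S: "strict_whiskering G' A' fam_dom fam_cod fam_idt fam_cmp fam_lw fam_rw"
    and sub: "A' \<subseteq> fams" "G' \<subseteq> G"
    and K: "strong_monoidal_functor X C K"
    and l: "\<And>A. A \<in> obj X \<Longrightarrow> l A \<in> G' \<and> d (l A) = fobj K A"
    and arr: "\<And>f. f \<in> arr X \<Longrightarrow> farr (lift X K l) f \<in> A'"
    and mult: "\<And>A B. \<lbrakk>A \<in> obj X; B \<in> obj X\<rbrakk> \<Longrightarrow> fmult (lift X K l) A B \<in> A' \<and> fam_inv (fmult (lift X K l) A B) \<in> A'"
    and unit: "funit (lift X K l) \<in> A' \<and> fam_inv (funit (lift X K l)) \<in> A'"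
  shows "strong_monoidal_functor X
    (strict_whiskering.strict_moncat G' A' fam_dom fam_cod fam_idt fam_cmp fam_lw fam_rw) (lift X K l)"
proof -
  interpret S: strict_whiskering G' A' fam_dom fam_cod fam_idt fam_cmp fam_lw fam_rw by (rule S)
  interpret K: strong_monoidal_functor X C K by (rule K)
  have fams: "f \<in> A' \<Longrightarrow> f \<in> fams" for f using sub by auto
  have [simp]: "A \<in> obj X \<Longrightarrow> l A \<in> G'" "A \<in> obj X \<Longrightarrow> l A \<in> G" "A \<in> obj X \<Longrightarrow> d (l A) = fobj K A"
    "A \<in> obj X \<Longrightarrow> fobj K A \<in> obj C" for A
    using l sub K.fobj_in_obj by auto
  have [simp]: "farr K f \<in> arr C" "src C (farr K f) = fobj K (src X f)" "trg C (farr K f) = fobj K (trg X f)"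
    if "f \<in> arr X" for f
    using K.farr_in_hom[of f "src X f" "trg X f"] that by (auto simp: in_hom_iff)
  have [simp]: "fmult K A B \<in> arr C" "src C (fmult K A B) = fobj K A \<otimes> fobj K B"
    "trg C (fmult K A B) = fobj K (A \<otimes>\<^bsub>X\<^esub> B)" "iso C (fmult K A B)" if "A \<in> obj X" "B \<in> obj X" for A B
    using K.fmult_in_hom[OF that] K.fmult_iso[OF that] by (auto simp: in_hom_iff)
  have [simp]: "funit K \<in> arr C" "src C (funit K) = unit C" "trg C (funit K) = fobj K (unit X)" "iso C (funit K)"
    using K.funit_in_hom K.funit_iso by (auto simp: in_hom_iff)
  have inv: "iso S.strict_moncat f" if "f \<in> A'" "fam_inv f \<in> A'" "\<And>Z. Z \<in> obj C \<Longrightarrow> iso C (cmpt f Z)" for f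
  proof -
    have "inverse_arrows S.strict_moncat f (fam_inv f)"
      using that fam_inv_cmp[OF fams[OF that(1)] that(3)] unfolding inverse_arrows_def by (simp add: in_hom_iff)
    then show ?thesis unfolding iso_def by blast
  qed
  note [simp] = fam_idt_in fam_cmp_in fam_lw_in fam_rw_in
  show ?thesis
  proof (intro strong_monoidal_functor.intro K.C.monoidal_category_axioms S.monoidal_strict_moncat
      strong_monoidal_functor_axioms.intro)
    fix A B f assume "f \<in> hom X A B"
    then show "farr (lift X K l) f \<in> hom S.strict_moncat (fobj (lift X K l) A) (fobj (lift X K l) B)"
      using arr[of f] by (auto simp: in_hom_iff)
  next
    fix A assume A: "A \<in> obj X"
    then show "farr (lift X K l) (ident X A) = ident S.strict_moncat (fobj (lift X K l) A)"
      by (intro fam_eqI) (auto simp: K.farr_ident)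
  next
    fix A B E f g assume fg: "f \<in> hom X A B" "g \<in> hom X B E"
    then have "farr K (g \<cdot>\<^bsub>X\<^esub> f) = farr K g \<cdot> farr K f" by (rule K.farr_comp)
    then show "farr (lift X K l) (g \<cdot>\<^bsub>X\<^esub> f) = farr (lift X K l) g \<cdot>\<^bsub>S.strict_moncat\<^esub> farr (lift X K l) f"
      using fg by (intro fam_eqI) (auto simp: in_hom_iff)
  next
    fix A B assume "A \<in> obj X" "B \<in> obj X"
    then show "fmult (lift X K l) A B \<in> hom S.strict_moncat
        (fobj (lift X K l) A \<otimes>\<^bsub>S.strict_moncat\<^esub> fobj (lift X K l) B) (fobj (lift X K l) (A \<otimes>\<^bsub>X\<^esub> B))"
      "iso S.strict_moncat (fmult (lift X K l) A B)"
      using mult[of A B] by (auto simp: in_hom_iff intro!: inv)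
  next
    fix A A' B B' f g assume fg: "f \<in> hom X A A'" "g \<in> hom X B B'"
    then have "fmult K A' B' \<cdot> (farr K f \<boxtimes> farr K g) = farr K (f \<boxtimes>\<^bsub>X\<^esub> g) \<cdot> fmult K A B"
      by (rule K.fmult_natural)
    then have "(fmult K A' B' \<boxtimes> ident C Z) \<cdot> (inverse_arr C (assoc C (fobj K A') (fobj K B') Z) \<cdot> (farr K f \<boxtimes> (farr K g \<boxtimes> ident C Z)))
      = (farr K (f \<boxtimes>\<^bsub>X\<^esub> g) \<boxtimes> ident C Z) \<cdot> ((fmult K A B \<boxtimes> ident C Z) \<cdot> inverse_arr C (assoc C (fobj K A) (fobj K B) Z))"
      if "Z \<in> obj C" for Z
      using that fg by (intro mult_act) (auto simp: in_hom_iff)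
    then show "fmult (lift X K l) A' B' \<cdot>\<^bsub>S.strict_moncat\<^esub> (farr (lift X K l) f \<boxtimes>\<^bsub>S.strict_moncat\<^esub> farr (lift X K l) g)
      = farr (lift X K l) (f \<boxtimes>\<^bsub>X\<^esub> g) \<cdot>\<^bsub>S.strict_moncat\<^esub> fmult (lift X K l) A B"
      using fg by (intro fam_eqI) (auto simp: in_hom_iff)
  next
    show "funit (lift X K l) \<in> hom S.strict_moncat (unit S.strict_moncat) (fobj (lift X K l) (unit X))"
      "iso S.strict_moncat (funit (lift X K l))"
      using unit by (auto simp: in_hom_iff intro!: inv)
  next
    fix A B E assume ABE [simp]: "A \<in> obj X" "B \<in> obj X" "E \<in> obj X"
    have "(farr K (assoc X A B E) \<boxtimes> ident C Z) \<cdot> ((fmult K (A \<otimes>\<^bsub>X\<^esub> B) E \<boxtimes> ident C Z)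
        \<cdot> (inverse_arr C (assoc C (fobj K (A \<otimes>\<^bsub>X\<^esub> B)) (fobj K E) Z)
        \<cdot> ((fmult K A B \<boxtimes> ident C (fobj K E \<otimes> Z)) \<cdot> inverse_arr C (assoc C (fobj K A) (fobj K B) (fobj K E \<otimes> Z)))))
      = (fmult K A (B \<otimes>\<^bsub>X\<^esub> E) \<boxtimes> ident C Z) \<cdot> (inverse_arr C (assoc C (fobj K A) (fobj K (B \<otimes>\<^bsub>X\<^esub> E)) Z)
        \<cdot> (ident C (fobj K A) \<boxtimes> ((fmult K B E \<boxtimes> ident C Z) \<cdot> inverse_arr C (assoc C (fobj K B) (fobj K E) Z))))"
      if "Z \<in> obj C" for Z
      using that K.assoc_coherence[OF ABE]
      by (intro assoc_act[where r = "fobj K (A \<otimes>\<^bsub>X\<^esub> (B \<otimes>\<^bsub>X\<^esub> E))" and ?r1.0 = "fobj K ((A \<otimes>\<^bsub>X\<^esub> B) \<otimes>\<^bsub>X\<^esub> E)"]) (auto simp: in_hom_iff)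
    then show "farr (lift X K l) (assoc X A B E) \<cdot>\<^bsub>S.strict_moncat\<^esub> fmult (lift X K l) (A \<otimes>\<^bsub>X\<^esub> B) E
        \<cdot>\<^bsub>S.strict_moncat\<^esub> (fmult (lift X K l) A B \<boxtimes>\<^bsub>S.strict_moncat\<^esub> ident S.strict_moncat (fobj (lift X K l) E))
      = fmult (lift X K l) A (B \<otimes>\<^bsub>X\<^esub> E) \<cdot>\<^bsub>S.strict_moncat\<^esub>
        (ident S.strict_moncat (fobj (lift X K l) A) \<boxtimes>\<^bsub>S.strict_moncat\<^esub> fmult (lift X K l) B E)
        \<cdot>\<^bsub>S.strict_moncat\<^esub> assoc S.strict_moncat (fobj (lift X K l) A) (fobj (lift X K l) B) (fobj (lift X K l) E)"
      by (intro fam_eqI) auto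
  next
    fix A assume A [simp]: "A \<in> obj X"
    have "(farr K (lunit X A) \<boxtimes> ident C Z) \<cdot> ((fmult K (unit X) A \<boxtimes> ident C Z)
        \<cdot> (inverse_arr C (assoc C (fobj K (unit X)) (fobj K A) Z)
        \<cdot> ((funit K \<boxtimes> ident C (fobj K A \<otimes> Z)) \<cdot> inverse_arr C (lunit C (fobj K A \<otimes> Z)))))
      = ident C (fobj K A \<otimes> Z)" if "Z \<in> obj C" for Z
      using that K.lunit_coherence[OF A]
      by (intro lunit_act[where c = "fobj K (unit X \<otimes>\<^bsub>X\<^esub> A)"]) (auto simp: in_hom_iff)
    then show "farr (lift X K l) (lunit X A) \<cdot>\<^bsub>S.strict_moncat\<^esub> fmult (lift X K l) (unit X) A
        \<cdot>\<^bsub>S.strict_moncat\<^esub> (funit (lift X K l) \<boxtimes>\<^bsub>S.strict_moncat\<^esub> ident S.strict_moncat (fobj (lift X K l) A))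
      = lunit S.strict_moncat (fobj (lift X K l) A)"
      by (intro fam_eqI) auto
    have "(farr K (runit X A) \<boxtimes> ident C Z) \<cdot> ((fmult K A (unit X) \<boxtimes> ident C Z)
        \<cdot> (inverse_arr C (assoc C (fobj K A) (fobj K (unit X)) Z)
        \<cdot> (ident C (fobj K A) \<boxtimes> ((funit K \<boxtimes> ident C Z) \<cdot> inverse_arr C (lunit C Z)))))
      = ident C (fobj K A \<otimes> Z)" if "Z \<in> obj C" for Z
      using that K.runit_coherence[OF A]
      by (intro runit_act[where c = "fobj K (A \<otimes>\<^bsub>X\<^esub> unit X)"]) (auto simp: in_hom_iff)
    then show "farr (lift X K l) (runit X A) \<cdot>\<^bsub>S.strict_moncat\<^esub> fmult (lift X K l) A (unit X)
        \<cdot>\<^bsub>S.strict_moncat\<^esub> (ident S.strict_moncat (fobj (lift X K l) A) \<boxtimes>\<^bsub>S.strict_moncat\<^esub> funit (lift X K l))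
      = runit S.strict_moncat (fobj (lift X K l) A)"
      by (intro fam_eqI) auto
  qed simp
qed

end

section \<open>Words in the image of a monoidal functor\<close>

locale word_functor = strict_whiskering G A dom cod idt cmp lw rw
  for G :: "'g set" and A :: "'k set" and dom cod :: "'k \<Rightarrow> 'g list"
    and idt :: "'g list \<Rightarrow> 'k" and cmp :: "'k \<Rightarrow> 'k \<Rightarrow> 'k" (infixr "\<odot>" 55)
    and lw :: "'g list \<Rightarrow> 'k \<Rightarrow> 'k" (infixr "\<rhd>" 70)
    and rw :: "'k \<Rightarrow> 'g list \<Rightarrow> 'k" (infixl "\<lhd>" 71) +
  fixes X :: "('x, 'y) moncat" and K :: "('x, 'y, 'g list, 'k) monfun" and l :: "'x \<Rightarrow> 'g"
  assumes strong: "strong_monoidal_functor X strict_moncat K"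
    and letters: "\<And>E. E \<in> obj X \<Longrightarrow> fobj K E = [l E]"
begin

sublocale K: strong_monoidal_functor X strict_moncat K by (rule strong)

primrec total :: "'x list \<Rightarrow> 'x" where
  "total [] = unit X"
| "total (E # Es) = E \<otimes>\<^bsub>X\<^esub> total Es"

text \<open>The canonical multiplication of a word into one letter. The product is nested to the
  right and ends in the unit, so that the empty word fits the same scheme.\<close>

primrec pack :: "'x list \<Rightarrow> 'k" where
  "pack [] = funit K"
| "pack (E # Es) = fmult K E (total Es) \<odot> ([l E] \<rhd> pack Es)"

lemma total_obj [simp]: "As \<in> lists (obj X) \<Longrightarrow> total As \<in> obj X"
  by (induction As) auto

lemma letter_in_G [simp]: "E \<in> obj X \<Longrightarrow> l E \<in> G"
  using K.fobj_in_obj letters by fastforce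

lemma map_letter_in_G [simp]: "As \<in> lists (obj X) \<Longrightarrow> map l As \<in> lists G"
  by (induction As) auto

lemma farr_K [simp]:
  assumes "f \<in> arr X"
  shows "farr K f \<in> A" "dom (farr K f) = [l (src X f)]" "cod (farr K f) = [l (trg X f)]"
  using K.farr_in_hom[of f "src X f" "trg X f"] assms letters by (auto simp: in_hom_iff)

lemma fmult_K [simp]:
  assumes "A1 \<in> obj X" "A2 \<in> obj X"
  shows "fmult K A1 A2 \<in> A" "dom (fmult K A1 A2) = [l A1, l A2]"
    "cod (fmult K A1 A2) = [l (A1 \<otimes>\<^bsub>X\<^esub> A2)]"
  using K.fmult_in_hom[of A1 A2] assms letters by (auto simp: in_hom_iff)

lemma funit_K [simp]: "funit K \<in> A" "dom (funit K) = []" "cod (funit K) = [l (unit X)]"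
  using K.funit_in_hom letters by (auto simp: in_hom_iff)

lemma pack_simps [simp]:
  assumes "As \<in> lists (obj X)"
  shows "pack As \<in> A" "dom (pack As) = map l As" "cod (pack As) = [l (total As)]"
  using assms by (induction As) auto

lemma farr_K_comp:
  assumes "f \<in> arr X" "g \<in> arr X" "trg X f = src X g"
  shows "farr K (g \<cdot>\<^bsub>X\<^esub> f) = farr K g \<odot> farr K f"
  using K.farr_comp[of f "src X f" "trg X f" g "trg X g"] assms by (auto simp: in_hom_iff)

lemma farr_K_ident: "A1 \<in> obj X \<Longrightarrow> farr K (ident X A1) = idt [l A1]"
  using K.farr_ident letters by simp

lemma farr_K_transpose:
  assumes "farr K f \<odot> m = x" "iso X f" "m \<in> A" "cod m = [l (src X f)]"
  shows "m = farr K (inverse_arr X f) \<odot> x"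
proof -
  have f [simp]: "f \<in> arr X" using assms(2) by (rule K.C.iso_arr)
  have i: "farr K (inverse_arr X f) \<odot> farr K f = idt [l (src X f)]"
    using farr_K_comp[of f "inverse_arr X f"] assms(2) by (simp add: farr_K_ident)
  have "farr K (inverse_arr X f) \<odot> x = (farr K (inverse_arr X f) \<odot> farr K f) \<odot> m"
    using assms by auto
  also have "\<dots> = m" unfolding i using assms by simp
  finally show ?thesis by simp
qed

lemma fmult_K_nat:
  assumes "f \<in> arr X" "g \<in> arr X"
  shows "fmult K (trg X f) (trg X g) \<odot> ([l (trg X f)] \<rhd> farr K g) \<odot> (farr K f \<lhd> [l (src X g)])
    = farr K (f \<boxtimes>\<^bsub>X\<^esub> g) \<odot> fmult K (src X f) (src X g)"
  using K.fmult_natural[of f "src X f" "trg X f" g "src X g" "trg X g"] assms by (auto simp: in_hom_iff)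

text \<open>Conjugation by \<open>pack\<close>, written as a commuting square so that
  \<open>pack\<close> need not be inverted.\<close>

definition collapses :: "'x list \<Rightarrow> 'k \<Rightarrow> 'x list \<Rightarrow> 'x list \<Rightarrow> 'y \<Rightarrow> bool" where
  "collapses As k Bs Cs g \<longleftrightarrow> g \<in> hom X (total (As @ Cs)) (total (Bs @ Cs)) \<and>
     pack (Bs @ Cs) \<odot> (k \<lhd> map l Cs) = farr K g \<odot> pack (As @ Cs)"

text \<open>The context \<open>Cs\<close> on the right makes this stable under whiskering from the right.\<close>

definition collapsible :: "'x list \<Rightarrow> 'k \<Rightarrow> 'x list \<Rightarrow> bool" where
  "collapsible As k Bs \<longleftrightarrow> As \<in> lists (obj X) \<and> Bs \<in> lists (obj X) \<and>
     k \<in> A \<and> dom k = map l As \<and> cod k = map l Bs \<and> (\<forall>Cs \<in> lists (obj X). \<exists>g. collapses As k Bs Cs g)"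

lemma collapsibleE:
  assumes "collapsible As k Bs" "Cs \<in> lists (obj X)"
  obtains g where "collapses As k Bs Cs g"
  using assms unfolding collapsible_def by blast

lemma collapsible_idt:
  assumes "As \<in> lists (obj X)"
  shows "collapsible As (idt (map l As)) As"
proof -
  have "collapses As (idt (map l As)) As Cs (ident X (total (As @ Cs)))" if Cs: "Cs \<in> lists (obj X)" for Cs
    using assms Cs unfolding collapses_def by (simp add: in_hom_iff farr_K_ident)
  then show ?thesis using assms unfolding collapsible_def by auto
qed

lemma collapsible_cmp:
  assumes "collapsible As j Bs" "collapsible Bs k Ds"
  shows "collapsible As (k \<odot> j) Ds"
proof -
  note * = assms[unfolded collapsible_def]
  have "\<exists>g. collapses As (k \<odot> j) Ds Cs g" if Cs: "Cs \<in> lists (obj X)" for Cs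
  proof -
    obtain g h where g: "collapses As j Bs Cs g" and h: "collapses Bs k Ds Cs h"
      using collapsibleE[OF assms(1) Cs] collapsibleE[OF assms(2) Cs] by metis
    note gh = g[unfolded collapses_def in_hom_iff] h[unfolded collapses_def in_hom_iff]
    have "pack (Ds @ Cs) \<odot> ((k \<odot> j) \<lhd> map l Cs) = (pack (Ds @ Cs) \<odot> (k \<lhd> map l Cs)) \<odot> (j \<lhd> map l Cs)"
      using * Cs by simp
    also have "\<dots> = farr K h \<odot> (pack (Bs @ Cs) \<odot> (j \<lhd> map l Cs))"
      using * gh Cs by simp
    also have "\<dots> = farr K (h \<cdot>\<^bsub>X\<^esub> g) \<odot> pack (As @ Cs)"
      using * gh Cs by (simp add: farr_K_comp)
    finally have "collapses As (k \<odot> j) Ds Cs (h \<cdot>\<^bsub>X\<^esub> g)"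
      using gh unfolding collapses_def by (simp add: in_hom_iff)
    then show ?thesis by blast
  qed
  then show ?thesis using * unfolding collapsible_def by simp
qed

text \<open>The multiplication by \<open>E\<close> is the outermost step of \<open>pack\<close>, so
  the witness is tensored with \<open>ident X E\<close> and naturality of \<open>fmult\<close>
  applies. A letter added on the right would sit innermost; that side is handled by the context
  \<open>Cs\<close>.\<close>

lemma collapsible_lw1:
  assumes "collapsible As k Bs" "E \<in> obj X"
  shows "collapsible (E # As) ([l E] \<rhd> k) (E # Bs)"
proof -
  note * = assms[unfolded collapsible_def]
  have "\<exists>g. collapses (E # As) ([l E] \<rhd> k) (E # Bs) Cs g" if Cs: "Cs \<in> lists (obj X)" for Cs
  proof -
    obtain g where g: "collapses As k Bs Cs g" using collapsibleE[OF assms(1) Cs] .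
    note g = g[unfolded collapses_def in_hom_iff]
    have "pack ((E # Bs) @ Cs) \<odot> (([l E] \<rhd> k) \<lhd> map l Cs)
      = fmult K E (total (Bs @ Cs)) \<odot> ([l E] \<rhd> (pack (Bs @ Cs) \<odot> (k \<lhd> map l Cs)))"
      using * Cs by simp
    also have "\<dots> = (fmult K E (total (Bs @ Cs)) \<odot> ([l E] \<rhd> farr K g)) \<odot> ([l E] \<rhd> pack (As @ Cs))"
      using * Cs g by simp
    also have "fmult K E (total (Bs @ Cs)) \<odot> ([l E] \<rhd> farr K g)
      = farr K (ident X E \<boxtimes>\<^bsub>X\<^esub> g) \<odot> fmult K E (total (As @ Cs))"
      using fmult_K_nat[of "ident X E" g] g * Cs by (simp add: farr_K_ident)
    also have "(farr K (ident X E \<boxtimes>\<^bsub>X\<^esub> g) \<odot> fmult K E (total (As @ Cs))) \<odot> ([l E] \<rhd> pack (As @ Cs))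
      = farr K (ident X E \<boxtimes>\<^bsub>X\<^esub> g) \<odot> pack ((E # As) @ Cs)"
      using * Cs g by simp
    finally show ?thesis
      using g * Cs unfolding collapses_def
      by (intro exI[of _ "ident X E \<boxtimes>\<^bsub>X\<^esub> g"]) (simp add: in_hom_iff)
  qed
  then show ?thesis using * unfolding collapsible_def by simp
qed

lemma collapsible_lw:
  assumes "collapsible As k Bs" "Es \<in> lists (obj X)"
  shows "collapsible (Es @ As) (map l Es \<rhd> k) (Es @ Bs)"
  using assms(2)
proof (induction Es)
  case Nil
  then show ?case using assms(1) by (simp add: collapsible_def)
next
  case (Cons E Es)
  then show ?case
    using collapsible_lw1[of "Es @ As" "map l Es \<rhd> k" "Es @ Bs" E] assms(1)
    by (simp add: collapsible_def)
qed

lemma collapsible_rw: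
  assumes "collapsible As k Bs" "Es \<in> lists (obj X)"
  shows "collapsible (As @ Es) (k \<lhd> map l Es) (Bs @ Es)"
proof -
  note * = assms[unfolded collapsible_def]
  have "\<exists>g. collapses (As @ Es) (k \<lhd> map l Es) (Bs @ Es) Cs g" if Cs: "Cs \<in> lists (obj X)" for Cs
  proof -
    obtain g where "collapses As k Bs (Es @ Cs) g"
      using collapsibleE[OF assms(1), of "Es @ Cs"] assms(2) Cs by auto
    then have "collapses (As @ Es) (k \<lhd> map l Es) (Bs @ Es) Cs g"
      using * Cs by (simp add: collapses_def)
    then show ?thesis by blast
  qed
  then show ?thesis using * unfolding collapsible_def by simp
qed

lemma collapsible_farr:
  assumes "f \<in> arr X"
  shows "collapsible [src X f] (farr K f) [trg X f]"
proof -
  have "collapses [src X f] (farr K f) [trg X f] Cs (f \<boxtimes>\<^bsub>X\<^esub> ident X (total Cs))"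
    if Cs: "Cs \<in> lists (obj X)" for Cs
  proof -
    have "pack ([trg X f] @ Cs) \<odot> (farr K f \<lhd> map l Cs)
      = fmult K (trg X f) (total Cs) \<odot> (([l (trg X f)] \<rhd> pack Cs) \<odot> (farr K f \<lhd> map l Cs))"
      using assms Cs by simp
    also have "\<dots> = (fmult K (trg X f) (total Cs) \<odot> (farr K f \<lhd> [l (total Cs)])) \<odot> ([l (src X f)] \<rhd> pack Cs)"
      using slide_plain[of "farr K f" "pack Cs"] assms Cs by simp
    also have "fmult K (trg X f) (total Cs) \<odot> (farr K f \<lhd> [l (total Cs)])
      = farr K (f \<boxtimes>\<^bsub>X\<^esub> ident X (total Cs)) \<odot> fmult K (src X f) (total Cs)"
      using fmult_K_nat[of f "ident X (total Cs)"] assms Cs by (simp add: farr_K_ident)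
    finally show ?thesis using assms Cs unfolding collapses_def by (simp add: in_hom_iff)
  qed
  then show ?thesis using assms unfolding collapsible_def by auto
qed

text \<open>Lets the structure isomorphisms of \<open>K\<close> serve as boxes in both directions:
  the witnesses for \<open>j\<close> are the inverses of those for \<open>k\<close>.\<close>

lemma collapsible_inverse:
  assumes "As \<in> lists (obj X)" "Bs \<in> lists (obj X)"
    and k: "k \<in> A" "dom k = map l As" "cod k = map l Bs"
    and j: "j \<in> A" "dom j = map l Bs" "cod j = map l As" "k \<odot> j = idt (map l Bs)"
    and g: "\<And>Cs. Cs \<in> lists (obj X) \<Longrightarrow> iso X (g Cs) \<and> collapses As k Bs Cs (g Cs)"
  shows "collapsible Bs j As"
proof -
  have "collapses Bs j As Cs (inverse_arr X (g Cs))" if Cs: "Cs \<in> lists (obj X)" for Cs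
  proof -
    note [simp] = assms(1-8) Cs
    let ?h = "inverse_arr X (g Cs)"
    note g = g[OF Cs, unfolded collapses_def in_hom_iff]
    have "pack (Bs @ Cs) = (pack (Bs @ Cs) \<odot> (k \<lhd> map l Cs)) \<odot> (j \<lhd> map l Cs)"
      using arg_cong[OF j(4), of "\<lambda>x. x \<lhd> map l Cs"] by simp
    also have "\<dots> = farr K (g Cs) \<odot> (pack (As @ Cs) \<odot> (j \<lhd> map l Cs))"
      using g by simp
    finally have "farr K (g Cs) \<odot> (pack (As @ Cs) \<odot> (j \<lhd> map l Cs)) = pack (Bs @ Cs)" by simp
    from farr_K_transpose[OF this]
    have "pack (As @ Cs) \<odot> (j \<lhd> map l Cs) = farr K ?h \<odot> pack (Bs @ Cs)"
      using g by simp
    then show ?thesis using g unfolding collapses_def by (simp add: in_hom_iff)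
  qed
  then show ?thesis using assms unfolding collapsible_def by auto
qed

text \<open>Associativity coherence of \<open>K\<close>, with the product of the context as third
  factor. For \<open>funit\<close> the left unit coherence plays the same role.\<close>

lemma collapses_fmult:
  assumes [simp]: "A1 \<in> obj X" "A2 \<in> obj X" "Cs \<in> lists (obj X)"
  shows "collapses [A1, A2] (fmult K A1 A2) [A1 \<otimes>\<^bsub>X\<^esub> A2] Cs (inverse_arr X (assoc X A1 A2 (total Cs)))"
proof -
  let ?a = "assoc X A1 A2 (total Cs)" and ?t = "total Cs"
  let ?m = "fmult K (A1 \<otimes>\<^bsub>X\<^esub> A2) ?t \<odot> (fmult K A1 A2 \<lhd> [l ?t])"
  have coh: "farr K ?a \<odot> ?m = fmult K A1 (A2 \<otimes>\<^bsub>X\<^esub> ?t) \<odot> ([l A1] \<rhd> fmult K A2 ?t)"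
    using K.assoc_coherence[of A1 A2 ?t] by (simp add: letters)
  have m: "?m = farr K (inverse_arr X ?a) \<odot> (fmult K A1 (A2 \<otimes>\<^bsub>X\<^esub> ?t) \<odot> ([l A1] \<rhd> fmult K A2 ?t))"
    by (rule farr_K_transpose[OF coh]) simp_all
  have "pack ([A1 \<otimes>\<^bsub>X\<^esub> A2] @ Cs) \<odot> (fmult K A1 A2 \<lhd> map l Cs)
    = fmult K (A1 \<otimes>\<^bsub>X\<^esub> A2) ?t \<odot> (([l (A1 \<otimes>\<^bsub>X\<^esub> A2)] \<rhd> pack Cs) \<odot> (fmult K A1 A2 \<lhd> map l Cs))" by simp
  also have "\<dots> = ?m \<odot> ([l A1, l A2] \<rhd> pack Cs)"
    using slide_plain[of "fmult K A1 A2" "pack Cs"] by simp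
  also have "\<dots> = farr K (inverse_arr X ?a) \<odot> pack ([A1, A2] @ Cs)"
    unfolding m by simp
  finally show ?thesis unfolding collapses_def by (simp add: in_hom_iff)
qed

lemma collapses_funit:
  assumes [simp]: "Cs \<in> lists (obj X)"
  shows "collapses [] (funit K) [unit X] Cs (inverse_arr X (lunit X (total Cs)))"
proof -
  let ?a = "lunit X (total Cs)" and ?t = "total Cs"
  let ?m = "fmult K (unit X) ?t \<odot> (funit K \<lhd> [l ?t])"
  have coh: "farr K ?a \<odot> ?m = idt [l ?t]"
    using K.lunit_coherence[of ?t] by (simp add: letters)
  have m: "?m = farr K (inverse_arr X ?a)"
    using farr_K_transpose[OF coh] by simp
  have "pack ([unit X] @ Cs) \<odot> (funit K \<lhd> map l Cs)
    = fmult K (unit X) ?t \<odot> (([l (unit X)] \<rhd> pack Cs) \<odot> (funit K \<lhd> map l Cs))" by simp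
  also have "\<dots> = ?m \<odot> pack Cs"
    using slide_plain[of "funit K" "pack Cs"] by simp
  also have "\<dots> = farr K (inverse_arr X ?a) \<odot> pack ([] @ Cs)"
    unfolding m by simp
  finally show ?thesis unfolding collapses_def by (simp add: in_hom_iff)
qed

lemma collapsible_fmult:
  assumes "A1 \<in> obj X" "A2 \<in> obj X"
  shows "collapsible [A1, A2] (fmult K A1 A2) [A1 \<otimes>\<^bsub>X\<^esub> A2]"
  using assms collapses_fmult unfolding collapsible_def by auto

lemma collapsible_fmult_inverse:
  assumes "A1 \<in> obj X" "A2 \<in> obj X" "inverse_arrows strict_moncat (fmult K A1 A2) j"
  shows "collapsible [A1 \<otimes>\<^bsub>X\<^esub> A2] j [A1, A2]"
  using assms collapses_fmult
  by (intro collapsible_inverse[where k = "fmult K A1 A2" and g = "\<lambda>Cs. inverse_arr X (assoc X A1 A2 (total Cs))"])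
    (auto simp: inverse_arrows_def in_hom_iff)

lemma collapsible_funit: "collapsible [] (funit K) [unit X]"
  using collapses_funit unfolding collapsible_def by auto

lemma collapsible_funit_inverse:
  assumes "inverse_arrows strict_moncat (funit K) j"
  shows "collapsible [unit X] j []"
  using assms collapses_funit
  by (intro collapsible_inverse[where k = "funit K" and g = "\<lambda>Cs. inverse_arr X (lunit X (total Cs))"])
    (auto simp: inverse_arrows_def in_hom_iff)

lemma collapsible_single:
  assumes "collapsible [A1] k [A2]"
  shows "\<exists>g \<in> hom X A1 A2. k = farr K g"
proof -
  note * = assms[unfolded collapsible_def]
  have [simp]: "A1 \<in> obj X" "A2 \<in> obj X" using * by auto
  \<comment> \<open>Here \<open>total [E]\<close> is \<open>E\<close> tensored with the unit, and by
    unit coherence \<open>pack [E]\<close> is inverse to the image of the right unitor. Conjugating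
    by right unitors in \<open>X\<close> therefore recovers \<open>k\<close>.\<close>
  have r: "farr K (runit X E) \<odot> pack [E] = idt [l E]" if "E \<in> obj X" for E
    using K.runit_coherence[of E] that by (simp add: letters)
  obtain g where "collapses [A1] k [A2] [] g" using collapsibleE[OF assms, of "[]"] by auto
  note g = this[unfolded collapses_def in_hom_iff]
  let ?r = "runit X A1"
  have p: "pack [A1] = farr K (inverse_arr X ?r)"
    using farr_K_transpose[OF r[of A1]] by simp
  have "k = (farr K (runit X A2) \<odot> pack [A2]) \<odot> k" using r[of A2] * by simp
  also have "\<dots> = farr K (runit X A2) \<odot> (farr K g \<odot> pack [A1])"
    using g * by simp
  also have "\<dots> = farr K (runit X A2 \<cdot>\<^bsub>X\<^esub> (g \<cdot>\<^bsub>X\<^esub> inverse_arr X ?r))"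
    unfolding p using g by (simp add: farr_K_comp)
  finally show ?thesis using g by (intro bexI[of _ "runit X A2 \<cdot>\<^bsub>X\<^esub> (g \<cdot>\<^bsub>X\<^esub> inverse_arr X ?r)"]) (auto simp: in_hom_iff)
qed

end

section \<open>Change of universe\<close>

text \<open>Strict preservation makes transport a mere relabelling, without coherence
  isomorphisms.\<close>

definition moncat_iso :: "('p, 'b) moncat \<Rightarrow> ('q, 'c) moncat \<Rightarrow> ('p \<Rightarrow> 'q) \<Rightarrow> ('b \<Rightarrow> 'c) \<Rightarrow> bool" where
  "moncat_iso D E p q \<longleftrightarrow> bij_betw p (obj D) (obj E) \<and> bij_betw q (arr D) (arr E) \<and>
     (\<forall>f \<in> arr D. src E (q f) = p (src D f) \<and> trg E (q f) = p (trg D f)) \<and>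
     (\<forall>A \<in> obj D. ident E (p A) = q (ident D A)) \<and>
     (\<forall>f \<in> arr D. \<forall>g \<in> arr D. trg D f = src D g \<longrightarrow> q g \<cdot>\<^bsub>E\<^esub> q f = q (g \<cdot>\<^bsub>D\<^esub> f)) \<and>
     (\<forall>A \<in> obj D. \<forall>B \<in> obj D. p A \<otimes>\<^bsub>E\<^esub> p B = p (A \<otimes>\<^bsub>D\<^esub> B)) \<and>
     (\<forall>f \<in> arr D. \<forall>g \<in> arr D. q f \<boxtimes>\<^bsub>E\<^esub> q g = q (f \<boxtimes>\<^bsub>D\<^esub> g)) \<and>
     unit E = p (unit D) \<and>
     (\<forall>A \<in> obj D. \<forall>B \<in> obj D. \<forall>X \<in> obj D. assoc E (p A) (p B) (p X) = q (assoc D A B X)) \<and>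
     (\<forall>A \<in> obj D. lunit E (p A) = q (lunit D A)) \<and> (\<forall>A \<in> obj D. runit E (p A) = q (runit D A))"

definition post :: "('p \<Rightarrow> 'q) \<Rightarrow> ('b \<Rightarrow> 'c) \<Rightarrow> ('o, 'a, 'p, 'b) monfun \<Rightarrow> ('o, 'a, 'q, 'c) monfun" where
  "post p q G = \<lparr>fobj = (\<lambda>A. p (fobj G A)), farr = (\<lambda>f. q (farr G f)),
     fmult = (\<lambda>A B. q (fmult G A B)), funit = q (funit G)\<rparr>"

lemma post_sel [simp]:
  "fobj (post p q G) A = p (fobj G A)" "farr (post p q G) f = q (farr G f)"
  "fmult (post p q G) A B = q (fmult G A B)" "funit (post p q G) = q (funit G)"
  by (simp_all add: post_def)

text \<open>Typing is what moving an equation along \<open>p\<close> and \<open>q\<close> requires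
  of its constituents. For a composite functor it follows without first showing that the composite
  is strong monoidal.\<close>

definition well_typed :: "('p, 'b) moncat \<Rightarrow> ('o, 'a) moncat \<Rightarrow> ('o, 'a, 'p, 'b) monfun \<Rightarrow> bool" where
  "well_typed D X G \<longleftrightarrow> (\<forall>A \<in> obj X. fobj G A \<in> obj D) \<and>
     (\<forall>f \<in> arr X. farr G f \<in> hom D (fobj G (src X f)) (fobj G (trg X f))) \<and>
     (\<forall>A \<in> obj X. \<forall>B \<in> obj X. fmult G A B \<in> hom D (fobj G A \<otimes>\<^bsub>D\<^esub> fobj G B) (fobj G (A \<otimes>\<^bsub>X\<^esub> B))) \<and>
     funit G \<in> hom D (unit D) (fobj G (unit X))"

context
  fixes D :: "('p, 'b) moncat" and E :: "('q, 'c) moncat" and p :: "'p \<Rightarrow> 'q" and q :: "'b \<Rightarrow> 'c"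
  assumes mon: "monoidal_category D" and moniso: "moncat_iso D E p q"
begin

interpretation D: monoidal_category D by (rule mon)

lemma moniso_simps [simp]:
  "A \<in> obj D \<Longrightarrow> p A \<in> obj E"
  "f \<in> arr D \<Longrightarrow> q f \<in> arr E"
  "f \<in> arr D \<Longrightarrow> src E (q f) = p (src D f)"
  "f \<in> arr D \<Longrightarrow> trg E (q f) = p (trg D f)"
  "A \<in> obj D \<Longrightarrow> ident E (p A) = q (ident D A)"
  "\<lbrakk>f \<in> arr D; g \<in> arr D; trg D f = src D g\<rbrakk> \<Longrightarrow> q g \<cdot>\<^bsub>E\<^esub> q f = q (g \<cdot>\<^bsub>D\<^esub> f)"
  "\<lbrakk>A \<in> obj D; B \<in> obj D\<rbrakk> \<Longrightarrow> p A \<otimes>\<^bsub>E\<^esub> p B = p (A \<otimes>\<^bsub>D\<^esub> B)"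
  "\<lbrakk>f \<in> arr D; g \<in> arr D\<rbrakk> \<Longrightarrow> q f \<boxtimes>\<^bsub>E\<^esub> q g = q (f \<boxtimes>\<^bsub>D\<^esub> g)"
  "unit E = p (unit D)"
  "\<lbrakk>A \<in> obj D; B \<in> obj D; X \<in> obj D\<rbrakk> \<Longrightarrow> assoc E (p A) (p B) (p X) = q (assoc D A B X)"
  "A \<in> obj D \<Longrightarrow> lunit E (p A) = q (lunit D A)"
  "A \<in> obj D \<Longrightarrow> runit E (p A) = q (runit D A)"
  "\<lbrakk>A \<in> obj D; B \<in> obj D\<rbrakk> \<Longrightarrow> p A = p B \<longleftrightarrow> A = B"
  "\<lbrakk>f \<in> arr D; g \<in> arr D\<rbrakk> \<Longrightarrow> q f = q g \<longleftrightarrow> f = g"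
  using moniso by (auto simp: moncat_iso_def bij_betw_def inj_on_def)

lemma moniso_objE:
  assumes "A \<in> obj E"
  obtains A' where "A' \<in> obj D" "A = p A'"
  using moniso assms unfolding moncat_iso_def bij_betw_def by blast

lemma moniso_homE:
  assumes "f \<in> hom E A B"
  obtains f' where "f' \<in> arr D" "f = q f'" "A = p (src D f')" "B = p (trg D f')"
proof -
  have "f \<in> q ` arr D" using assms moniso unfolding moncat_iso_def bij_betw_def hom_def by blast
  then show thesis using that assms unfolding in_hom_iff by auto
qed

lemma moniso_inverse: "inverse_arrows D f g \<Longrightarrow> inverse_arrows E (q f) (q g)"
  by (auto simp: inverse_arrows_def in_hom_iff)

lemma moniso_iso: "iso D f \<Longrightarrow> iso E (q f)"
  using moniso_inverse by (auto simp: iso_def)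

lemma moniso_monoidal: "monoidal_category E"
proof unfold_locales
  fix f assume "f \<in> arr E"
  then have "f \<in> hom E (src E f) (trg E f)" by (simp add: in_hom_iff)
  from moniso_homE[OF this] show "src E f \<in> obj E" "trg E f \<in> obj E"
    using D.src_in_obj D.trg_in_obj moniso_simps(1) by metis+
qed ((elim moniso_objE moniso_homE)?;
    auto simp: in_hom_iff moniso_iso D.assoc_nat D.lunit_nat D.runit_nat D.pentagon D.triangle)+

lemma moniso_autonomous:
  assumes "autonomous_category D"
  shows "autonomous_category E"
proof -
  interpret DA: autonomous_category D by (rule assms)
  interpret E: monoidal_category E by (rule moniso_monoidal)
  have inv: "inverse_arr E (q f) = q (inverse_arr D f)" if "iso D f" for f
    using E.inverse_arr_eq[OF moniso_inverse[OF D.inverse_arr_inverse[OF that]]] .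
  have "adjunction E (p X) (p A) (q e) (q n)" if "adjunction D X A e n" for X A e n
    using that unfolding adjunction_def in_hom_iff by (elim conjE) (simp add: inv)
  then show ?thesis
    using DA.left_adjoint_exists DA.right_adjoint_exists
    by unfold_locales (metis moniso_objE)+
qed

lemma moniso_sym: "moncat_iso E D (inv_into (obj D) p) (inv_into (arr D) q)"
proof -
  have b: "bij_betw p (obj D) (obj E)" "bij_betw q (arr D) (arr E)" "inj_on p (obj D)" "inj_on q (arr D)"
    using moniso by (auto simp: moncat_iso_def bij_betw_def)
  have [simp]: "A \<in> obj D \<Longrightarrow> inv_into (obj D) p (p A) = A" "f \<in> arr D \<Longrightarrow> inv_into (arr D) q (q f) = f" for A f
    using b by auto
  have E: "obj E = p ` obj D" "arr E = q ` arr D" using b by (auto simp: bij_betw_def)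
  show ?thesis
    using bij_betw_inv_into[OF b(1)] bij_betw_inv_into[OF b(2)]
    unfolding moncat_iso_def by (simp add: E)
qed

lemma strong_monoidal_post:
  assumes "strong_monoidal_functor X D G"
  shows "strong_monoidal_functor X E (post p q G)"
proof -
  interpret G: strong_monoidal_functor X D G by (rule assms)
  have h: "f \<in> arr X \<Longrightarrow> farr G f \<in> arr D \<and> src D (farr G f) = fobj G (src X f) \<and> trg D (farr G f) = fobj G (trg X f)" for f
    using G.farr_in_hom[of f "src X f" "trg X f"] by (auto simp: in_hom_iff)
  have m: "A \<in> obj X \<Longrightarrow> B \<in> obj X \<Longrightarrow> fmult G A B \<in> arr D \<and>
      src D (fmult G A B) = fobj G A \<otimes>\<^bsub>D\<^esub> fobj G B \<and> trg D (fmult G A B) = fobj G (A \<otimes>\<^bsub>X\<^esub> B)" for A B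
    using G.fmult_in_hom[of A B] by (auto simp: in_hom_iff)
  have u: "funit G \<in> arr D" "src D (funit G) = unit D" "trg D (funit G) = fobj G (unit X)"
    using G.funit_in_hom by (auto simp: in_hom_iff)
  note [simp] = h m u G.fobj_in_obj
  show ?thesis
  proof (intro strong_monoidal_functor.intro G.C.monoidal_category_axioms moniso_monoidal
      strong_monoidal_functor_axioms.intro)
    fix A B f g Y assume "f \<in> hom X A B" "g \<in> hom X B Y"
    then show "farr (post p q G) (g \<cdot>\<^bsub>X\<^esub> f) = farr (post p q G) g \<cdot>\<^bsub>E\<^esub> farr (post p q G) f"
      using G.farr_comp[of f A B g Y] by (auto simp: in_hom_iff)
  next
    fix A A' B B' f g assume "f \<in> hom X A A'" "g \<in> hom X B B'"
    then show "fmult (post p q G) A' B' \<cdot>\<^bsub>E\<^esub> (farr (post p q G) f \<boxtimes>\<^bsub>E\<^esub> farr (post p q G) g)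
      = farr (post p q G) (f \<boxtimes>\<^bsub>X\<^esub> g) \<cdot>\<^bsub>E\<^esub> fmult (post p q G) A B"
      using G.fmult_natural[of f A A' g B B'] by (auto simp: in_hom_iff)
  next
    fix A B Y assume "A \<in> obj X" "B \<in> obj X" "Y \<in> obj X"
    then show "farr (post p q G) (assoc X A B Y) \<cdot>\<^bsub>E\<^esub> fmult (post p q G) (A \<otimes>\<^bsub>X\<^esub> B) Y
              \<cdot>\<^bsub>E\<^esub> (fmult (post p q G) A B \<boxtimes>\<^bsub>E\<^esub> ident E (fobj (post p q G) Y))
          = fmult (post p q G) A (B \<otimes>\<^bsub>X\<^esub> Y) \<cdot>\<^bsub>E\<^esub> (ident E (fobj (post p q G) A) \<boxtimes>\<^bsub>E\<^esub> fmult (post p q G) B Y)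
              \<cdot>\<^bsub>E\<^esub> assoc E (fobj (post p q G) A) (fobj (post p q G) B) (fobj (post p q G) Y)"
      using G.assoc_coherence[of A B Y] by simp
  next
    fix A assume "A \<in> obj X"
    then show "farr (post p q G) (lunit X A) \<cdot>\<^bsub>E\<^esub> fmult (post p q G) (unit X) A
              \<cdot>\<^bsub>E\<^esub> (funit (post p q G) \<boxtimes>\<^bsub>E\<^esub> ident E (fobj (post p q G) A)) = lunit E (fobj (post p q G) A)"
      "farr (post p q G) (runit X A) \<cdot>\<^bsub>E\<^esub> fmult (post p q G) A (unit X)
              \<cdot>\<^bsub>E\<^esub> (ident E (fobj (post p q G) A) \<boxtimes>\<^bsub>E\<^esub> funit (post p q G)) = runit E (fobj (post p q G) A)"
      using G.lunit_coherence[of A] G.runit_coherence[of A] by simp_all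
  qed (auto simp: in_hom_iff G.farr_ident G.fmult_iso G.funit_iso intro!: moniso_iso)
qed

text \<open>\<open>H'\<close> and \<open>K'\<close> are given by their values on the carriers of
  \<open>X\<close> only: composing with \<open>post\<close>, or passing to a copy of
  \<open>D\<close> and back, returns a functor that may differ elsewhere.\<close>

lemma nat_iso_transport:
  assumes X: "monoidal_category X" and t: "monoidal_nat_iso X D H K t"
    and typed: "well_typed D X H" "well_typed D X K"
    and H: "\<And>A. A \<in> obj X \<Longrightarrow> fobj H' A = p (fobj H A)" "\<And>f. f \<in> arr X \<Longrightarrow> farr H' f = q (farr H f)"
      "\<And>A B. A \<in> obj X \<Longrightarrow> B \<in> obj X \<Longrightarrow> fmult H' A B = q (fmult H A B)" "funit H' = q (funit H)"
    and K: "\<And>A. A \<in> obj X \<Longrightarrow> fobj K' A = p (fobj K A)" "\<And>f. f \<in> arr X \<Longrightarrow> farr K' f = q (farr K f)"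
      "\<And>A B. A \<in> obj X \<Longrightarrow> B \<in> obj X \<Longrightarrow> fmult K' A B = q (fmult K A B)" "funit K' = q (funit K)"
  shows "monoidal_nat_iso X E H' K' (\<lambda>A\<in>obj X. q (t A))"
proof -
  interpret X: monoidal_category X by (rule X)
  have typed_simps: "A \<in> obj X \<Longrightarrow> fobj M A \<in> obj D" 
    "f \<in> arr X \<Longrightarrow> farr M f \<in> arr D \<and> src D (farr M f) = fobj M (src X f) \<and> trg D (farr M f) = fobj M (trg X f)"
    "A \<in> obj X \<Longrightarrow> B \<in> obj X \<Longrightarrow> fmult M A B \<in> arr D \<and>
      src D (fmult M A B) = fobj M A \<otimes>\<^bsub>D\<^esub> fobj M B \<and> trg D (fmult M A B) = fobj M (A \<otimes>\<^bsub>X\<^esub> B)"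
    "funit M \<in> arr D \<and> src D (funit M) = unit D \<and> trg D (funit M) = fobj M (unit X)"
    if "well_typed D X M" for M A B f
    using that unfolding well_typed_def by (auto simp: in_hom_iff)
  note [simp] = typed_simps[OF typed(1)] typed_simps[OF typed(2)] H K
  have [simp]: "t A \<in> arr D" "src D (t A) = fobj H A" "trg D (t A) = fobj K A" "iso D (t A)"
    if "A \<in> obj X" for A
    using t that unfolding monoidal_nat_iso_def by (auto simp: in_hom_iff)
  show ?thesis
    unfolding monoidal_nat_iso_def
  proof (intro conjI ballI)
    fix A assume "A \<in> obj X"
    then show "(\<lambda>A\<in>obj X. q (t A)) A \<in> hom E (fobj H' A) (fobj K' A)" "iso E ((\<lambda>A\<in>obj X. q (t A)) A)"
      using moniso_iso by (auto simp: in_hom_iff)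
  next
    fix A B f assume A: "A \<in> obj X" "B \<in> obj X" "f \<in> hom X A B"
    then have "t B \<cdot>\<^bsub>D\<^esub> farr H f = farr K f \<cdot>\<^bsub>D\<^esub> t A"
      using t unfolding monoidal_nat_iso_def by blast
    then show "(\<lambda>A\<in>obj X. q (t A)) B \<cdot>\<^bsub>E\<^esub> farr H' f = farr K' f \<cdot>\<^bsub>E\<^esub> (\<lambda>A\<in>obj X. q (t A)) A"
      using A by (auto simp: in_hom_iff)
  next
    fix A B assume A: "A \<in> obj X" "B \<in> obj X"
    then have "t (A \<otimes>\<^bsub>X\<^esub> B) \<cdot>\<^bsub>D\<^esub> fmult H A B = fmult K A B \<cdot>\<^bsub>D\<^esub> (t A \<boxtimes>\<^bsub>D\<^esub> t B)"
      using t unfolding monoidal_nat_iso_def by blast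
    then show "(\<lambda>A\<in>obj X. q (t A)) (A \<otimes>\<^bsub>X\<^esub> B) \<cdot>\<^bsub>E\<^esub> fmult H' A B
      = fmult K' A B \<cdot>\<^bsub>E\<^esub> ((\<lambda>A\<in>obj X. q (t A)) A \<boxtimes>\<^bsub>E\<^esub> (\<lambda>A\<in>obj X. q (t A)) B)"
      using A by simp
  next
    have "t (unit X) \<cdot>\<^bsub>D\<^esub> funit H = funit K"
      using t unfolding monoidal_nat_iso_def by blast
    then show "(\<lambda>A\<in>obj X. q (t A)) (unit X) \<cdot>\<^bsub>E\<^esub> funit H' = funit K'"
      by simp
  qed auto
qed

end

text \<open>The structure is transported along an injection of the arrows, each object taking the
  code of its identity as its name.\<close>

lemma moncat_iso_exists:
  fixes D :: "('p, 'b) moncat"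
  assumes D: "monoidal_category D" and small: "small_in TYPE('u) D"
  shows "\<exists>(E :: ('u, 'u) moncat) p q. moncat_iso D E p q"
proof -
  interpret D: monoidal_category D by (rule D)
  obtain q :: "'b \<Rightarrow> 'u" where q: "inj_on q (arr D)" using small unfolding small_in_def by blast
  define p where "p A = q (ident D A)" for A
  have p: "inj_on p (obj D)"
  proof (rule inj_onI)
    fix A B assume AB: "A \<in> obj D" "B \<in> obj D" "p A = p B"
    then have "ident D A = ident D B" using q by (auto simp: p_def inj_on_def)
    then show "A = B" using D.ident_simps(2) AB by metis
  qed
  define p' q' where "p' = inv_into (obj D) p" and "q' = inv_into (arr D) q"
  have [simp]: "A \<in> obj D \<Longrightarrow> p' (p A) = A" "f \<in> arr D \<Longrightarrow> q' (q f) = f" for A f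
    using p q by (auto simp: p'_def q'_def)
  define E :: "('u, 'u) moncat" where "E = \<lparr>obj = p ` obj D, arr = q ` arr D,
    src = (\<lambda>f. p (src D (q' f))), trg = (\<lambda>f. p (trg D (q' f))), ident = (\<lambda>A. q (ident D (p' A))),
    comp = (\<lambda>g f. q (q' g \<cdot>\<^bsub>D\<^esub> q' f)), tensor_obj = (\<lambda>A B. p (p' A \<otimes>\<^bsub>D\<^esub> p' B)),
    tensor_arr = (\<lambda>f g. q (q' f \<boxtimes>\<^bsub>D\<^esub> q' g)), unit = p (unit D),
    assoc = (\<lambda>A B X. q (assoc D (p' A) (p' B) (p' X))), lunit = (\<lambda>A. q (lunit D (p' A))),
    runit = (\<lambda>A. q (runit D (p' A)))\<rparr>"
  have "moncat_iso D E p q"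
    using p q by (auto simp: moncat_iso_def E_def bij_betw_def)
  then show ?thesis by blast
qed

lemma well_typed_strong:
  assumes "strong_monoidal_functor X D G"
  shows "well_typed D X G"
proof -
  interpret strong_monoidal_functor X D G by (rule assms)
  show ?thesis
    using fobj_in_obj farr_in_hom fmult_in_hom funit_in_hom
    unfolding well_typed_def by (simp add: in_hom_iff)
qed

lemma well_typed_comp:
  assumes "strong_monoidal_functor X L F" "strong_monoidal_functor L D G"
  shows "well_typed D X (monfun_comp D G F)"
proof -
  interpret F: strong_monoidal_functor X L F by (rule assms)
  interpret G: strong_monoidal_functor L D G by (rule assms)
  show ?thesis
    using F.fobj_in_obj F.farr_in_hom F.fmult_in_hom F.funit_in_hom
      G.fobj_in_obj G.farr_in_hom G.fmult_in_hom G.funit_in_hom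
    unfolding well_typed_def monfun_comp_def by (simp add: in_hom_iff)
qed

lemma extension_transport:
  fixes D :: "('q, 'c) moncat" and E :: "('r, 'd) moncat"
  assumes D: "monoidal_category D" and F: "strong_monoidal_functor C L F"
    and iso: "moncat_iso D E p q" and ext: "extension_along C L F D G G' \<phi>"
    and G: "strong_monoidal_functor C D G"
    and H: "\<And>A. A \<in> obj C \<Longrightarrow> fobj H A = p (fobj G A)" "\<And>f. f \<in> arr C \<Longrightarrow> farr H f = q (farr G f)"
      "\<And>A B. A \<in> obj C \<Longrightarrow> B \<in> obj C \<Longrightarrow> fmult H A B = q (fmult G A B)" "funit H = q (funit G)"
  shows "extension_along C L F E H (post p q G') (\<lambda>A\<in>obj C. q (\<phi> A))"
proof -
  interpret F: strong_monoidal_functor C L F by (rule F)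
  have s: "strong_monoidal_functor L D G'" and n: "monoidal_nat_iso C D (monfun_comp D G' F) G \<phi>"
    using ext unfolding extension_along_def by auto
  interpret G': strong_monoidal_functor L D G' by (rule s)
  note [simp] = moniso_simps[OF D iso] post_sel
  have m: "farr G' (fmult F A B) \<in> hom D (fobj G' (fobj F A \<otimes>\<^bsub>L\<^esub> fobj F B)) (fobj G' (fobj F (A \<otimes>\<^bsub>C\<^esub> B)))" 
    "fmult G' (fobj F A) (fobj F B) \<in> hom D (fobj G' (fobj F A) \<otimes>\<^bsub>D\<^esub> fobj G' (fobj F B)) (fobj G' (fobj F A \<otimes>\<^bsub>L\<^esub> fobj F B))"
    if "A \<in> obj C" "B \<in> obj C" for A B
    using that F.fmult_in_hom G'.farr_in_hom G'.fmult_in_hom F.fobj_in_obj by auto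
  have u: "farr G' (funit F) \<in> hom D (fobj G' (unit L)) (fobj G' (fobj F (unit C)))"
    "funit G' \<in> hom D (unit D) (fobj G' (unit L))"
    using F.funit_in_hom G'.farr_in_hom G'.funit_in_hom by auto
  have "monoidal_nat_iso C E (monfun_comp E (post p q G') F) H (\<lambda>A\<in>obj C. q (\<phi> A))"
    using m u H
    by (intro nat_iso_transport[OF D iso F.C.monoidal_category_axioms n
          well_typed_comp[OF F s] well_typed_strong[OF G]])
      (auto simp: monfun_comp_def in_hom_iff)
  then show ?thesis
    using strong_monoidal_post[OF D iso s] unfolding extension_along_def by blast
qed

section \<open>The universal property for autonomous categories that are small in the
  universe\<close>

context
  fixes C :: "('o, 'a) moncat" and L :: "('p, 'b) moncat" and F :: "('o, 'a, 'p, 'b) monfun"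
    and D :: "('q, 'c) moncat" and G :: "('o, 'a, 'q, 'c) monfun"
  assumes free: "free_autonomous TYPE('u) C L F"
    and aut: "autonomous_category D" and small: "small_in TYPE('u) D"
    and G: "strong_monoidal_functor C D G"
begin

interpretation F: strong_monoidal_functor C L F
  using free unfolding free_autonomous_def by blast

interpretation D: autonomous_category D by (rule aut)

interpretation G: strong_monoidal_functor C D G by (rule G)

lemma copy:
  obtains E :: "('u, 'u) moncat" and p q p' q' where
    "moncat_iso D E p q" "autonomous_category E" "strong_monoidal_functor C E (post p q G)"
    "moncat_iso E D p' q'" "\<And>A. A \<in> obj D \<Longrightarrow> p' (p A) = A" "\<And>f. f \<in> arr D \<Longrightarrow> q' (q f) = f"
proof -
  obtain E :: "('u, 'u) moncat" and p q where i: "moncat_iso D E p q"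
    using moncat_iso_exists[OF D.monoidal_category_axioms small] by blast
  moreover have "inj_on p (obj D)" "inj_on q (arr D)"
    using i by (auto simp: moncat_iso_def bij_betw_def)
  ultimately show thesis
    using moniso_autonomous[OF D.monoidal_category_axioms i aut] strong_monoidal_post[OF D.monoidal_category_axioms i G]
      moniso_sym[OF D.monoidal_category_axioms i] that by auto
qed

lemma G_arr:
  "A \<in> obj C \<Longrightarrow> fobj G A \<in> obj D" "f \<in> arr C \<Longrightarrow> farr G f \<in> arr D"
  "A \<in> obj C \<Longrightarrow> B \<in> obj C \<Longrightarrow> fmult G A B \<in> arr D" "funit G \<in> arr D"
  using G.fobj_in_obj[of A] G.farr_in_hom[of f "src C f" "trg C f"] G.fmult_in_hom[of A B] G.funit_in_hom
  by (auto simp: in_hom_iff)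

text \<open>The extension is found for a copy of \<open>D\<close> over \<open>'u\<close> and carried
  back along the inverse relabelling; comparisons of extensions are obtained in the same
  way.\<close>

lemma extension_exists: "\<exists>G' \<phi>. extension_along C L F D G G' \<phi>"
proof -
  obtain E :: "('u, 'u) moncat" and p q p' q' where E: "moncat_iso D E p q" "autonomous_category E"
    "strong_monoidal_functor C E (post p q G)" "moncat_iso E D p' q'"
    "\<And>A. A \<in> obj D \<Longrightarrow> p' (p A) = A" "\<And>f. f \<in> arr D \<Longrightarrow> q' (q f) = f"
    by (rule copy) (rule that)
  interpret E: autonomous_category E by (rule E)
  obtain G' \<phi> where e: "extension_along C L F E (post p q G) G' \<phi>"
    using free E unfolding free_autonomous_def by meson
  have "extension_along C L F D G (post p' q' G') (\<lambda>A\<in>obj C. q' (\<phi> A))"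
    by (rule extension_transport[OF E.monoidal_category_axioms F.strong_monoidal_functor_axioms E(4) e E(3)])
      (use G_arr in \<open>simp_all add: E\<close>)
  then show ?thesis by blast
qed

lemma extension_unique:
  assumes 1: "extension_along C L F D G G1 \<phi>1" and 2: "extension_along C L F D G G2 \<phi>2"
  shows "\<exists>\<theta>. monoidal_nat_iso L D G1 G2 \<theta> \<and> (\<forall>A \<in> obj C. \<phi>2 A \<cdot>\<^bsub>D\<^esub> \<theta> (fobj F A) = \<phi>1 A)"
proof -
  obtain E :: "('u, 'u) moncat" and p q p' q' where E: "moncat_iso D E p q" "autonomous_category E"
    "strong_monoidal_functor C E (post p q G)" "moncat_iso E D p' q'"
    "\<And>A. A \<in> obj D \<Longrightarrow> p' (p A) = A" "\<And>f. f \<in> arr D \<Longrightarrow> q' (q f) = f"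
    by (rule copy) (rule that)
  interpret E: autonomous_category E by (rule E)
  note t = extension_transport[OF D.monoidal_category_axioms F.strong_monoidal_functor_axioms E(1) _ G]
  have e: "extension_along C L F E (post p q G) (post p q G1) (\<lambda>A\<in>obj C. q (\<phi>1 A))"
    "extension_along C L F E (post p q G) (post p q G2) (\<lambda>A\<in>obj C. q (\<phi>2 A))"
    by (rule t[OF 1], simp_all) (rule t[OF 2], simp_all)
  obtain \<theta> where \<theta>: "monoidal_nat_iso L E (post p q G1) (post p q G2) \<theta>"
    "\<forall>A \<in> obj C. (\<lambda>A\<in>obj C. q (\<phi>2 A)) A \<cdot>\<^bsub>E\<^esub> \<theta> (fobj F A) = (\<lambda>A\<in>obj C. q (\<phi>1 A)) A"
    using free E(2,3) e unfolding free_autonomous_def by meson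
  have s: "strong_monoidal_functor L D G1" "strong_monoidal_functor L D G2"
    using 1 2 unfolding extension_along_def by auto
  interpret G1: strong_monoidal_functor L D G1 by (rule s)
  interpret G2: strong_monoidal_functor L D G2 by (rule s)
  have arr: "f \<in> arr L \<Longrightarrow> farr G1 f \<in> arr D" "f \<in> arr L \<Longrightarrow> farr G2 f \<in> arr D" 
    "A \<in> obj L \<Longrightarrow> B \<in> obj L \<Longrightarrow> fmult G1 A B \<in> arr D" "A \<in> obj L \<Longrightarrow> B \<in> obj L \<Longrightarrow> fmult G2 A B \<in> arr D"
    "funit G1 \<in> arr D" "funit G2 \<in> arr D" for f A B
    using G1.farr_in_hom[of f "src L f" "trg L f"] G1.fmult_in_hom[of A B] G1.funit_in_hom
      G2.farr_in_hom[of f "src L f" "trg L f"] G2.fmult_in_hom[of A B] G2.funit_in_hom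
    by (auto simp: in_hom_iff)
  have n: "monoidal_nat_iso L D G1 G2 (\<lambda>A\<in>obj L. q' (\<theta> A))"
    by (rule nat_iso_transport[OF E.monoidal_category_axioms E(4) F.D.monoidal_category_axioms \<theta>(1)
          s[THEN strong_monoidal_post[OF D.monoidal_category_axioms E(1)], THEN well_typed_strong]])
      (use arr G1.fobj_in_obj G2.fobj_in_obj in \<open>simp_all add: E\<close>)
  have "\<phi>2 A \<cdot>\<^bsub>D\<^esub> q' (\<theta> (fobj F A)) = \<phi>1 A" if A: "A \<in> obj C" for A
  proof -
    have "\<phi>1 A \<in> arr D" "\<phi>2 A \<in> arr D" "src D (\<phi>2 A) = fobj G2 (fobj F A)"
      using 1 2 A unfolding extension_along_def monoidal_nat_iso_def
      by (auto simp: in_hom_iff monfun_comp_def)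
    moreover have "q (\<phi>2 A) \<cdot>\<^bsub>E\<^esub> \<theta> (fobj F A) = q (\<phi>1 A)" using \<theta>(2) A by simp
    moreover have "\<theta> (fobj F A) \<in> arr E" "trg E (\<theta> (fobj F A)) = p (fobj G2 (fobj F A))"
      using \<theta>(1) A F.fobj_in_obj unfolding monoidal_nat_iso_def by (auto simp: in_hom_iff)
    ultimately show ?thesis
      using moniso_simps(6)[OF E.monoidal_category_axioms E(4), of "\<theta> (fobj F A)" "q (\<phi>2 A)"] E(5,6)
        moniso_simps(2,3)[OF D.monoidal_category_axioms E(1)] by simp
  qed
  then show ?thesis using n F.fobj_in_obj by (intro exI[of _ "\<lambda>A\<in>obj L. q' (\<theta> A)"]) auto
qed

end

section \<open>Codes for pairs and lists in an infinite type\<close>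

lemma inj_pair_exists:
  assumes "infinite (UNIV :: 'u set)"
  shows "\<exists>p :: 'u \<times> 'u \<Rightarrow> 'u. inj p"
proof -
  have "(card_of ((UNIV :: 'u set) \<times> (UNIV :: 'u set)), card_of (UNIV :: 'u set)) \<in> ordLeq"
    using card_of_Times_same_infinite[OF assms] ordIso_iff_ordLeq by blast
  then show ?thesis unfolding card_of_ordLeq[symmetric] by auto
qed

lemma inj_nat_exists:
  assumes "infinite (UNIV :: 'u set)"
  shows "\<exists>c :: nat \<Rightarrow> 'u. inj c"
  using infinite_countable_subset[OF assms] by blast

lemma inj_list_exists:
  assumes "infinite (UNIV :: 'u set)"
  shows "\<exists>e :: 'u list \<Rightarrow> 'u. inj e"
proof -
  obtain p :: "'u \<times> 'u \<Rightarrow> 'u" where p: "inj p" using inj_pair_exists[OF assms] by blast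
  obtain c :: "nat \<Rightarrow> 'u" where c: "inj c" using inj_nat_exists[OF assms] by blast
  \<comment> \<open>The distinct tags \<open>c 0\<close> and \<open>c 1\<close> keep the codes of
    empty and nonempty lists apart.\<close>
  define e where "e = rec_list (p (c 0, c 0)) (\<lambda>x _ y. p (c 1, p (x, y)))"
  have e: "e [] = p (c 0, c 0)" "e (x # xs) = p (c 1, p (x, e xs))" for x xs
    by (simp_all add: e_def)
  have "e xs = e ys \<Longrightarrow> xs = ys" for xs ys
  proof (induction xs arbitrary: ys)
    case Nil
    then show ?case using p c by (cases ys) (auto simp: e inj_eq)
  next
    case (Cons x xs)
    then show ?case using p c by (cases ys) (auto simp: e inj_eq)
  qed
  then show ?thesis unfolding inj_def by blast
qed

section \<open>Fullness\<close>

definition id_monfun :: "('o, 'a) moncat \<Rightarrow> ('o, 'a, 'o, 'a) monfun" where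
  "id_monfun C = \<lparr>fobj = (\<lambda>A. A), farr = (\<lambda>f. f), fmult = (\<lambda>A B. ident C (A \<otimes>\<^bsub>C\<^esub> B)), funit = ident C (unit C)\<rparr>"

lemma id_monfun_sel [simp]:
  "fobj (id_monfun C) A = A" "farr (id_monfun C) f = f"
  "fmult (id_monfun C) A B = ident C (A \<otimes>\<^bsub>C\<^esub> B)" "funit (id_monfun C) = ident C (unit C)"
  by (simp_all add: id_monfun_def)

lemma strong_monoidal_id:
  assumes "monoidal_category C"
  shows "strong_monoidal_functor C C (id_monfun C)"
proof -
  interpret monoidal_category C by (rule assms)
  show ?thesis
    by unfold_locales (auto simp: in_hom_iff)
qed

section \<open>Iterated duals and the words over them\<close>

locale autonomous_embedding =
  strong_monoidal_functor C L F + aut: autonomous_category L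
  for C :: "('o, 'a) moncat" and L :: "('p, 'b) moncat" and F :: "('o, 'a, 'p, 'b) monfun"
begin

definition right_dual :: "'p \<Rightarrow> 'p" where
  "right_dual X = (SOME Y. \<exists>e n. adjunction L X Y e n)"

definition left_dual :: "'p \<Rightarrow> 'p" where
  "left_dual X = (SOME Y. \<exists>e n. adjunction L Y X e n)"

lemma right_dual: "X \<in> obj L \<Longrightarrow> \<exists>e n. adjunction L X (right_dual X) e n"
  unfolding right_dual_def by (rule someI_ex) (rule aut.right_adjoint_exists)

lemma left_dual: "X \<in> obj L \<Longrightarrow> \<exists>e n. adjunction L (left_dual X) X e n"
  unfolding left_dual_def by (rule someI_ex) (rule aut.left_adjoint_exists)

definition iterated_dual :: "'o \<Rightarrow> int \<Rightarrow> 'p" where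
  "iterated_dual A n = (if n \<ge> 0 then (right_dual ^^ nat n) (fobj F A) else (left_dual ^^ nat (- n)) (fobj F A))"

lemma adjunction_obj: "adjunction L X Y e n \<Longrightarrow> X \<in> obj L \<and> Y \<in> obj L"
  by (simp add: adjunction_def)

lemma iterated_dual_0 [simp]: "iterated_dual A 0 = fobj F A"
  by (simp add: iterated_dual_def)

lemma iterated_dual_obj [simp]:
  assumes "A \<in> obj C"
  shows "iterated_dual A n \<in> obj L"
proof -
  have "(right_dual ^^ m) (fobj F A) \<in> obj L" for m
  proof (induction m)
    case (Suc m)
    then show ?case using right_dual adjunction_obj by fastforce
  qed (use assms fobj_in_obj in simp)
  moreover have "(left_dual ^^ m) (fobj F A) \<in> obj L" for m
  proof (induction m)
    case (Suc m)
    then show ?case using left_dual adjunction_obj by fastforce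
  qed (use assms fobj_in_obj in simp)
  ultimately show ?thesis unfolding iterated_dual_def by simp
qed

text \<open>For \<open>n \<ge> 0\<close> the object at \<open>n + 1\<close> was chosen as a right
  dual of the one at \<open>n\<close>; for \<open>n < 0\<close> the object at \<open>n\<close> was
  chosen as a left dual of the one at \<open>n + 1\<close>. Both choices give an adjunction in the
  same direction.\<close>

lemma iterated_dual_adjunction:
  assumes "A \<in> obj C"
  shows "\<exists>e k. adjunction L (iterated_dual A n) (iterated_dual A (n + 1)) e k"
proof (cases "n \<ge> 0")
  case True
  then have "iterated_dual A (n + 1) = right_dual (iterated_dual A n)"
    by (simp add: iterated_dual_def nat_add_distrib)
  then show ?thesis using right_dual assms by simp
next
  case False
  then have "nat (- n) = Suc (nat (- (n + 1)))" by simp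
  then have "iterated_dual A n = left_dual (iterated_dual A (n + 1))"
    using False by (simp add: iterated_dual_def)
  then show ?thesis using left_dual assms by simp
qed

text \<open>One choice for each \<open>A\<close> and \<open>n\<close>: a cap and a cup that share a
  letter and have the same winding then belong to one adjunction, as the snake equations
  demand.\<close>

definition dual_arrs :: "'o \<Rightarrow> int \<Rightarrow> 'b \<times> 'b" where
  "dual_arrs A n = (SOME x. adjunction L (iterated_dual A n) (iterated_dual A (n + 1)) (fst x) (snd x))"

lemma dual_arrs:
  assumes "A \<in> obj C"
  shows "adjunction L (iterated_dual A n) (iterated_dual A (n + 1)) (fst (dual_arrs A n)) (snd (dual_arrs A n))"
proof -
  have "\<exists>x. adjunction L (iterated_dual A n) (iterated_dual A (n + 1)) (fst x) (snd x)"
    using iterated_dual_adjunction[OF assms, of n] by auto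
  then show ?thesis unfolding dual_arrs_def by (rule someI_ex)
qed

text \<open>The letter \<open>Inr (A, n)\<close> stands for the \<open>n\<close>-th iterated dual of \<open>F A\<close>; its label is kept apart
  from the object it denotes, since different labels may denote the same object of \<open>L\<close>.\<close>

definition denote :: "'p + 'o \<times> int \<Rightarrow> 'p" where
  "denote g = (case g of Inl X \<Rightarrow> X | Inr (A, n) \<Rightarrow> iterated_dual A n)"

definition wires :: "('p + 'o \<times> int) set" where
  "wires = Inr ` (obj C \<times> UNIV)"

text \<open>The letters \<open>Inl X\<close> carry the embedding of all of \<open>L\<close> into
  words and occur inside caps and cups as names of products; the generated subcategory has words of
  \<open>wires\<close> only as objects.\<close>

definition alphabet :: "('p + 'o \<times> int) set" where
  "alphabet = Inl ` obj L \<union> wires"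

lemma denote_simps [simp]: "denote (Inl X) = X" "denote (Inr (A, n)) = iterated_dual A n"
  by (simp_all add: denote_def)

lemma alphabet_simps [simp]:
  "Inl X \<in> alphabet \<longleftrightarrow> X \<in> obj L" "Inr (A, n) \<in> alphabet \<longleftrightarrow> A \<in> obj C" "Inr (A, n) \<in> wires \<longleftrightarrow> A \<in> obj C"
  by (auto simp: alphabet_def wires_def)

lemma wires_sub: "wires \<subseteq> alphabet"
  by (auto simp: alphabet_def)

sublocale W: word_action L denote Inl alphabet
  by unfold_locales (auto simp: alphabet_def wires_def)

abbreviation word_cat where "word_cat \<equiv> W.strict_moncat"

lemma autonomous_word_cat: "autonomous_category word_cat"
proof (rule W.autonomous_strict_moncat)
  fix g assume g: "g \<in> alphabet"
  obtain Y e n where *: "adjunction L Y (denote g) e n"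
    using aut.left_adjoint_exists[OF W.d_obj[OF g]] by blast
  have "W.dual_pair [Inl Y] [g] (W.cap_fam (Inl Y) g e) (W.cup_fam g (Inl Y) n)"
    using * adjunction_obj[OF *] g by (intro W.dual_pair_fam) simp_all
  then show "\<exists>h e n. W.dual_pair [h] [g] e n" by blast
  obtain Y e n where *: "adjunction L (denote g) Y e n"
    using aut.right_adjoint_exists[OF W.d_obj[OF g]] by blast
  have "W.dual_pair [g] [Inl Y] (W.cap_fam g (Inl Y) e) (W.cup_fam (Inl Y) g n)"
    using * adjunction_obj[OF *] g by (intro W.dual_pair_fam) simp_all
  then show "\<exists>h e n. W.dual_pair [g] [h] e n" by blast
qed

abbreviation wire :: "'o \<Rightarrow> 'p + 'o \<times> int" where "wire A \<equiv> Inr (A, 0)"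

abbreviation FW where "FW \<equiv> W.lift C F wire"

abbreviation LW where "LW \<equiv> W.lift L (id_monfun L) Inl"

lemma farr_simps [simp]:
  assumes "f \<in> arr C"
  shows "farr F f \<in> arr L" "src L (farr F f) = fobj F (src C f)" "trg L (farr F f) = fobj F (trg C f)"
  using farr_in_hom[of f "src C f" "trg C f"] assms by (auto simp: in_hom_iff)

lemma fmult_simps [simp]:
  assumes "A \<in> obj C" "B \<in> obj C"
  shows "fmult F A B \<in> arr L" "src L (fmult F A B) = fobj F A \<otimes>\<^bsub>L\<^esub> fobj F B"
    "trg L (fmult F A B) = fobj F (A \<otimes>\<^bsub>C\<^esub> B)" "iso L (fmult F A B)"
  using fmult_in_hom[OF assms] fmult_iso[OF assms] by (auto simp: in_hom_iff)

lemma funit_simps [simp]: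
  "funit F \<in> arr L" "src L (funit F) = unit L" "trg L (funit F) = fobj F (unit C)" "iso L (funit F)"
  using funit_in_hom funit_iso by (auto simp: in_hom_iff)

declare fobj_in_obj [simp]

lemma strong_FW: "strong_monoidal_functor C word_cat FW"
  by (rule W.strong_monoidal_lift)
    (use W.strict_whiskering_axioms strong_monoidal_functor_axioms in \<open>simp_all\<close>)

lemma strong_LW: "strong_monoidal_functor L word_cat LW"
  by (rule W.strong_monoidal_lift)
    (use W.strict_whiskering_axioms strong_monoidal_id[OF D.monoidal_category_axioms] in simp_all)

sublocale N: word_functor alphabet W.fams W.fam_dom W.fam_cod W.fam_idt W.fam_cmp W.fam_lw W.fam_rw C FW wire
  by (intro word_functor.intro word_functor_axioms.intro W.strict_whiskering_axioms strong_FW) simp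

text \<open>Besides the images of arrows of \<open>C\<close> this contains the structure
  isomorphisms of \<open>FW\<close> and their inverses.\<close>

definition box :: "('p + 'o \<times> int) list \<Rightarrow> ('p + 'o \<times> int) list \<times> ('p \<Rightarrow> 'b) \<times> ('p + 'o \<times> int) list
    \<Rightarrow> ('p + 'o \<times> int) list \<Rightarrow> bool" where
  "box a k b \<longleftrightarrow> (\<exists>As Bs. a = map wire As \<and> b = map wire Bs \<and> N.collapsible As k Bs)"

definition cap where
  "cap g h e \<longleftrightarrow> (\<exists>A \<in> obj C. \<exists>n. g = Inr (A, n) \<and> h = Inr (A, n + 1) \<and> e = W.cap_fam g h (fst (dual_arrs A n)))"

definition cup where
  "cup h g k \<longleftrightarrow> (\<exists>A \<in> obj C. \<exists>n. g = Inr (A, n) \<and> h = Inr (A, n + 1) \<and> k = W.cup_fam h g (snd (dual_arrs A n)))"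

text \<open>The value 0 on letters \<open>Inl X\<close> is a default; generators touch only
  wires.\<close>

definition wind :: "'p + 'o \<times> int \<Rightarrow> int" where
  "wind g = (case g of Inl _ \<Rightarrow> 0 | Inr (A, n) \<Rightarrow> n)"

lemma wind_simps [simp]: "wind (Inl X) = 0" "wind (Inr (A, n)) = n"
  by (simp_all add: wind_def)

lemma wire_dual_pair:
  assumes "A \<in> obj C"
  shows "W.dual_pair [Inr (A, n)] [Inr (A, n + 1)] (W.cap_fam (Inr (A, n)) (Inr (A, n + 1)) (fst (dual_arrs A n)))
    (W.cup_fam (Inr (A, n + 1)) (Inr (A, n)) (snd (dual_arrs A n)))"
  using dual_arrs[OF assms, of n] assms by (intro W.dual_pair_fam) simp_all

lemma collapsible_FWD:
  assumes "N.collapsible As k Bs"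
  shows "As \<in> lists (obj C) \<and> Bs \<in> lists (obj C) \<and> k \<in> W.fams \<and> W.fam_dom k = map wire As \<and> W.fam_cod k = map wire Bs"
  using assms N.collapsible_def by auto

sublocale Z: zigzag alphabet W.fams W.fam_dom W.fam_cod W.fam_idt W.fam_cmp W.fam_lw W.fam_rw wind box cap cup
proof
  fix a k b assume "box a k b"
  then obtain As Bs where *: "a = map wire As" "b = map wire Bs" "N.collapsible As k Bs"
    unfolding box_def by blast
  show "k \<in> W.fams \<and> W.fam_dom k = a \<and> W.fam_cod k = b" "\<forall>g \<in> set a \<union> set b. wind g = 0"
    using collapsible_FWD[OF *(3)] *(1,2) by auto
next
  fix g h e assume "cap g h e"
  then show "e \<in> W.fams \<and> W.fam_dom e = [g, h] \<and> W.fam_cod e = []" "wind h = wind g + 1"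
    using wire_dual_pair unfolding cap_def W.dual_pair_def by auto
next
  fix g h n assume "cup h g n"
  then show "n \<in> W.fams \<and> W.fam_dom n = [] \<and> W.fam_cod n = [h, g]" "wind h = wind g + 1"
    using wire_dual_pair unfolding cup_def W.dual_pair_def by auto
next
  fix g h g' e n assume "cap g h e" "cup h g' n"
  then show "g' = g \<and> W.fam_cmp (W.fam_rw e [g]) (W.fam_lw [g] n) = W.fam_idt [g]"
    using wire_dual_pair unfolding cap_def cup_def W.dual_pair_def by auto
next
  fix g h g' e n assume "cup g h n" "cap h g' e"
  then show "g' = g \<and> W.fam_cmp (W.fam_lw [g] e) (W.fam_rw n [g]) = W.fam_idt [g]"
    using wire_dual_pair unfolding cap_def cup_def W.dual_pair_def by auto
qed

definition derived where
  "derived = {f. Z.der wires (W.fam_dom f) f (W.fam_cod f)}"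

sublocale V: strict_whiskering wires derived W.fam_dom W.fam_cod W.fam_idt W.fam_cmp W.fam_lw W.fam_rw
  unfolding derived_def by (rule Z.der_whiskering) (rule wires_sub)

lemma derived_sub: "derived \<subseteq> W.fams"
  using Z.der_in[OF wires_sub] unfolding derived_def by blast

lemma gen_derived:
  assumes "Z.gen a k b" "a \<in> lists wires" "b \<in> lists wires"
  shows "k \<in> derived"
  using Z.der_gen[OF wires_sub assms] Z.gen_in[OF assms(1)] unfolding derived_def by simp

lemma box_derived:
  assumes "N.collapsible As k Bs"
  shows "k \<in> derived"
proof -
  have "Z.gen (map wire As) k (map wire Bs)"
    using assms unfolding Z.gen.simps box_def by blast
  moreover have "map wire As \<in> lists wires" "map wire Bs \<in> lists wires"
    using collapsible_FWD[OF assms] by (auto simp: in_lists_conv_set)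
  ultimately show ?thesis by (rule gen_derived)
qed

lemma wire_dual_pair_derived:
  assumes "A \<in> obj C"
  shows "V.dual_pair [Inr (A, n)] [Inr (A, n + 1)] (W.cap_fam (Inr (A, n)) (Inr (A, n + 1)) (fst (dual_arrs A n)))
    (W.cup_fam (Inr (A, n + 1)) (Inr (A, n)) (snd (dual_arrs A n)))"
proof -
  have "W.cap_fam (Inr (A, n)) (Inr (A, n + 1)) (fst (dual_arrs A n)) \<in> derived"
    by (rule gen_derived, rule Z.gen_cap) (use assms in \<open>auto simp: cap_def\<close>)
  moreover have "W.cup_fam (Inr (A, n + 1)) (Inr (A, n)) (snd (dual_arrs A n)) \<in> derived"
    by (rule gen_derived, rule Z.gen_cup) (use assms in \<open>auto simp: cup_def\<close>)
  ultimately show ?thesis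
    using wire_dual_pair[OF assms, of n] assms unfolding W.dual_pair_def V.dual_pair_def by simp
qed

lemma autonomous_derived: "autonomous_category V.strict_moncat"
proof (rule V.autonomous_strict_moncat)
  fix g assume "g \<in> wires"
  then obtain A n where g: "A \<in> obj C" "g = Inr (A, n)" by (auto simp: wires_def)
  show "\<exists>h e n. V.dual_pair [h] [g] e n"
    using wire_dual_pair_derived[OF g(1), of "n - 1"] unfolding g(2) diff_add_cancel by blast
  show "\<exists>h e n. V.dual_pair [g] [h] e n"
    using wire_dual_pair_derived[OF g(1), of n] unfolding g(2) by blast
qed

text \<open>Arrows and structure isomorphisms of \<open>FW\<close> are boxes. So are the inverses of
  the latter, which keeps them invertible in the smaller category.\<close>

lemma strong_FW_derived: "strong_monoidal_functor C V.strict_moncat FW"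
proof (rule W.strong_monoidal_lift)
  show "strong_monoidal_functor C L F" ..
  show "strict_whiskering wires derived W.fam_dom W.fam_cod W.fam_idt W.fam_cmp W.fam_lw W.fam_rw" ..
  show "derived \<subseteq> W.fams" by (rule derived_sub)
  show "wires \<subseteq> alphabet" by (rule wires_sub)
  show "wire A \<in> wires \<and> denote (wire A) = fobj F A" if "A \<in> obj C" for A using that by simp
  show "farr FW f \<in> derived" if "f \<in> arr C" for f
    by (rule box_derived, rule N.collapsible_farr) (use that in simp_all)
  show "fmult FW A B \<in> derived \<and> W.fam_inv (fmult FW A B) \<in> derived" if AB: "A \<in> obj C" "B \<in> obj C" for A B
  proof
    show "fmult FW A B \<in> derived"
      by (rule box_derived, rule N.collapsible_fmult) (use AB in simp_all)
    have "inverse_arrows word_cat (fmult FW A B) (W.fam_inv (fmult FW A B))"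
      using AB by (intro W.inverse_arrows_fam_inv) simp_all
    then show "W.fam_inv (fmult FW A B) \<in> derived"
      using AB by (intro box_derived[OF N.collapsible_fmult_inverse])
  qed
  show "funit FW \<in> derived \<and> W.fam_inv (funit FW) \<in> derived"
  proof
    show "funit FW \<in> derived"
      by (rule box_derived, rule N.collapsible_funit)
    have "inverse_arrows word_cat (funit FW) (W.fam_inv (funit FW))"
      by (intro W.inverse_arrows_fam_inv) simp_all
    then show "W.fam_inv (funit FW) \<in> derived"
      by (rule box_derived[OF N.collapsible_funit_inverse])
  qed
qed

lemma map_wire_split:
  assumes "map wire Ds = x @ map wire As @ y"
  obtains Xs Ys where "x = map wire Xs" "y = map wire Ys" "Ds = Xs @ As @ Ys"
proof -
  obtain Xs Es where 1: "Ds = Xs @ Es" "x = map wire Xs" "map wire As @ y = map wire Es"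
    using assms by (auto simp: map_eq_append_conv)
  obtain As' Ys where 2: "Es = As' @ Ys" "map wire As = map wire As'" "y = map wire Ys"
    using 1(3)[symmetric] by (auto simp: map_eq_append_conv)
  have "inj wire" by (auto simp: inj_def)
  then have "As = As'" using 2(2) by (simp add: inj_map_eq_map)
  then show thesis using that 1 2 by simp
qed

text \<open>In winding 0 every generator is a box. It rewrites a segment of a word of wires into
  another such segment, and whiskering and composing keep the result collapsible.\<close>

lemma wind_0_collapsible:
  assumes "Z.der {g \<in> alphabet. wind g = 0} v k w" "v = map wire As" "As \<in> lists (obj C)"
  shows "\<exists>Bs. w = map wire Bs \<and> N.collapsible As k Bs"
  using assms
proof (induction rule: Z.der.induct)
  case (der_idt v)
  then show ?case using N.collapsible_idt[of As] by auto
next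
  case (der_step v k x a y j b)
  then obtain Ds where Ds: "x @ a @ y = map wire Ds" "N.collapsible As k Ds" by auto
  have "a \<in> lists {g \<in> alphabet. wind g = 0}" using Z.der_lists[OF der_step(1)] by simp
  then have "box a j b" using Z.gen_wind_0 der_step(2,3) by blast
  then obtain As' Bs' where j: "a = map wire As'" "b = map wire Bs'" "N.collapsible As' j Bs'"
    unfolding box_def by blast
  obtain Xs Ys where xy: "x = map wire Xs" "y = map wire Ys" "Ds = Xs @ As' @ Ys"
    using map_wire_split[of Ds x As' y] Ds(1) j(1) by auto
  have "Xs \<in> lists (obj C)" "Ys \<in> lists (obj C)" using collapsible_FWD[OF Ds(2)] xy by auto
  then have "N.collapsible Ds (W.fam_lw x (W.fam_rw j y)) (Xs @ Bs' @ Ys)"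
    using N.collapsible_lw[OF N.collapsible_rw[OF j(3)], of Ys Xs] xy by simp
  from N.collapsible_cmp[OF Ds(2) this] show ?case
    using xy j(2) by (intro exI[of _ "Xs @ Bs' @ Ys"]) simp
qed

theorem derived_full:
  assumes "k \<in> derived" "W.fam_dom k = [wire A]" "W.fam_cod k = [wire B]"
  shows "\<exists>g \<in> hom C A B. k = farr FW g"
proof -
  let ?Q = "{g \<in> alphabet. wind g = 0}"
  have AB: "A \<in> obj C" "B \<in> obj C"
    using assms V.dom_in[OF assms(1)] V.cod_in[OF assms(1)] by auto
  have "Z.der alphabet [wire A] k [wire B]"
    using Z.der_mono[OF _ wires_sub] assms unfolding derived_def by fastforce
  then have "Z.der ?Q [wire A] k [wire B]"
    using AB by (intro Z.der_wind_0) auto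
  then have "\<exists>Bs. [wire B] = map wire Bs \<and> N.collapsible [A] k Bs"
    by (rule wind_0_collapsible) (use AB in simp_all)
  then have "N.collapsible [A] k [B]" by auto
  from N.collapsible_single[OF this] show ?thesis by simp
qed

end

section \<open>From the generated subcategory to all words, and fullness\<close>

lemma strong_monoidal_superset:
  assumes E: "monoidal_category E" and G: "strong_monoidal_functor X D G"
    and sub: "obj D \<subseteq> obj E" "arr D \<subseteq> arr E"
    and eq: "src D = src E" "trg D = trg E" "ident D = ident E" "comp D = comp E" "tensor_obj D = tensor_obj E"
      "tensor_arr D = tensor_arr E" "unit D = unit E" "assoc D = assoc E" "lunit D = lunit E" "runit D = runit E"
  shows "strong_monoidal_functor X E G"
proof -
  interpret G: strong_monoidal_functor X D G by (rule G)
  have h: "f \<in> hom D A B \<Longrightarrow> f \<in> hom E A B" for f A B using sub eq by (auto simp: in_hom_iff)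
  have i: "iso D f \<Longrightarrow> iso E f" for f
    using sub unfolding iso_def inverse_arrows_def in_hom_iff eq by blast
  show ?thesis
    by (intro strong_monoidal_functor.intro E G.C.monoidal_category_axioms strong_monoidal_functor_axioms.intro)
      (use sub(1) G.fobj_in_obj h[OF G.farr_in_hom] G.farr_ident G.farr_comp h[OF G.fmult_in_hom] i[OF G.fmult_iso] G.fmult_natural
        h[OF G.funit_in_hom] i[OF G.funit_iso] G.assoc_coherence G.lunit_coherence G.runit_coherence
        in \<open>auto simp: eq\<close>)
qed

lemma extension_superset:
  assumes E: "monoidal_category E" and ext: "extension_along C L F D G G' \<phi>"
    and sub: "obj D \<subseteq> obj E" "arr D \<subseteq> arr E"
    and eq: "src D = src E" "trg D = trg E" "ident D = ident E" "comp D = comp E" "tensor_obj D = tensor_obj E"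
      "tensor_arr D = tensor_arr E" "unit D = unit E" "assoc D = assoc E" "lunit D = lunit E" "runit D = runit E"
  shows "extension_along C L F E G G' \<phi>"
proof -
  have "strong_monoidal_functor L D G'" using ext unfolding extension_along_def by blast
  then have 1: "strong_monoidal_functor L E G'" by (rule strong_monoidal_superset[OF E _ sub eq])
  have h: "f \<in> hom D A B \<Longrightarrow> f \<in> hom E A B" for f A B using sub eq by (auto simp: in_hom_iff)
  have i: "iso D f \<Longrightarrow> iso E f" for f
    using sub unfolding iso_def inverse_arrows_def in_hom_iff eq by blast
  have "monfun_comp E G' F = monfun_comp D G' F" by (simp add: monfun_comp_def eq)
  then have "monoidal_nat_iso C E (monfun_comp E G' F) G \<phi>"
    using ext h i unfolding extension_along_def monoidal_nat_iso_def eq by auto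
  then show ?thesis using 1 unfolding extension_along_def by blast
qed

context autonomous_embedding
begin

text \<open>By \<open>fams_determined\<close>, an arrow is encoded by its two words and its
  component at the unit. Objects inside the letters are encoded by their identities.\<close>

lemma small_word_cat:
  assumes inf: "infinite (UNIV :: 'u set)" and C: "small_in TYPE('u) C" and L: "small_in TYPE('u) L"
  shows "small_in TYPE('u) word_cat"
proof -
  obtain i :: "'a \<Rightarrow> 'u" where i: "inj_on i (arr C)" using C unfolding small_in_def by blast
  obtain j :: "'b \<Rightarrow> 'u" where j: "inj_on j (arr L)" using L unfolding small_in_def by blast
  obtain p :: "'u \<times> 'u \<Rightarrow> 'u" where p: "inj p" using inj_pair_exists[OF inf] by blast
  obtain c :: "nat \<Rightarrow> 'u" where c: "inj c" using inj_nat_exists[OF inf] by blast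
  obtain e :: "'u list \<Rightarrow> 'u" where e: "inj e" using inj_list_exists[OF inf] by blast
  \<comment> \<open>An integer is encoded by its positive and its negative part.\<close>
  define z :: "int \<Rightarrow> 'u" where "z n = p (c (nat n), c (nat (- n)))" for n
  have z: "z m = z n \<longleftrightarrow> m = n" for m n
    unfolding z_def inj_eq[OF p] prod.inject inj_eq[OF c] by auto
  define g where "g x = (case x of Inl X \<Rightarrow> p (c 0, j (ident L X)) | Inr (A, n) \<Rightarrow> p (c 1, p (i (ident C A), z n)))" for x
  have ident: "A = B" if "A \<in> obj C" "B \<in> obj C" "ident C A = ident C B" for A B
    using that C.ident_simps(2) by metis
  have identL: "A = B" if "A \<in> obj L" "B \<in> obj L" "ident L A = ident L B" for A B
    using that D.ident_simps(2) by metis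
  have g: "inj_on g alphabet"
  proof (rule inj_onI)
    fix x y assume "x \<in> alphabet" "y \<in> alphabet" "g x = g y"
    then show "x = y"
      using p c z i j ident identL
      by (auto simp: alphabet_def wires_def g_def inj_eq inj_on_eq_iff)
  qed
  define h where "h f = p (e (map g (W.fam_dom f)), p (j (W.cmpt f (unit L)), e (map g (W.fam_cod f))))" for f
  have "inj_on h W.fams"
  proof (rule inj_onI)
    fix f f' assume f: "f \<in> W.fams" "f' \<in> W.fams" and "h f = h f'"
    then have *: "map g (W.fam_dom f) = map g (W.fam_dom f')" "map g (W.fam_cod f) = map g (W.fam_cod f')"
      "j (W.cmpt f (unit L)) = j (W.cmpt f' (unit L))"
      unfolding h_def by (auto simp: inj_eq[OF p] inj_eq[OF e])
    have map_g: "v = w" if "map g v = map g w" "v \<in> lists alphabet" "w \<in> lists alphabet" for v w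
      by (intro map_inj_on[OF that(1)] inj_on_subset[OF g]) (use that in auto)
    show "f = f'"
    proof (rule W.fams_determined[OF f])
      show "W.fam_dom f = W.fam_dom f'" "W.fam_cod f = W.fam_cod f'"
        using map_g * f W.fams_simps by blast+
      show "W.cmpt f (unit L) = W.cmpt f' (unit L)"
        using * j f W.fams_simps(3) D.unit_obj by (auto dest: inj_onD)
    qed
  qed
  then show ?thesis unfolding small_in_def by auto
qed

text \<open>\<open>LW\<close> after \<open>F\<close> writes \<open>F A\<close> as the letter
  \<open>Inl (fobj F A)\<close>, whereas \<open>FW\<close> writes it as \<open>wire A\<close>. Both
  letters denote the same object, and \<open>compare\<close> is the identity of that object read as
  an arrow between them.\<close>

definition compare :: "'o \<Rightarrow> ('p + 'o \<times> int) list \<times> ('p \<Rightarrow> 'b) \<times> ('p + 'o \<times> int) list" where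
  "compare = (\<lambda>A \<in> obj C. W.box_fam (Inl (fobj F A)) (ident L (fobj F A)) (wire A))"

lemma compare_simps [simp]:
  assumes "A \<in> obj C"
  shows "compare A = W.box_fam (Inl (fobj F A)) (ident L (fobj F A)) (wire A)"
  using assms by (simp add: compare_def)

lemma extension_LW: "extension_along C L F word_cat FW LW compare"
  unfolding extension_along_def monoidal_nat_iso_def
proof (intro conjI strong_LW ballI)
  show "compare \<in> extensional (obj C)" by (simp add: compare_def)
next
  fix A assume A: "A \<in> obj C"
  then show "compare A \<in> hom word_cat (fobj (monfun_comp word_cat LW F) A) (fobj FW A)"
    by (simp add: in_hom_iff monfun_comp_def)
  have "inverse_arrows word_cat (compare A) (W.fam_inv (compare A))"
    using A by (intro W.inverse_arrows_fam_inv) simp_all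
  then show "iso word_cat (compare A)" unfolding iso_def by blast
next
  fix A B f assume "A \<in> obj C" "B \<in> obj C" "f \<in> hom C A B"
  then show "compare B \<cdot>\<^bsub>word_cat\<^esub> farr (monfun_comp word_cat LW F) f = farr FW f \<cdot>\<^bsub>word_cat\<^esub> compare A"
    by (auto simp: in_hom_iff monfun_comp_def intro!: W.fam_eqI)
next
  fix A B assume "A \<in> obj C" "B \<in> obj C"
  then show "compare (A \<otimes>\<^bsub>C\<^esub> B) \<cdot>\<^bsub>word_cat\<^esub> fmult (monfun_comp word_cat LW F) A B
    = fmult FW A B \<cdot>\<^bsub>word_cat\<^esub> (compare A \<boxtimes>\<^bsub>word_cat\<^esub> compare B)"
    by (auto simp: monfun_comp_def intro!: W.fam_eqI)
next
  show "compare (unit C) \<cdot>\<^bsub>word_cat\<^esub> funit (monfun_comp word_cat LW F) = funit FW"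
    by (auto simp: monfun_comp_def intro!: W.fam_eqI)
qed

theorem full_if_free:
  assumes inf: "infinite (UNIV :: 'u set)" and C: "small_in TYPE('u) C" and L: "small_in TYPE('u) L"
    and free: "free_autonomous TYPE('u) C L F"
  shows "full_functor C L F"
  unfolding full_functor_def
proof (intro ballI)
  interpret DC: autonomous_category V.strict_moncat by (rule autonomous_derived)
  fix A B h assume A: "A \<in> obj C" and B: "B \<in> obj C" and h: "h \<in> hom L (fobj F A) (fobj F B)"
  note small = small_word_cat[OF inf C L]
  have small': "small_in TYPE('u) V.strict_moncat"
    using small derived_sub unfolding small_in_def by (auto intro: inj_on_subset)
  obtain G \<phi> where G: "extension_along C L F V.strict_moncat FW G \<phi>"
    using extension_exists[OF free autonomous_derived small' strong_FW_derived] by blast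
  \<comment> \<open>Regarded as an extension into all words, the extension into the generated
    subcategory can be compared with \<open>LW\<close>, whose values need not be generated.\<close>
  have "extension_along C L F word_cat FW G \<phi>"
    using derived_sub wires_sub lists_mono[OF wires_sub]
    by (intro extension_superset[OF W.monoidal_strict_moncat G]) (auto simp: fun_eq_iff)
  from extension_unique[OF free autonomous_word_cat small strong_FW this extension_LW]
  obtain \<theta> where \<theta>: "monoidal_nat_iso L word_cat G LW \<theta>"
    "\<And>A. A \<in> obj C \<Longrightarrow> compare A \<cdot>\<^bsub>word_cat\<^esub> \<theta> (fobj F A) = \<phi> A" by blast
  interpret G: strong_monoidal_functor L V.strict_moncat G
    using G unfolding extension_along_def by blast
  have \<phi>: "\<phi> A \<in> derived" "W.fam_dom (\<phi> A) = fobj G (fobj F A)" "W.fam_cod (\<phi> A) = [wire A]" "iso V.strict_moncat (\<phi> A)"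
    if "A \<in> obj C" for A
    using G that unfolding extension_along_def monoidal_nat_iso_def by (auto simp: in_hom_iff monfun_comp_def)
  have Gh: "farr G h \<in> derived" "W.fam_dom (farr G h) = fobj G (fobj F A)" "W.fam_cod (farr G h) = fobj G (fobj F B)"
    using G.farr_in_hom[OF h] by (auto simp: in_hom_iff)
  have h': "h \<in> arr L" "src L h = fobj F A" "trg L h = fobj F B" using h by (auto simp: in_hom_iff)
  let ?psi = "inverse_arr V.strict_moncat (\<phi> A)"
  have psi: "?psi \<in> derived" "W.fam_dom ?psi = [wire A]" "W.fam_cod ?psi = fobj G (fobj F A)"
    "W.fam_cmp (\<phi> A) ?psi = W.fam_idt [wire A]"
    using DC.inverse_simps[OF \<phi>(4)[OF A]] \<phi>[OF A] by simp_all
  \<comment> \<open>\<open>farr G h\<close> conjugated by \<open>\<phi>\<close> into an arrow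
    between the one-letter words of \<open>A\<close> and \<open>B\<close>. All three factors are
    built from generators, so \<open>derived_full\<close> applies.\<close>
  let ?k = "W.fam_cmp (\<phi> B) (W.fam_cmp (farr G h) ?psi)"
  have k: "?k \<in> derived" "W.fam_dom ?k = [wire A]" "W.fam_cod ?k = [wire B]"
    using psi Gh \<phi>[OF B] \<phi>[OF A] by (auto intro!: V.cmp_in)
  then obtain g where g: "g \<in> hom C A B" "?k = farr FW g" using derived_full by blast
  have \<theta>A: "\<theta> X \<in> W.fams \<and> W.fam_dom (\<theta> X) = fobj G X \<and> W.fam_cod (\<theta> X) = [Inl X]" if "X \<in> obj L" for X
    using \<theta>(1) that unfolding monoidal_nat_iso_def by (auto simp: in_hom_iff)
  have "\<theta> (fobj F B) \<cdot>\<^bsub>word_cat\<^esub> farr G h = farr LW h \<cdot>\<^bsub>word_cat\<^esub> \<theta> (fobj F A)"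
    using \<theta>(1) h fobj_in_obj[OF A] fobj_in_obj[OF B] unfolding monoidal_nat_iso_def by blast
  then have nat: "W.fam_cmp (\<theta> (fobj F B)) (farr G h) = W.fam_cmp (farr LW h) (\<theta> (fobj F A))"
    by (simp only: W.strict_moncat_sel)
  note fams = derived_sub[THEN subsetD]
  show "\<exists>g \<in> hom C A B. h = farr F g"
  proof
    show "g \<in> hom C A B" by (rule g)
    have [simp]: "\<theta> (fobj F A) \<in> W.fams" "\<theta> (fobj F B) \<in> W.fams" "farr G h \<in> W.fams" "?psi \<in> W.fams"
      using \<theta>A A B fams Gh psi by auto
    have [simp]: "W.fam_dom (\<theta> (fobj F A)) = fobj G (fobj F A)" "W.fam_cod (\<theta> (fobj F A)) = [Inl (fobj F A)]"
      "W.fam_dom (\<theta> (fobj F B)) = fobj G (fobj F B)" "W.fam_cod (\<theta> (fobj F B)) = [Inl (fobj F B)]"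
      using \<theta>A A B by auto
    note [simp] = A B h' Gh psi(2,3)
    have p: "W.fam_cmp (W.box_fam (Inl (fobj F A)) (ident L (fobj F A)) (wire A)) (\<theta> (fobj F A)) = \<phi> A"
      "W.fam_cmp (W.box_fam (Inl (fobj F B)) (ident L (fobj F B)) (wire B)) (\<theta> (fobj F B)) = \<phi> B"
      using \<theta>(2)[OF A] \<theta>(2)[OF B] A B by simp_all
    let ?c = "\<lambda>A. W.box_fam (Inl (fobj F A)) (ident L (fobj F A)) (wire A)"
    let ?h = "W.box_fam (wire A) h (wire B)"
    have sq: "W.fam_cmp (?c B) (farr LW h) = W.fam_cmp ?h (?c A)"
      by (auto intro!: W.fam_eqI)
    \<comment> \<open>Since \<open>\<phi>\<close> is \<open>compare\<close> after
      \<open>\<theta>\<close>, naturality of \<open>\<theta>\<close> exchanges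
      \<open>farr G h\<close> for \<open>farr LW h\<close>, and \<open>compare\<close> relabels the
      latter. Thus \<open>?k\<close> is \<open>h\<close> itself, read as a box between
      wires.\<close>
    have "?k = W.fam_cmp (?c B) (W.fam_cmp (W.fam_cmp (\<theta> (fobj F B)) (farr G h)) ?psi)"
      unfolding p(2)[symmetric] by simp
    also have "\<dots> = W.fam_cmp (W.fam_cmp (?c B) (farr LW h)) (W.fam_cmp (\<theta> (fobj F A)) ?psi)"
      unfolding nat by simp
    also have "\<dots> = W.fam_cmp ?h (W.fam_cmp (W.fam_cmp (?c A) (\<theta> (fobj F A))) ?psi)"
      unfolding sq by simp
    also have "\<dots> = ?h" unfolding p(1) psi(4) by simp
    \<comment> \<open>The component at the unit of a box is its arrow tensored with the unit;
      naturality of the right unitor then removes that factor.\<close>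
    finally have "W.cmpt ?h (unit L) = W.cmpt (farr FW g) (unit L)" using g(2) by simp
    then have eq: "h \<boxtimes>\<^bsub>L\<^esub> ident L (unit L) = farr F g \<boxtimes>\<^bsub>L\<^esub> ident L (unit L)"
      by simp
    have Fg: "farr F g \<in> hom L (fobj F A) (fobj F B)" using farr_in_hom g by blast
    have "h \<cdot>\<^bsub>L\<^esub> runit L (fobj F A) = farr F g \<cdot>\<^bsub>L\<^esub> runit L (fobj F A)"
      using D.runit_natural[OF h] D.runit_natural[OF Fg] eq by simp
    then show "h = farr F g"
      using Fg by (intro D.iso_cancel_right[of h "runit L (fobj F A)" "farr F g"]) (auto simp: in_hom_iff)
  qed
qed

end

theorem theorem2:
  fixes C :: "('o, 'a) moncat"
    and L :: "('p, 'b) moncat"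
    and F :: "('o, 'a, 'p, 'b) monfun"
  assumes "infinite (UNIV :: 'u set)"
    and "small_in TYPE('u) C"
    and "small_in TYPE('u) L"
    and "monoidal_category C"
    and "free_autonomous TYPE('u) C L F"
  shows "full_functor C L F"
proof -
  have "autonomous_embedding C L F"
    using assms(5) unfolding free_autonomous_def autonomous_embedding_def by blast
  then show ?thesis
    using assms by (intro autonomous_embedding.full_if_free)
qed

end
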